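(* Let $g\ge 2$, $k\ge 2$ and $r\ge -1$ be integers, let $\varphi:\widetilde\Gamma\to\Gamma$ be a uniform $k$-gonal folded chain of loops of genus $g$ (so $\Gamma$ has genus $g$ and $\widetilde\Gamma$ has genus $2g-1$), and let $l=\lceil k/2\rceil$. Then the codimension of the Prym--Brill--Noether locus $V^r(\Gamma,\varphi)$ relative to the Prym variety is $$n(r,k)=\begin{cases}\binom{l+1}{2}+l(r-l) & \text{if } l\le r-1,\\[2pt] \binom{r+1}{2} & \text{if } l>r-1.\end{cases}$$ Here a set of negative dimension is by convention empty: $V^r(\Gamma,\varphi)$ is empty if $n(r,k)>g-1$, and otherwise $\dim V^r(\Gamma,\varphi)=g-1-n(r,k)$.
   Context: Chain of loops. $\Gamma$ is a metric graph made of $g$ loops $\gamma_1,\dots,\gamma_g$. The loop $\gamma_a$ has a left vertex $l_a$ and a right vertex $r_a$, joined by an upper arc of length $\ell_a>0$ and a lower arc of length $m_a>0$; for $a<g$ the vertex $r_a$ is joined to $l_{a+1}$ by a bridge. The torsion of $\gamma_a$ is the least positive integer $k$ such that $k\,m_a$ is an integer multiple of $\ell_a+m_a$. The chain is uniform $k$-gonal if every loop has torsion $k$. Folded chain of loops. $\widetilde\Gamma$ is a chain of $2g-1$ loops $\widetilde\gamma_1,\dots,\widetilde\gamma_{2g-1}$, and $\varphi:\widetilde\Gamma\to\Gamma$ is the double cover such that: for $a<g$, each of $\widetilde\gamma_a$ and $\widetilde\gamma_{2g-a}$ maps isometrically onto $\gamma_a$; the middle loop $\widetilde\gamma_g$ consists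 of two edges, each of length $\ell_g+m_g$, joining two vertices which both lie over $l_g$, and each of these edges maps isometrically onto the loop $\gamma_g$; each bridge of $\Gamma$ from $r_a$ to $l_{a+1}$ has two isometric preimages, one joining $\widetilde\gamma_a$ to $\widetilde\gamma_{a+1}$ and one joining $\widetilde\gamma_{2g-a}$ to $\widetilde\gamma_{2g-a-1}$ (for $a=g-1$ these two bridges are attached to the two different vertices of $\widetilde\gamma_g$). The folded chain is called uniform $k$-gonal if $\Gamma$ is. Prym--Brill--Noether locus. Divisors on metric graphs, linear equivalence (chip-firing), the canonical divisor $K_\Gamma=\sum_v(\mathrm{val}(v)-2)v$ and the Baker--Norine rank $r(D)$ are the usual ones; $\varphi_*$ is the pushforward $\sum a_p\,p\mapsto\sum a_p\,\varphi(p)$ on divisor classes. Then $$V^r(\Gamma,\varphi)=\{[D]\in\mathrm{Pic}^{2g-2}(\widetilde\Gamma): \varphi_*[D]=[K_\Gamma],\ r(D)\ge r,\ r(D)\equiv r \bmod 2\}.$$ The fibre $\varphi_*^{-1}([K_\Gamma])$ is a disjoint union of two real tori of dimension $g-1$, each called a Prym variety, distinguished by the parity of the rank of their elements; $V^r(\Gamma,\varphi)$ lies in one of them, and codimension is taken relative to it. *)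

theory Defs
  imports "HOL-Analysis.Analysis" "HOL-Library.Function_Algebras"
begin

text \<open>
  The pointwise real vector space structure on functions makes the library's \<^const>\<open>convex\<close> hulls
  and \<open>affine_dependent\<close> available for real edge chains.
\<close>

instantiation "fun" :: (type, real_vector) real_vector
begin
definition scaleR_fun :: "real \<Rightarrow> ('a \<Rightarrow> 'b) \<Rightarrow> 'a \<Rightarrow> 'b"
  where "scaleR_fun c f = (\<lambda>x. c *\<^sub>R f x)"
instance
  by standard (simp_all add: scaleR_fun_def plus_fun_def fun_eq_iff scaleR_add_right scaleR_add_left)
end


section \<open>Metric graphs\<close>

text \<open>
  A metric graph is given by a finite model: the edge \<open>e\<close> is the segment from \<open>tail \<Gamma> e\<close> to
  \<open>head \<Gamma> e\<close> of length \<open>len \<Gamma> e\<close>.  Orientations are auxiliary.  Its points are the vertices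
  and the interior points \<open>Inner e t\<close>, where \<open>t\<close> is the distance from the tail along \<open>e\<close>.
\<close>

record ('v, 'e) mgraph =
  verts :: "'v set"
  edges :: "'e set"
  tail :: "'e \<Rightarrow> 'v"
  head :: "'e \<Rightarrow> 'v"
  len :: "'e \<Rightarrow> real"

datatype ('v, 'e) point = Vertex 'v | Inner 'e real

definition points :: "('v, 'e) mgraph \<Rightarrow> ('v, 'e) point set"
  where "points \<Gamma> = Vertex ` verts \<Gamma> \<union> {Inner e t | e t. e \<in> edges \<Gamma> \<and> 0 < t \<and> t < len \<Gamma> e}"


section \<open>Divisors and linear equivalence\<close>

type_synonym ('v, 'e) divisor = "('v, 'e) point \<Rightarrow> int"

definition divisors :: "('v, 'e) mgraph \<Rightarrow> ('v, 'e) divisor set"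
  where "divisors \<Gamma> = {D. finite {p. D p \<noteq> 0} \<and> {p. D p \<noteq> 0} \<subseteq> points \<Gamma>}"

definition deg :: "('v, 'e) divisor \<Rightarrow> int"
  where "deg D = (\<Sum>p | D p \<noteq> 0. D p)"

definition divisors_of_degree :: "('v, 'e) mgraph \<Rightarrow> int \<Rightarrow> ('v, 'e) divisor set"
  where "divisors_of_degree \<Gamma> d = {D \<in> divisors \<Gamma>. deg D = d}"

definition effective :: "('v, 'e) divisor \<Rightarrow> bool"
  where "effective D \<longleftrightarrow> (\<forall>p. 0 \<le> D p)"

definition valence :: "('v, 'e) mgraph \<Rightarrow> 'v \<Rightarrow> nat"
  where "valence \<Gamma> v = card {e \<in> edges \<Gamma>. tail \<Gamma> e = v} + card {e \<in> edges \<Gamma>. head \<Gamma> e = v}"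

text \<open>Points in the interior of an edge have valence 2 and hence do not contribute.\<close>

definition canonical :: "('v, 'e) mgraph \<Rightarrow> ('v, 'e) divisor"
  where "canonical \<Gamma> p =
    (case p of Vertex v \<Rightarrow> if v \<in> verts \<Gamma> then int (valence \<Gamma> v) - 2 else 0 | Inner e t \<Rightarrow> 0)"

text \<open>Piecewise linear with integer slopes on \<open>[0, c]\<close>; \<open>B\<close> is the set of breakpoints.\<close>

definition int_pl :: "real \<Rightarrow> (real \<Rightarrow> real) \<Rightarrow> bool"
  where "int_pl c h \<longleftrightarrow>
    (\<exists>B. finite B \<and>
      (\<forall>a b. 0 \<le> a \<and> a < b \<and> b \<le> c \<and> {a<..<b} \<inter> B = {} \<longrightarrow>
        (\<exists>n::int. \<forall>t\<in>{a..b}. h t = h a + of_int n * (t - a))))"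

definition right_slope :: "(real \<Rightarrow> real) \<Rightarrow> real \<Rightarrow> int"
  where "right_slope h t = (THE n. \<forall>\<^sub>F u in at_right t. h u = h t + of_int n * (u - t))"

text \<open>The left slope is the slope in the outgoing direction, away from \<open>t\<close>.\<close>

definition left_slope :: "(real \<Rightarrow> real) \<Rightarrow> real \<Rightarrow> int"
  where "left_slope h t = (THE n. \<forall>\<^sub>F u in at_left t. h u = h t + of_int n * (t - u))"

text \<open>
  The sum of the outgoing slopes at every point, for a family \<open>f\<close> of functions, \<open>f e\<close> being
  defined on the closed edge \<open>e\<close>.  The values of \<open>f\<close> need not agree at the vertices.
\<close>

definition div_of :: "('v, 'e) mgraph \<Rightarrow> ('e \<Rightarrow> real \<Rightarrow> real) \<Rightarrow> ('v, 'e) divisor"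
  where "div_of \<Gamma> f p =
    (if p \<notin> points \<Gamma> then 0
     else case p of
       Vertex v \<Rightarrow> (\<Sum>e | e \<in> edges \<Gamma> \<and> tail \<Gamma> e = v. right_slope (f e) 0) +
                   (\<Sum>e | e \<in> edges \<Gamma> \<and> head \<Gamma> e = v. left_slope (f e) (len \<Gamma> e))
     | Inner e t \<Rightarrow> right_slope (f e) t + left_slope (f e) t)"

definition rational_fun :: "('v, 'e) mgraph \<Rightarrow> ('e \<Rightarrow> real \<Rightarrow> real) \<Rightarrow> bool"
  where "rational_fun \<Gamma> f \<longleftrightarrow>
    (\<exists>h. \<forall>e\<in>edges \<Gamma>. int_pl (len \<Gamma> e) (f e) \<and>
          f e 0 = h (tail \<Gamma> e) \<and> f e (len \<Gamma> e) = h (head \<Gamma> e))"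

definition lin_equiv :: "('v, 'e) mgraph \<Rightarrow> ('v, 'e) divisor \<Rightarrow> ('v, 'e) divisor \<Rightarrow> bool"
  where "lin_equiv \<Gamma> D D' \<longleftrightarrow> (\<exists>f. rational_fun \<Gamma> f \<and> D' = D + div_of \<Gamma> f)"

text \<open>Elements of the Picard group are represented as linear equivalence classes.\<close>

definition div_class :: "('v, 'e) mgraph \<Rightarrow> ('v, 'e) divisor \<Rightarrow> ('v, 'e) divisor set"
  where "div_class \<Gamma> D = {D' \<in> divisors \<Gamma>. lin_equiv \<Gamma> D D'}"

text \<open>
  The Baker--Norine rank.  For \<open>k = - 1\<close> the condition is vacuous, and if \<open>D\<close> is not
  equivalent to an effective divisor, then it fails for all \<open>k \<ge> 0\<close>.
\<close>

definition rank_div :: "('v, 'e) mgraph \<Rightarrow> ('v, 'e) divisor \<Rightarrow> int"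
  where "rank_div \<Gamma> D = (GREATEST k. - 1 \<le> k \<and>
    (\<forall>E\<in>divisors_of_degree \<Gamma> k. effective E \<longrightarrow>
      (\<exists>D'. lin_equiv \<Gamma> (D - E) D' \<and> effective D')))"

definition pushforward :: "(('v, 'e) point \<Rightarrow> ('w, 'f) point) \<Rightarrow> ('v, 'e) divisor \<Rightarrow> ('w, 'f) divisor"
  where "pushforward \<phi> D q = (\<Sum>p | D p \<noteq> 0 \<and> \<phi> p = q. D p)"


section \<open>Dimension of subsets of the Picard torus\<close>

text \<open>The real first homology, as a space of chains supported on the edges.\<close>

definition homology1 :: "('v, 'e) mgraph \<Rightarrow> ('e \<Rightarrow> real) set"
  where "homology1 \<Gamma> = {\<omega>. (\<forall>e. e \<notin> edges \<Gamma> \<longrightarrow> \<omega> e = 0) \<and>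
    (\<forall>v\<in>verts \<Gamma>. (\<Sum>e | e \<in> edges \<Gamma> \<and> tail \<Gamma> e = v. \<omega> e) =
                 (\<Sum>e | e \<in> edges \<Gamma> \<and> head \<Gamma> e = v. \<omega> e))}"

text \<open>
  For \<open>\<Gamma>\<close> connected and \<open>D\<^sub>0\<close> of degree \<open>d\<close>, the map \<open>pic_cover \<Gamma> D\<^sub>0\<close> on \<open>homology1 \<Gamma>\<close> is the
  universal covering of the torus of divisor classes of degree \<open>d\<close>; it inverts the Abel--Jacobi
  isomorphism.  Indeed, a divisor \<open>D\<close> with \<open>D - D\<^sub>0 = div_of \<Gamma> f\<close> is the translate of \<open>D\<^sub>0\<close> by the
  boundary (up to a global sign) of the integral 1-chain given by the slopes of \<open>f\<close>.  The integral
  of a harmonic form \<open>\<eta>\<close> over that chain is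
  \<open>\<Sum>e. \<eta> e * (f e (len \<Gamma> e) - f e 0) = \<Sum>e. len \<Gamma> e * \<eta> e * \<omega> e\<close>,
  the pairing of \<open>\<eta>\<close> with \<open>\<omega>\<close> by which \<open>homology1 \<Gamma>\<close> is identified with the dual of the space of
  harmonic forms.  The value of \<open>pic_cover\<close> is a full linear equivalence class, two values being
  equal iff their arguments differ by an integral cycle; for \<open>\<omega> = 0\<close> it is the class of \<open>D\<^sub>0\<close>.
\<close>

definition pic_cover ::
    "('v, 'e) mgraph \<Rightarrow> ('v, 'e) divisor \<Rightarrow> ('e \<Rightarrow> real) \<Rightarrow> ('v, 'e) divisor set"
  where "pic_cover \<Gamma> D\<^sub>0 \<omega> = {D\<^sub>0 + div_of \<Gamma> f | f.
    \<exists>h. \<forall>e\<in>edges \<Gamma>. int_pl (len \<Gamma> e) (f e) \<and>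
      f e 0 = h (tail \<Gamma> e) \<and> f e (len \<Gamma> e) = h (head \<Gamma> e) + len \<Gamma> e * \<omega> e}"

text \<open>
  A nonempty compact polyhedral set \<open>S\<close> of divisor classes of degree \<open>d\<close> has dimension \<open>n\<close> if it is
  the union of the images of finitely many nonempty simplices in the universal covering, the
  largest of which has dimension \<open>n\<close>.  Since the covering is a local isometry, \<open>n\<close> does not depend
  on the choices and is also the topological dimension of \<open>S\<close>.  Each simplex is given by its
  vertex set \<open>C\<close>.
\<close>

definition has_pic_dim ::
    "('v, 'e) mgraph \<Rightarrow> int \<Rightarrow> ('v, 'e) divisor set set \<Rightarrow> int \<Rightarrow> bool"
  where "has_pic_dim \<Gamma> d S n \<longleftrightarrow>
    (\<exists>D\<^sub>0\<in>divisors_of_degree \<Gamma> d. \<exists>\<C>. finite \<C> \<and> \<C> \<noteq> {} \<and>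
      (\<forall>C\<in>\<C>. finite C \<and> C \<noteq> {} \<and> C \<subseteq> homology1 \<Gamma> \<and> \<not> affine_dependent C) \<and>
      S = (\<Union>C\<in>\<C>. pic_cover \<Gamma> D\<^sub>0 ` (convex hull C)) \<and>
      n = int (Max (card ` \<C>)) - 1)"


section \<open>The Prym--Brill--Noether locus\<close>

text \<open>
  Here \<open>\<phi>\<close> maps the points of \<open>\<Gamma>'\<close> to those of \<open>\<Gamma>\<close>, and \<open>g\<close> is the genus of \<open>\<Gamma>\<close>.
\<close>

definition prym_brill_noether ::
    "('v, 'e) mgraph \<Rightarrow> ('w, 'f) mgraph \<Rightarrow> (('v, 'e) point \<Rightarrow> ('w, 'f) point) \<Rightarrow> nat \<Rightarrow> int
      \<Rightarrow> ('v, 'e) divisor set set"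
  where "prym_brill_noether \<Gamma>' \<Gamma> \<phi> g r = {div_class \<Gamma>' D | D.
    D \<in> divisors_of_degree \<Gamma>' (2 * int g - 2) \<and>
    div_class \<Gamma> (pushforward \<phi> D) = div_class \<Gamma> (canonical \<Gamma>) \<and>
    r \<le> rank_div \<Gamma>' D \<and> rank_div \<Gamma>' D mod 2 = r mod 2}"


section \<open>Chains of loops and folded chains of loops\<close>

datatype chain_vertex = LeftV nat | RightV nat

datatype chain_edge = Upper nat | Lower nat | Bridge nat

text \<open>
  The chain of \<open>n\<close> loops, indexed by \<open>1, \<dots>, n\<close>.  The arcs of loop \<open>a\<close> run from its left to its
  right vertex and have lengths \<open>\<l> a\<close> and \<open>m a\<close>; the bridge after loop \<open>a\<close> has length \<open>b a\<close>.
\<close>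

definition chain_of_loops ::
    "nat \<Rightarrow> (nat \<Rightarrow> real) \<Rightarrow> (nat \<Rightarrow> real) \<Rightarrow> (nat \<Rightarrow> real) \<Rightarrow> (chain_vertex, chain_edge) mgraph"
  where "chain_of_loops n \<l> m b = \<lparr>
    verts = LeftV ` {1..n} \<union> RightV ` {1..n},
    edges = Upper ` {1..n} \<union> Lower ` {1..n} \<union> Bridge ` {1..<n},
    tail = (\<lambda>e. case e of Upper a \<Rightarrow> LeftV a | Lower a \<Rightarrow> LeftV a | Bridge a \<Rightarrow> RightV a),
    head = (\<lambda>e. case e of Upper a \<Rightarrow> RightV a | Lower a \<Rightarrow> RightV a | Bridge a \<Rightarrow> LeftV (a + 1)),
    len = (\<lambda>e. case e of Upper a \<Rightarrow> \<l> a | Lower a \<Rightarrow> m a | Bridge a \<Rightarrow> b a)\<rparr>"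

text \<open>
  \<open>k\<close> is the torsion of a loop with arcs of lengths \<open>x\<close> and \<open>y\<close>.  This is a relation because the
  torsion need not exist.
\<close>

definition has_torsion :: "real \<Rightarrow> real \<Rightarrow> nat \<Rightarrow> bool"
  where "has_torsion x y k \<longleftrightarrow>
    0 < k \<and> (\<exists>z::int. real k * y = of_int z * (x + y)) \<and>
    (\<forall>j. 0 < j \<and> (\<exists>z::int. real j * y = of_int z * (x + y)) \<longrightarrow> k \<le> j)"

definition uniform_gonal :: "nat \<Rightarrow> (nat \<Rightarrow> real) \<Rightarrow> (nat \<Rightarrow> real) \<Rightarrow> nat \<Rightarrow> bool"
  where "uniform_gonal g \<l> m k \<longleftrightarrow> (\<forall>a\<in>{1..g}. has_torsion (\<l> a) (m a) k)"

text \<open>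
  The folded chain of loops over \<open>chain_of_loops g \<l> m b\<close>.  Loop \<open>a\<close> and loop \<open>2 * g - a\<close> cover
  loop \<open>a\<close>; the bridges after loop \<open>a\<close> and after loop \<open>2 * g - a - 1\<close> cover the bridge after
  loop \<open>a\<close>.
\<close>

definition folded_chain ::
    "nat \<Rightarrow> (nat \<Rightarrow> real) \<Rightarrow> (nat \<Rightarrow> real) \<Rightarrow> (nat \<Rightarrow> real) \<Rightarrow> (chain_vertex, chain_edge) mgraph"
  where "folded_chain g \<l> m b = chain_of_loops (2 * g - 1)
    (\<lambda>a. if a < g then \<l> a else if a = g then \<l> g + m g else \<l> (2 * g - a))
    (\<lambda>a. if a < g then m a else if a = g then \<l> g + m g else m (2 * g - a))
    (\<lambda>a. if a < g then b a else b (2 * g - 1 - a))"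

text \<open>
  The double cover.  On the second half of the folded chain left and right are exchanged, so that
  interior points are reparametrised from the other end.  The upper edge of the middle loop,
  read from left to right, runs along the upper arc of loop \<open>g\<close> and returns along the lower one;
  the lower edge runs along the lower arc and returns along the upper one.  In this way the
  middle loop is a connected double cover of loop \<open>g\<close>.
\<close>

fun folding_map ::
    "nat \<Rightarrow> (nat \<Rightarrow> real) \<Rightarrow> (nat \<Rightarrow> real) \<Rightarrow> (nat \<Rightarrow> real)
      \<Rightarrow> (chain_vertex, chain_edge) point \<Rightarrow> (chain_vertex, chain_edge) point"
  where
    "folding_map g \<l> m b (Vertex (LeftV a)) =
      Vertex (if a \<le> g then LeftV a else RightV (2 * g - a))"
  | "folding_map g \<l> m b (Vertex (RightV a)) =
      Vertex (if a < g then RightV a else LeftV (2 * g - a))"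
  | "folding_map g \<l> m b (Inner (Upper a) t) =
      (if a < g then Inner (Upper a) t
       else if a > g then Inner (Upper (2 * g - a)) (\<l> (2 * g - a) - t)
       else if t < \<l> g then Inner (Upper g) t
       else if t = \<l> g then Vertex (RightV g)
       else Inner (Lower g) (\<l> g + m g - t))"
  | "folding_map g \<l> m b (Inner (Lower a) t) =
      (if a < g then Inner (Lower a) t
       else if a > g then Inner (Lower (2 * g - a)) (m (2 * g - a) - t)
       else if t < m g then Inner (Lower g) t
       else if t = m g then Vertex (RightV g)
       else Inner (Upper g) (\<l> g + m g - t))"
  | "folding_map g \<l> m b (Inner (Bridge a) t) =
      (if a < g then Inner (Bridge a) t
       else Inner (Bridge (2 * g - 1 - a)) (b (2 * g - 1 - a) - t))"

definition pbn_codim :: "int \<Rightarrow> nat \<Rightarrow> int"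
  where "pbn_codim r k =
    (let l = \<lceil>real k / 2\<rceil> in
      if l \<le> r - 1 then int ((nat l + 1) choose 2) + l * (r - l)
      else int (nat (r + 1) choose 2))"

end

theory Submission
  imports Defs
begin

text \<open>
  By Abel--Jacobi theory a divisor class on a chain of loops is given by its degree and one
  coordinate on each loop.  Whether it is effective, and hence its rank, only depends on the places
  where the coordinate of a loop is a multiple of its upper arc; they form a residue class modulo the
  torsion, or there are none.  On passing a loop the ranks of the restrictions to the left change as
  a \<open>k\<close>-core does when all addable boxes of one residue are added.

  The Prym condition makes the right half of the folded chain mirror the left half and makes the
  middle loop special.  The rank has the parity prescribed by the middle loop.  For \<open>r\<close> of this parity
  it is at least \<open>r\<close> iff the core of the first \<open>g - 1\<close> loops contains the staircase \<open>(r, r - 1, \<dots>, 1)\<close>.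
  So the locus is a union of tori, one for each partial assignment of residues
  to the loops whose core contains the staircase, and its codimension is the least number of
  residues in such an assignment.  For the lower bound the core is put on an abacus, where the
  number of steps is a sum over pairs of runners; for the upper bound there is an explicit word.
\<close>

section \<open>Profiles of cores\<close>

text \<open>Cores enter through a game. Let \<open>u\<close> be the number of chips beyond loop
  \<open>a\<close>, and put x = d + 1 - a - u. The least number of chips whose removal from the left
  part can make \<open>u\<close> unattainable is (h x + x) / 2, where \<open>h\<close> is the
  profile after \<open>a\<close> loops; a loop raises this number exactly at the local minima of
  \<open>h\<close> at which it is special. The mirrored right half has the cost (h x - x) / 2 with
  the same \<open>h\<close>. The two costs add up to h x, so the rank is min h or min h - 1. The
  middle loop decides which, and this is where the condition r <= h x for all x comes from.

  Counting boxes does not give the lower bound for the number of letters, since one letter may add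
  many boxes at once. The weight of an abacus does: a letter raises it by at most 2, however many
  boxes it adds, and half of it is the length of an affine Grassmannian permutation. The numbers r -
  i in the codimension appear because the profile, evaluated next to the first bead of the i-th
  runner, is a row sum of the weight plus i.\<close>

text \<open>
  A partition is encoded by the function \<open>h\<close> with \<open>h x = \<bar>x\<bar> + 2 * b\<close>, where \<open>b\<close> is the number of its
  boxes of content \<open>x\<close>.  Its addable boxes are the local minima of \<open>h\<close>, and it contains the staircase
  \<open>(r, r - 1, \<dots>, 1)\<close> iff \<open>r \<le> h x\<close> for all \<open>x\<close>.
\<close>

definition raise_minima :: "(int \<Rightarrow> bool) \<Rightarrow> (int \<Rightarrow> int) \<Rightarrow> int \<Rightarrow> int"
  where "raise_minima P h x =
    (if P x \<and> h (x - 1) = h x + 1 \<and> h (x + 1) = h x + 1 then h x + 2 else h x)"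

primrec profile :: "(nat \<Rightarrow> int \<Rightarrow> bool) \<Rightarrow> nat \<Rightarrow> int \<Rightarrow> int" where
  "profile c 0 = (\<lambda>x. \<bar>x\<bar>)"
| "profile c (Suc a) = raise_minima (c (Suc a)) (profile c a)"

definition is_profile :: "(int \<Rightarrow> int) \<Rightarrow> bool"
  where "is_profile h \<longleftrightarrow> (\<forall>x. \<bar>h (x + 1) - h x\<bar> = 1) \<and> (\<forall>x. \<bar>x\<bar> \<le> h x) \<and> (\<forall>x. even (h x + x))"

lemma is_profileD:
  assumes "is_profile h"
  shows "h (x + 1) = h x + 1 \<or> h (x + 1) = h x - 1"
    and "h (x - 1) = h x + 1 \<or> h (x - 1) = h x - 1"
    and "\<bar>x\<bar> \<le> h x" and "even (h x + x)"
proof -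
  have *: "\<bar>h (y + 1) - h y\<bar> = 1" for y using assms by (auto simp: is_profile_def)
  show "h (x + 1) = h x + 1 \<or> h (x + 1) = h x - 1" using *[of x] by linarith
  show "h (x - 1) = h x + 1 \<or> h (x - 1) = h x - 1" using *[of "x - 1"] by (simp; linarith)
  show "\<bar>x\<bar> \<le> h x" "even (h x + x)" using assms by (auto simp: is_profile_def)
qed

lemma is_profile_raise_minima:
  assumes "is_profile h"
  shows "is_profile (raise_minima P h)"
proof -
  let ?h = "raise_minima P h"
  have "\<bar>?h (x + 1) - ?h x\<bar> = 1" for x
  proof -
    have e: "x + 1 - 1 = x" "x + 1 + 1 = x + 2" by auto
    \<comment> \<open>With w, a, b, d the values of \<open>h\<close> at x - 1, ..., x + 2 this is a
      finite case check: two neighbouring positions are never both minima.\<close>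
    have "\<bar>(if P (x+1) \<and> a = b + 1 \<and> d = b + 1 then b + 2 else b) -
           (if P x \<and> w = a + 1 \<and> b = a + 1 then a + 2 else a)\<bar> = 1"
      if "b = a + 1 \<or> b = a - 1" for a b d w :: int
      using that by auto
    then show ?thesis
      unfolding raise_minima_def e using is_profileD(1)[OF assms, of x] by blast
  qed
  moreover have "\<bar>x\<bar> \<le> ?h x" for x
    using is_profileD(3)[OF assms, of x] by (auto simp: raise_minima_def)
  moreover have "even (?h x + x)" for x
    using is_profileD(4)[OF assms, of x] by (auto simp: raise_minima_def)
  ultimately show ?thesis by (auto simp: is_profile_def)
qed

lemma is_profile_abs: "is_profile (\<lambda>x. \<bar>x\<bar>)"
  unfolding is_profile_def
proof (intro conjI allI)
  fix x :: int
  show "\<bar>\<bar>x + 1\<bar> - \<bar>x\<bar>\<bar> = 1" by linarith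
  show "even (\<bar>x\<bar> + x)" by (cases "x \<ge> 0") auto
qed simp

lemma is_profile_profile: "is_profile (profile c a)"
  by (induction a) (auto intro: is_profile_abs is_profile_raise_minima)

text \<open>Only local minima are raised, and the absolute value has its only one at 0. So the
  region in which the profile differs from that of the empty partition grows by at most one position
  on either side per step.\<close>

lemma profile_eq_abs: "int a \<le> \<bar>x\<bar> \<Longrightarrow> profile c a x = \<bar>x\<bar>"
proof (induction a arbitrary: x)
  case (Suc a)
  have "profile c a x = \<bar>x\<bar>" using Suc by auto
  moreover have "profile c a (x - 1) = \<bar>x - 1\<bar>" using Suc.IH[of "x-1"] Suc.prems by linarith
  moreover have "profile c a (x + 1) = \<bar>x + 1\<bar>" using Suc.IH[of "x+1"] Suc.prems by linarith
  moreover have "x \<noteq> 0" using Suc.prems by auto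
  ultimately show ?case by (simp add: raise_minima_def)
qed simp

lemma profile_cong:
  "(\<And>i. 1 \<le> i \<Longrightarrow> i \<le> a \<Longrightarrow> c i = c' i) \<Longrightarrow> profile c a = profile c' a"
  by (induction a) auto

text \<open>By parity \<open>h\<close> and \<open>h'\<close> agree at x or differ by at least 2. If
  they agree at a minimum of \<open>h\<close>, then it is a minimum of \<open>h'\<close> as well,
  because the neighbouring values of \<open>h'\<close> are at least as large.\<close>

lemma raise_minima_mono:
  assumes "is_profile h" "is_profile h'" "\<And>x. h x \<le> h' x" "\<And>x. P x \<Longrightarrow> P' x"
  shows "raise_minima P h x \<le> raise_minima P' h' x"
proof -
  have "h' x = h x \<or> h' x \<ge> h x + 2"
    using is_profileD(4)[OF assms(1), of x] is_profileD(4)[OF assms(2), of x] assms(3)[of x]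
    by presburger
  then show ?thesis
    using assms(3)[of "x+1"] assms(3)[of "x-1"] is_profileD(1,2)[OF assms(2), of x] assms(4)[of x] assms(3)[of x]
    by (auto simp: raise_minima_def)
qed

text \<open>Additional letters never shrink the core. This is what puts whole tori into the locus: a
  class on a torus may be special on more loops than the assignment of residues demands.\<close>

lemma profile_mono:
  assumes "\<And>i x. 1 \<le> i \<Longrightarrow> i \<le> a \<Longrightarrow> c i x \<Longrightarrow> c' i x"
  shows "profile c a x \<le> profile c' a x"
  using assms
proof (induction a arbitrary: x)
  case (Suc a)
  show ?case unfolding profile.simps
    by (rule raise_minima_mono) (use Suc is_profile_profile in auto)
qed simp

lemma profile_False:
  assumes "\<And>i. n < i \<Longrightarrow> i \<le> n + d \<Longrightarrow> c i = (\<lambda>_. False)"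
  shows "profile c (n + d) = profile c n"
  using assms by (induction d) (auto simp: raise_minima_def fun_eq_iff)

text \<open>Conjugation of partitions. It identifies the profile of the right half, read from the
  right end, with that of the left half.\<close>

lemma profile_reflect: "profile (\<lambda>a x. c a (- x)) a x = profile c a (- x)"
  by (induction a arbitrary: x) (auto simp: raise_minima_def)

text \<open>The costs (h x + x) / 2 and (h x - x) / 2 of the game are monotone in x and change by at
  most one per unit.\<close>

lemma profile_add_mono:
  assumes "is_profile h" and "x \<le> y"
  shows "h x + x \<le> h y + y" and "h y - y \<le> h x - x"
    and "h y + y \<le> h x + x + 2 * (y - x)" and "h x - x \<le> h y - y + 2 * (y - x)"
proof -
  have "h x + x \<le> h (x + int n) + (x + int n) \<and> h (x + int n) - (x + int n) \<le> h x - x" for n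
  proof (induction n)
    case (Suc n)
    then show ?case using is_profileD(1)[OF assms(1), of "x + int n"] by (auto simp: algebra_simps)
  qed simp
  from this[of "nat (y - x)"] show "h x + x \<le> h y + y" "h y - y \<le> h x - x"
    using assms(2) by auto
  then show "h y + y \<le> h x + x + 2 * (y - x)" "h x - x \<le> h y - y + 2 * (y - x)"
    by (simp_all add: algebra_simps)
qed

section \<open>The least number of letters\<close>

text \<open>The codimension n(r, k), in the form in which the abacus produces it: one summand for
  each pair of opposite runners and, for odd \<open>k\<close>, one for the middle runner.\<close>

definition staircase_cost :: "int \<Rightarrow> nat \<Rightarrow> int"
  where "staircase_cost r k = (\<Sum>i<(k + 1) div 2. max 0 (r - int i))"

text \<open>
  Reading a profile as the boundary of a \<open>k\<close>-core, \<open>\<beta> i\<close> is the first bead on the \<open>i\<close>-th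
  runner of its abacus, and \<open>runner_count k \<beta> i x\<close> the signed number of beads moved past \<open>x\<close>.
\<close>

definition runner_count :: "nat \<Rightarrow> (nat \<Rightarrow> int) \<Rightarrow> nat \<Rightarrow> int \<Rightarrow> int"
  where "runner_count k \<beta> i x = (x - \<beta> i) div int k + 1"

definition abacus_profile :: "nat \<Rightarrow> (nat \<Rightarrow> int) \<Rightarrow> int \<Rightarrow> int"
  where "abacus_profile k \<beta> x = (\<Sum>i<k. \<bar>runner_count k \<beta> i x\<bar>)"

text \<open>The runners are numbered by the order of their first beads and not by residue, so that
  \<open>i\<close> is the number of runners starting before the i-th one. This number is the
  correction term in all later bounds.\<close>

definition abacus :: "nat \<Rightarrow> (nat \<Rightarrow> int) \<Rightarrow> bool"
  where "abacus k \<beta> \<longleftrightarrow> strict_mono_on {..<k} \<beta> \<and> inj_on (\<lambda>i. \<beta> i mod int k) {..<k}"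

text \<open>Half of this sum over ordered pairs is Shi's formula for the length of the affine
  Grassmannian permutation with window \<open>\<beta>\<close>.\<close>

definition abacus_weight :: "nat \<Rightarrow> (nat \<Rightarrow> int) \<Rightarrow> int"
  where "abacus_weight k \<beta> = (\<Sum>i<k. \<Sum>j<k. \<bar>\<beta> j - \<beta> i\<bar> div int k)"

section \<open>Letters acting on an abacus\<close>

lemma abacus_runner:
  assumes "abacus k \<beta>" "0 < k"
  obtains i where "i < k" "\<beta> i mod int k = s mod int k"
proof -
  have "(\<lambda>i. \<beta> i mod int k) ` {..<k} = {0..<int k}"
  proof (rule card_subset_eq)
    show "(\<lambda>i. \<beta> i mod int k) ` {..<k} \<subseteq> {0..<int k}" using assms by auto
    show "card ((\<lambda>i. \<beta> i mod int k) ` {..<k}) = card {0..<int k}"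
      using assms by (auto simp: abacus_def card_image)
  qed simp
  moreover have "s mod int k \<in> {0..<int k}" using assms by auto
  ultimately have "s mod int k \<in> (\<lambda>i. \<beta> i mod int k) ` {..<k}" by simp
  then obtain i where "i < k" "s mod int k = \<beta> i mod int k" by auto
  then show thesis using that by metis
qed

lemma abacus_unique:
  assumes "abacus k \<beta>" "i < k" "j < k" "\<beta> i mod int k = \<beta> j mod int k"
  shows "i = j"
  using assms by (auto simp: abacus_def dest: inj_onD)

lemma div_int_add_one:
  fixes a k :: int
  assumes "0 < k"
  shows "(a + 1) div k = (if (a + 1) mod k = 0 then a div k + 1 else a div k)"
proof (cases "(a + 1) mod k = 0")
  case True
  then obtain q where q: "a + 1 = k * q" by auto
  then have "a = k * (q - 1) + (k - 1)" by (simp add: algebra_simps)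
  then have "a div k = q - 1" using assms by (simp add: div_mult_self4)
  then show ?thesis using q assms True by simp
next
  case False
  have a: "a = k * (a div k) + a mod k" by simp
  have "a mod k \<noteq> k - 1"
  proof
    assume "a mod k = k - 1"
    then have "(a + 1) mod k = 0" by (metis add.commute add_diff_cancel_left' diff_add_cancel mod_add_left_eq mod_self)
    then show False using False by simp
  qed
  then have "0 \<le> a mod k + 1" "a mod k + 1 < k" using assms pos_mod_bound[of k a] pos_mod_sign[of k a] by linarith+
  moreover have "a + 1 = k * (a div k) + (a mod k + 1)" using a by linarith
  ultimately have "(a + 1) div k = a div k" by (metis div_mult_self4 div_pos_pos_trivial add.right_neutral less_irrefl assms)
  then show ?thesis using False by simp
qed

lemma runner_count_step:
  assumes "0 < k"
  shows "runner_count k \<beta> i (x + 1) =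
    (if (x + 1) mod int k = \<beta> i mod int k then runner_count k \<beta> i x + 1 else runner_count k \<beta> i x)"
proof -
  have "((x - \<beta> i) + 1) mod int k = 0 \<longleftrightarrow> (x + 1) mod int k = \<beta> i mod int k"
    by (metis add_diff_eq diff_add_eq mod_eq_dvd_iff dvd_eq_mod_eq_0)
  then show ?thesis using div_int_add_one[of "int k" "x - \<beta> i"] assms
    by (simp add: runner_count_def algebra_simps)
qed

lemma runner_count_pos_iff: "0 < k \<Longrightarrow> 0 < runner_count k \<beta> i x \<longleftrightarrow> \<beta> i \<le> x"
  unfolding runner_count_def using pos_imp_zdiv_nonneg_iff[of "int k" "x - \<beta> i"] by auto

text \<open>Only the runner through x + 1 changes its signed count. Hence the profile goes up on the
  way to x + 1 iff there is a bead at x + 1.\<close>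

lemma abacus_profile_step:
  assumes "abacus k \<beta>" "i < k" "\<beta> i mod int k = (x + 1) mod int k"
  shows "abacus_profile k \<beta> (x + 1) = abacus_profile k \<beta> x + (if \<beta> i \<le> x + 1 then 1 else - 1)"
proof -
  have k: "0 < k" using assms(2) by simp
  have *: "\<bar>runner_count k \<beta> m (x + 1)\<bar> =
      \<bar>runner_count k \<beta> m x\<bar> + (if m = i then (if \<beta> i \<le> x + 1 then 1 else - 1) else 0)"
    if "m < k" for m
  proof (cases "m = i")
    case True
    then have "runner_count k \<beta> m (x + 1) = runner_count k \<beta> m x + 1"
      using runner_count_step[OF k, of \<beta> i x] assms by simp
    then show ?thesis using True runner_count_pos_iff[OF k, of \<beta> i "x + 1"] by auto
  next
    case False
    then have "(x + 1) mod int k \<noteq> \<beta> m mod int k"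
      using abacus_unique[OF assms(1) that assms(2)] assms(3) by auto
    then show ?thesis using runner_count_step[OF k, of \<beta> m x] False by simp
  qed
  show ?thesis
    unfolding abacus_profile_def using * assms(2) by (simp add: sum.distrib)
qed

lemma diff_mod_eq_0_iff: "(a - b) mod k = 0 \<longleftrightarrow> a mod k = b mod k" for a b k :: int
  by (metis mod_eq_dvd_iff dvd_eq_mod_eq_0)

lemma abs_add_one_div:
  fixes d k :: int
  assumes "0 < k" "d mod k \<noteq> 0" "(d + 1) mod k \<noteq> 0"
  shows "\<bar>d + 1\<bar> div k = \<bar>d\<bar> div k"
proof (cases "d \<ge> 0")
  case True
  then show ?thesis using div_int_add_one[of k d] assms by simp
next
  case False
  have "(- d) mod k \<noteq> 0" using assms(2) by (simp add: mod_eq_0_iff_dvd)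
  then have "(- d) div k = (- d - 1) div k"
    using div_int_add_one[of k "- d - 1"] assms by simp
  then show ?thesis using False by simp
qed

text \<open>A minimum at x means that there is no bead at x but one at x + 1. For x of residue
  \<open>s\<close> this concerns the runners \<open>j\<close> and \<open>i\<close> of residues s and
  s + 1, and it happens for some x iff \<beta> i < \<beta> j. Raising all these minima exchanges the
  beads of the two runners: the first bead of \<open>i\<close> moves down by one and that of
  \<open>j\<close> up by one. Among all differences of first beads only that of \<open>i\<close> and
  \<open>j\<close> reaches a new multiple of \<open>k\<close>, and it occurs in both orders.\<close>

lemma abacus_raise_minima:
  assumes ab: "abacus k \<beta>" and k: "2 \<le> k"
  shows "\<exists>\<beta>'. abacus k \<beta>' \<and>
    abacus_profile k \<beta>' = raise_minima (\<lambda>x. x mod int k = s mod int k) (abacus_profile k \<beta>) \<and>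
    abacus_weight k \<beta>' \<le> abacus_weight k \<beta> + 2"
proof -
  have k0: "0 < k" using k by simp
  obtain i where i: "i < k" "\<beta> i mod int k = (s + 1) mod int k"
    using abacus_runner[OF ab k0] by blast
  obtain j where j: "j < k" "\<beta> j mod int k = s mod int k"
    using abacus_runner[OF ab k0] by blast
  have succ: "(u + 1) mod int k = (v + 1) mod int k \<longleftrightarrow> u mod int k = v mod int k" for u v
    using diff_mod_eq_0_iff[of "u + 1" "v + 1" "int k"] diff_mod_eq_0_iff[of "u" "v" "int k"] by simp
  have one: "1 mod int k \<noteq> 0" using k by simp
  have neq: "i \<noteq> j"
  proof
    assume "i = j"
    then have "(s + 1) mod int k = s mod int k" using i j by simp
    then have "int k dvd 1" by (simp add: mod_eq_dvd_iff)
    then show False using k by simp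
  qed
  let ?h = "abacus_profile k \<beta>"
  have up: "?h (x + 1) = ?h x + (if \<beta> i \<le> x + 1 then 1 else - 1)" if "x mod int k = s mod int k" for x
    by (rule abacus_profile_step[OF ab i(1)]) (use that i succ in simp)
  have down: "?h x = ?h (x - 1) + (if \<beta> j \<le> x then 1 else - 1)" if "x mod int k = s mod int k" for x
    using abacus_profile_step[OF ab j(1), of "x - 1"] that j by simp
  show ?thesis
  proof (cases "\<beta> i < \<beta> j")
    case False
    have "\<not> (?h (x - 1) = ?h x + 1 \<and> ?h (x + 1) = ?h x + 1)" if "x mod int k = s mod int k" for x
    proof
      assume "?h (x - 1) = ?h x + 1 \<and> ?h (x + 1) = ?h x + 1"
      then have "\<beta> i \<le> x + 1" "x < \<beta> j" using up[OF that] down[OF that] by (auto split: if_splits)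
      then have "\<beta> i = \<beta> j" using False by simp
      then show False using neq abacus_unique[OF ab i(1) j(1)] by simp
    qed
    then have "raise_minima (\<lambda>x. x mod int k = s mod int k) ?h = ?h"
      by (auto simp: raise_minima_def fun_eq_iff)
    then show ?thesis using ab by (intro exI[of _ \<beta>]) auto
  next
    case lt: True
    define \<beta>' where "\<beta>' = \<beta>(i := \<beta> i - 1, j := \<beta> j + 1)"
    have \<beta>': "\<beta>' i = \<beta> i - 1" "\<beta>' j = \<beta> j + 1" "\<And>m. m \<noteq> i \<Longrightarrow> m \<noteq> j \<Longrightarrow> \<beta>' m = \<beta> m"
      using neq by (auto simp: \<beta>'_def)
    have res: "\<beta>' i mod int k = s mod int k" "\<beta>' j mod int k = (s + 1) mod int k"
      using i(2) j(2) succ[of "\<beta> i - 1" s] succ[of "\<beta> j" s] \<beta>' by auto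
    have mono: "\<beta> m < \<beta> n \<longleftrightarrow> m < n" if "m < k" "n < k" for m n
      using ab that by (auto simp: abacus_def strict_mono_on_less)
    have "i < j" using mono i j lt by simp
    \<comment> \<open>The order survives because no third runner starts at \<beta> i - 1 or \<beta>
      j + 1: these positions lie on the runners \<open>j\<close> and \<open>i\<close>.\<close>
    have smono: "\<beta>' m < \<beta>' n" if mn: "m < n" "m < k" "n < k" for m n
    proof -
      have l: "\<beta> m < \<beta> n" using mono mn by simp
      have a: "\<beta> m \<noteq> \<beta> i - 1" if "m \<noteq> j"
        using abacus_unique[OF ab \<open>m < k\<close> j(1)] that res(1) \<beta>'(1) j(2) by auto
      have b: "\<beta> n \<noteq> \<beta> j + 1" if "n \<noteq> i"
        using abacus_unique[OF ab \<open>n < k\<close> i(1)] that res(2) \<beta>'(2) i(2) by auto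
      consider "m = i" "n = j" | "m = i" "n \<noteq> j" "n \<noteq> i" | "m = j" "n \<noteq> j" "n \<noteq> i" | "m \<noteq> i" "m \<noteq> j" "n = i" 
        | "m \<noteq> i" "m \<noteq> j" "n = j" | "m \<noteq> i" "m \<noteq> j" "n \<noteq> i" "n \<noteq> j"
        using \<open>i < j\<close> mn by fastforce
      then show ?thesis
      proof cases
        case 3
        then show ?thesis using l b \<beta>'(3)[of n] \<beta>'(2) by simp
      next
        case 4
        then show ?thesis using l a \<beta>'(3)[of m] \<beta>'(1) by simp
      qed (use l \<beta>' in simp_all)
    qed
    have inj: "inj_on (\<lambda>m. \<beta>' m mod int k) {..<k}"
    proof (rule inj_onI)
      fix m n assume mn: "m \<in> {..<k}" "n \<in> {..<k}" and e: "\<beta>' m mod int k = \<beta>' n mod int k"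
      define \<pi> where "\<pi> m = (if m = i then j else if m = j then i else m)" for m
      have "\<beta>' m mod int k = \<beta> (\<pi> m) mod int k" for m
        using res i(2) j(2) \<beta>'(3) by (auto simp: \<pi>_def)
      then have "\<pi> m = \<pi> n"
        using abacus_unique[OF ab, of "\<pi> m" "\<pi> n"] e mn i(1) j(1) by (auto simp: \<pi>_def split: if_splits)
      then show "m = n" by (auto simp: \<pi>_def split: if_splits)
    qed
    have ab': "abacus k \<beta>'"
      using smono inj by (auto simp: abacus_def strict_mono_on_def)
    have prof: "abacus_profile k \<beta>' x = raise_minima (\<lambda>x. x mod int k = s mod int k) ?h x" for x
    proof -
      have ri: "runner_count k \<beta>' i x = runner_count k \<beta> i (x + 1)"
        by (simp add: runner_count_def \<beta>' algebra_simps)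
      have rj: "runner_count k \<beta>' j x = runner_count k \<beta> j (x - 1)"
        by (simp add: runner_count_def \<beta>' algebra_simps)
      have ro: "runner_count k \<beta>' m x = runner_count k \<beta> m x" if "m \<noteq> i" "m \<noteq> j" for m
        using that by (simp add: runner_count_def \<beta>')
      have si: "\<bar>runner_count k \<beta> i (x + 1)\<bar> = \<bar>runner_count k \<beta> i x\<bar> +
        (if x mod int k = s mod int k then if \<beta> i \<le> x + 1 then 1 else - 1 else 0)"
        using runner_count_step[OF k0, of \<beta> i x] runner_count_pos_iff[OF k0, of \<beta> i "x + 1"] i succ[of x s]
        by auto
      have sj: "\<bar>runner_count k \<beta> j (x - 1)\<bar> = \<bar>runner_count k \<beta> j x\<bar> +
        (if x mod int k = s mod int k then if \<beta> j \<le> x then - 1 else 1 else 0)"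
        using runner_count_step[OF k0, of \<beta> j "x - 1"] runner_count_pos_iff[OF k0, of \<beta> j "x"] j
        by auto
      have "\<bar>runner_count k \<beta>' m x\<bar> = \<bar>runner_count k \<beta> m x\<bar> +
        (if m = i then (if x mod int k = s mod int k then if \<beta> i \<le> x + 1 then 1 else - 1 else 0) else 0) +
        (if m = j then (if x mod int k = s mod int k then if \<beta> j \<le> x then - 1 else 1 else 0) else 0)" for m
        using ri rj ro si sj neq by auto
      then have "abacus_profile k \<beta>' x = ?h x +
        (if x mod int k = s mod int k then if \<beta> i \<le> x + 1 then 1 else - 1 else 0) +
        (if x mod int k = s mod int k then if \<beta> j \<le> x then - 1 else 1 else 0)"
        using i(1) j(1) by (simp add: abacus_profile_def sum.distrib)
      moreover have "?h (x + 1) = ?h x + (if \<beta> i \<le> x + 1 then 1 else - 1) \<and>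
          ?h (x - 1) = ?h x + (if \<beta> j \<le> x then - 1 else 1)" if "x mod int k = s mod int k"
        using up[OF that] down[OF that] by auto
      ultimately show ?thesis
        using lt by (cases "\<beta> i \<le> x + 1"; cases "\<beta> j \<le> x") (simp_all add: raise_minima_def)
    qed
    have nd: "(\<beta> n - \<beta> m) mod int k \<noteq> 0" if "m < k" "n < k" "m \<noteq> n" for m n
      using abacus_unique[OF ab that(1,2)] that(3) by (metis diff_mod_eq_0_iff)
    have wt: "\<bar>\<beta>' n - \<beta>' m\<bar> div int k = \<bar>\<beta> n - \<beta> m\<bar> div int k +
        (if m = i then if n = j then 1 else 0 else 0) + (if m = j then if n = i then 1 else 0 else 0)"
      if mn: "m < k" "n < k" for m n
    proof -
      \<comment> \<open>The difference \<beta> j - \<beta> i is -1 modulo \<open>k\<close>. Adding 2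
        passes a multiple of \<open>k\<close> at the first unit and, as k >= 2, none at the
        second.\<close>
      have ij: "\<bar>\<beta>' j - \<beta>' i\<bar> div int k = \<bar>\<beta> j - \<beta> i\<bar> div int k + 1"
      proof -
        have "(\<beta> j - \<beta> i + 1) mod int k = 0"
        proof -
          have "(\<beta> j + 1) mod int k = \<beta> i mod int k" using i(2) succ[of "\<beta> j" s] j(2) by simp
          then show ?thesis using diff_mod_eq_0_iff[of "\<beta> j + 1" "\<beta> i" "int k"] by (simp add: algebra_simps)
        qed
        moreover from this have "(\<beta> j - \<beta> i + 1 + 1) mod int k \<noteq> 0"
          using one by (metis add.left_neutral mod_add_left_eq)
        ultimately have "(\<beta> j - \<beta> i + 1 + 1) div int k = (\<beta> j - \<beta> i) div int k + 1"
          using div_int_add_one[of "int k" "\<beta> j - \<beta> i + 1"] div_int_add_one[of "int k" "\<beta> j - \<beta> i"] k0 by simp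
        moreover have "\<bar>\<beta>' j - \<beta>' i\<bar> = \<beta> j - \<beta> i + 1 + 1" using lt \<beta>'(1,2) by simp
        ultimately show ?thesis using lt by simp
      qed
      have oi: "\<bar>\<beta> p - \<beta>' i\<bar> div int k = \<bar>\<beta> p - \<beta> i\<bar> div int k" if "p < k" "p \<noteq> i" "p \<noteq> j" for p
      proof -
        have e: "\<beta> p - \<beta>' i = \<beta> p - \<beta> i + 1" using \<beta>'(1) by simp
        have "(\<beta> p - \<beta> i + 1) mod int k \<noteq> 0"
        proof
          assume "(\<beta> p - \<beta> i + 1) mod int k = 0"
          then have "\<beta> p mod int k = \<beta>' i mod int k"
            by (simp only: diff_mod_eq_0_iff[of "\<beta> p" "\<beta>' i" "int k", unfolded e])
          then show False using res(1) j abacus_unique[OF ab that(1) j(1)] that by simp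
        qed
        then show ?thesis using abs_add_one_div[of "int k" "\<beta> p - \<beta> i"] nd[of i p] k0 that i(1)
          unfolding e by simp
      qed
      have oj: "\<bar>\<beta> p - \<beta>' j\<bar> div int k = \<bar>\<beta> p - \<beta> j\<bar> div int k" if "p < k" "p \<noteq> i" "p \<noteq> j" for p
      proof -
        have e: "\<beta>' j - \<beta> p = \<beta> j - \<beta> p + 1" using \<beta>'(2) by simp
        have "(\<beta> j - \<beta> p + 1) mod int k \<noteq> 0"
        proof
          assume "(\<beta> j - \<beta> p + 1) mod int k = 0"
          then have "\<beta> p mod int k = \<beta>' j mod int k"
            using diff_mod_eq_0_iff[of "\<beta>' j" "\<beta> p" "int k", unfolded e] by simp
          then show False using res(2) i abacus_unique[OF ab that(1) i(1)] that by simp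
        qed
        then show ?thesis using abs_add_one_div[of "int k" "\<beta> j - \<beta> p"] nd[of p j] k0 that j(1)
          abs_minus_commute[of "\<beta> p" "\<beta>' j"] abs_minus_commute[of "\<beta> p" "\<beta> j"] unfolding e by simp
      qed
      have "\<bar>\<beta>' i - \<beta>' j\<bar> div int k = \<bar>\<beta> i - \<beta> j\<bar> div int k + 1"
        using ij by (simp only: abs_minus_commute[of "\<beta>' i"] abs_minus_commute[of "\<beta> i"])
      moreover have "\<bar>\<beta>' i - \<beta> p\<bar> div int k = \<bar>\<beta> i - \<beta> p\<bar> div int k" if "p < k" "p \<noteq> i" "p \<noteq> j" for p
        using oi[OF that] by (simp only: abs_minus_commute[of _ "\<beta> p"])
      moreover have "\<bar>\<beta>' j - \<beta> p\<bar> div int k = \<bar>\<beta> j - \<beta> p\<bar> div int k" if "p < k" "p \<noteq> i" "p \<noteq> j" for p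
        using oj[OF that] by (simp only: abs_minus_commute[of _ "\<beta> p"])
      moreover define f where "f m n = \<bar>\<beta> n - \<beta> m\<bar> div int k" for m n
      moreover define f' where "f' m n = \<bar>\<beta>' n - \<beta>' m\<bar> div int k" for m n
      moreover have "\<bar>\<beta>' i - \<beta>' i\<bar> div int k = 0" "\<bar>\<beta> i - \<beta> i\<bar> div int k = 0"
        "\<bar>\<beta>' j - \<beta>' j\<bar> div int k = 0" "\<bar>\<beta> j - \<beta> j\<bar> div int k = 0" by simp_all
      ultimately have "f' i j = f i j + 1" "f' j i = f j i + 1"
        "f' i i = f i i" "f' j j = f j j"
        "\<And>p. p < k \<Longrightarrow> p \<noteq> i \<Longrightarrow> p \<noteq> j \<Longrightarrow> f' i p = f i p \<and> f' p i = f p i \<and> f' j p = f j p \<and> f' p j = f p j"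
        "\<And>p q. p \<noteq> i \<Longrightarrow> p \<noteq> j \<Longrightarrow> q \<noteq> i \<Longrightarrow> q \<noteq> j \<Longrightarrow> f' p q = f p q"
        using ij oi oj \<beta>'(3) by metis+
      then have "f' m n = f m n + (if m = i then if n = j then 1 else 0 else 0) + (if m = j then if n = i then 1 else 0 else 0)"
        using mn neq
        by (cases "m = i"; cases "m = j"; cases "n = i"; cases "n = j"; (hypsubst?); simp (no_asm_simp))
      then show ?thesis by (simp only: f_def f'_def)
    qed
    have "abacus_weight k \<beta>' = (\<Sum>m<k. \<Sum>n<k. \<bar>\<beta> n - \<beta> m\<bar> div int k +
        (if m = i then if n = j then 1 else 0 else 0) + (if m = j then if n = i then 1 else 0 else 0))"
      unfolding abacus_weight_def by (intro sum.cong refl) (use wt in auto)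
    also have "\<dots> = abacus_weight k \<beta> + (\<Sum>m<k. \<Sum>n<k. if m = i then if n = j then 1 else 0 else 0)
        + (\<Sum>m<k. \<Sum>n<k. if m = j then if n = i then 1 else 0 else 0)"
      by (simp add: abacus_weight_def sum.distrib)
    also have "(\<Sum>m<k. \<Sum>n<k. if m = i then if n = j then 1 else 0 else 0) = (1::int)"
      using i(1) j(1) by (subst sum.swap) simp
    also have "(\<Sum>m<k. \<Sum>n<k. if m = j then if n = i then 1 else 0 else 0) = (1::int)"
      using i(1) j(1) by (subst sum.swap) simp
    finally have "abacus_weight k \<beta>' \<le> abacus_weight k \<beta> + 2" by simp
    then show ?thesis using ab' prof by (intro exI[of _ \<beta>']) auto
  qed
qed

text \<open>The empty core: the beads are exactly the positive integers.\<close>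

lemma abacus_start:
  assumes "0 < k"
  shows "abacus k (\<lambda>i. int i + 1)" and "abacus_profile k (\<lambda>i. int i + 1) x = \<bar>x\<bar>"
    and "abacus_weight k (\<lambda>i. int i + 1) = 0"
proof -
  have "inj_on (\<lambda>i. (int i + 1) mod int k) {..<k}"
  proof (rule inj_onI)
    fix m n assume mn: "m \<in> {..<k}" "n \<in> {..<k}" and "(int m + 1) mod int k = (int n + 1) mod int k"
    then have "int m mod int k = int n mod int k"
      using diff_mod_eq_0_iff[of "int m + 1" "int n + 1" "int k"] diff_mod_eq_0_iff[of "int m" "int n" "int k"]
      by simp
    then show "m = n" using mn by simp
  qed
  then show ab: "abacus k (\<lambda>i. int i + 1)" by (auto simp: abacus_def strict_mono_on_def)
  let ?h = "abacus_profile k (\<lambda>i. int i + 1)"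
  have "(- 1 - int i) div int k = - 1" if "i < k" for i
    using that by (intro int_div_pos_eq[where r = "int k - 1 - int i"]) auto
  then have 0: "?h 0 = 0"
    by (simp add: abacus_profile_def runner_count_def algebra_simps)
  have step: "?h (x + 1) = ?h x + (if 0 \<le> x then 1 else - 1)" for x
  proof -
    obtain i where i: "i < k" "(int i + 1) mod int k = (x + 1) mod int k"
      using abacus_runner[OF ab assms] by blast
    have "int i + 1 \<le> x + 1 \<longleftrightarrow> 0 \<le> x"
    proof
      assume "0 \<le> x"
      have "int i mod int k = x mod int k"
        using i(2) diff_mod_eq_0_iff[of "int i + 1" "x + 1" "int k"] diff_mod_eq_0_iff[of "int i" "x" "int k"]
        by simp
      then have "int i = x mod int k" using i(1) by simp
      then show "int i + 1 \<le> x + 1" using \<open>0 \<le> x\<close> assms zmod_le_nonneg_dividend[of x "int k"] by simp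
    qed simp
    then show ?thesis using abacus_profile_step[OF ab i(1), of x] i(2) by simp
  qed
  show "?h x = \<bar>x\<bar>"
  proof (induction x rule: int_induct[where k = 0])
    case base
    then show ?case using 0 by simp
  next
    case (step1 i)
    then show ?case using step[of i] by simp
  next
    case (step2 i)
    then show ?case using step[of "i - 1"] by simp
  qed
  have "\<bar>int j - int i\<bar> div int k = 0" if "i < k" "j < k" for i j
    using that by (intro div_pos_pos_trivial) auto
  then show "abacus_weight k (\<lambda>i. int i + 1) = 0"
    by (simp add: abacus_weight_def)
qed

definition letters :: "nat \<Rightarrow> (nat \<Rightarrow> int \<Rightarrow> bool) \<Rightarrow> nat \<Rightarrow> bool"
  where "letters k c n \<longleftrightarrow> (\<forall>a\<in>{1..n}. c a = (\<lambda>_. False) \<or> (\<exists>s. c a = (\<lambda>x. x mod int k = s mod int k)))"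

text \<open>Each letter contributes at most 2 to the weight and a missing letter nothing, so half
  the weight is a lower bound for the number of letters.\<close>

lemma profile_abacus:
  assumes "2 \<le> k" "letters k c n"
  shows "\<exists>\<beta>. abacus k \<beta> \<and> abacus_profile k \<beta> = profile c n \<and>
    abacus_weight k \<beta> \<le> 2 * int (card {a \<in> {1..n}. c a \<noteq> (\<lambda>_. False)})"
  using assms(2)
proof (induction n)
  case 0
  show ?case using abacus_start[of k] assms(1) by (intro exI[of _ "\<lambda>i. int i + 1"]) auto
next
  case (Suc n)
  then obtain \<beta> where \<beta>: "abacus k \<beta>" "abacus_profile k \<beta> = profile c n"
    "abacus_weight k \<beta> \<le> 2 * int (card {a \<in> {1..n}. c a \<noteq> (\<lambda>_. False)})"
    by (auto simp: letters_def)
  consider "c (Suc n) = (\<lambda>_. False)" | s where "c (Suc n) = (\<lambda>x. x mod int k = s mod int k)"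
    using Suc.prems by (force simp: letters_def)
  then show ?case
  proof cases
    case 1
    then have "{a \<in> {1..Suc n}. c a \<noteq> (\<lambda>_. False)} = {a \<in> {1..n}. c a \<noteq> (\<lambda>_. False)}"
      by (auto simp: le_Suc_eq)
    moreover have "profile c (Suc n) = profile c n" using 1 by (simp add: raise_minima_def fun_eq_iff)
    ultimately show ?thesis using \<beta> by metis
  next
    case 2
    then have "c (Suc n) \<noteq> (\<lambda>_. False)" by (auto simp: fun_eq_iff)
    then have "{a \<in> {1..Suc n}. c a \<noteq> (\<lambda>_. False)} = insert (Suc n) {a \<in> {1..n}. c a \<noteq> (\<lambda>_. False)}"
      by (auto simp: le_Suc_eq)
    then have "card {a \<in> {1..Suc n}. c a \<noteq> (\<lambda>_. False)} = Suc (card {a \<in> {1..n}. c a \<noteq> (\<lambda>_. False)})"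
      by simp
    moreover obtain \<beta>' where "abacus k \<beta>'" "abacus_profile k \<beta>' = profile c (Suc n)"
      "abacus_weight k \<beta>' \<le> abacus_weight k \<beta> + 2"
      using abacus_raise_minima[OF \<beta>(1) assms(1), of s] 2 \<beta>(2) by auto
    ultimately show ?thesis using \<beta>(3) by (intro exI[of _ \<beta>']) auto
  qed
qed

section \<open>Lower bound for the weight of an abacus\<close>

lemma neg_div_int:
  fixes d k :: int
  assumes "0 < k" "d mod k \<noteq> 0"
  shows "(- d) div k = - (d div k) - 1" and "(- d - 1) div k = - (d div k) - 1" and "(d - 1) div k = d div k"
proof -
  show 1: "(d - 1) div k = d div k"
    using div_int_add_one[of k "d - 1"] assms by simp
  show 2: "(- d) div k = - (d div k) - 1"
    using assms by (simp add: div_minus_minus zdiv_zminus1_eq_if)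
  have "- d mod k \<noteq> 0" using assms(2) by (simp add: mod_eq_0_iff_dvd)
  then show "(- d - 1) div k = - (d div k) - 1"
    using div_int_add_one[of k "- d - 1"] assms 2 by simp
qed

text \<open>Just before the first bead of runner \<open>i\<close> the counts are the integer parts
  that make up the weight, except that the runners before \<open>i\<close> count one more; one
  period before that bead the runners after \<open>i\<close> count one more. Summed over
  \<open>j\<close>, the profile at these two places is the i-th row sum of the weight plus i,
  respectively plus k - 1 - i.\<close>

lemma runner_count_before:
  assumes ab: "abacus k \<beta>" and ij: "i < k" "j < k"
  shows "\<bar>runner_count k \<beta> j (\<beta> i - 1)\<bar> = \<bar>\<beta> j - \<beta> i\<bar> div int k + (if j < i then 1 else 0)"
    and "\<bar>runner_count k \<beta> j (\<beta> i - int k)\<bar> = \<bar>\<beta> j - \<beta> i\<bar> div int k + (if i < j then 1 else 0)"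
proof -
  have k: "0 < int k" using ij by simp
  have mono: "\<beta> m < \<beta> n \<longleftrightarrow> m < n" if "m < k" "n < k" for m n
    using ab that by (auto simp: abacus_def strict_mono_on_less)
  have 2: "runner_count k \<beta> j (\<beta> i - int k) = (\<beta> i - \<beta> j) div int k"
  proof -
    have "\<beta> i - int k - \<beta> j = \<beta> i - \<beta> j + int k * (- 1)" by simp
    then have "(\<beta> i - int k - \<beta> j) div int k = (\<beta> i - \<beta> j) div int k - 1"
      using k by (simp only: div_mult_self2[of "int k"])
    then show ?thesis by (simp add: runner_count_def)
  qed
  consider "j = i" | "j < i" | "i < j" by linarith
  then have "\<bar>runner_count k \<beta> j (\<beta> i - 1)\<bar> = \<bar>\<beta> j - \<beta> i\<bar> div int k + (if j < i then 1 else 0) \<and>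
    \<bar>runner_count k \<beta> j (\<beta> i - int k)\<bar> = \<bar>\<beta> j - \<beta> i\<bar> div int k + (if i < j then 1 else 0)"
  proof cases
    case 1
    then show ?thesis using 2 k by (simp add: runner_count_def div_eq_minus1)
  next
    case lt: 2
    define d where "d = \<beta> i - \<beta> j"
    have d: "0 < d" "d mod int k \<noteq> 0"
      using mono lt ij abacus_unique[OF ab ij(2,1)] by (auto simp: d_def diff_mod_eq_0_iff)
    have "runner_count k \<beta> j (\<beta> i - 1) = (d - 1) div int k + 1"
      by (simp add: runner_count_def d_def algebra_simps)
    then have "runner_count k \<beta> j (\<beta> i - 1) = d div int k + 1"
      using neg_div_int(3)[OF k d(2)] by simp
    moreover have "\<bar>\<beta> j - \<beta> i\<bar> = d" using d by (simp add: d_def)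
    moreover have "0 \<le> d div int k" using d k by (simp add: pos_imp_zdiv_nonneg_iff)
    ultimately show ?thesis using 2 lt by (simp add: d_def)
  next
    case gt: 3
    define d where "d = \<beta> j - \<beta> i"
    have d: "0 < d" "d mod int k \<noteq> 0"
      using mono gt ij abacus_unique[OF ab ij(2,1)] by (auto simp: d_def diff_mod_eq_0_iff)
    have "runner_count k \<beta> j (\<beta> i - 1) = (- d - 1) div int k + 1"
      by (simp add: runner_count_def d_def algebra_simps)
    then have a: "runner_count k \<beta> j (\<beta> i - 1) = - (d div int k)"
      using neg_div_int(2)[OF k d(2)] by simp
    have "\<beta> i - \<beta> j = - d" by (simp add: d_def)
    then have b: "runner_count k \<beta> j (\<beta> i - int k) = - (d div int k) - 1"
      using 2 neg_div_int(1)[OF k d(2)] by simp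
    have "\<bar>\<beta> j - \<beta> i\<bar> = d" using d by (simp add: d_def)
    moreover have "0 \<le> d div int k" using d k by (simp add: pos_imp_zdiv_nonneg_iff)
    ultimately show ?thesis using a b gt by simp
  qed
  then show "\<bar>runner_count k \<beta> j (\<beta> i - 1)\<bar> = \<bar>\<beta> j - \<beta> i\<bar> div int k + (if j < i then 1 else 0)"
    and "\<bar>runner_count k \<beta> j (\<beta> i - int k)\<bar> = \<bar>\<beta> j - \<beta> i\<bar> div int k + (if i < j then 1 else 0)"
    by auto
qed

lemma sum_count_less:
  assumes "i < k"
  shows "(\<Sum>j<k. if j < i then 1 else 0) = int i" and "(\<Sum>j<k. if i < j then 1 else 0) = int (k - 1 - i)"
proof -
  have "{..<k} \<inter> {j. j < i} = {..<i}" using assms by auto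
  then show "(\<Sum>j<k. if j < i then 1 else 0) = int i" by (simp add: sum.If_cases)
  have "{..<k} \<inter> {j. i < j} = {i<..<k}" by auto
  then show "(\<Sum>j<k. if i < j then 1 else 0) = int (k - 1 - i)" by (simp add: sum.If_cases)
qed

text \<open>Runner \<open>i\<close> is paired with the opposite runner k - 1 - i, for which the same
  lower bound holds.\<close>

lemma sum_outer_ge:
  fixes f :: "nat \<Rightarrow> int"
  assumes "2 * l \<le> k" "\<And>i. i < l \<Longrightarrow> max 0 (r - int i) \<le> f i"
    "\<And>i. i < l \<Longrightarrow> max 0 (r - int i) \<le> f (k - 1 - i)"
  shows "2 * (\<Sum>i<l. max 0 (r - int i)) \<le> (\<Sum>i<l. f i) + (\<Sum>i\<in>{k - l..<k}. f i)"
proof -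
  have "bij_betw (\<lambda>i. k - 1 - i) {..<l} {k - l..<k}"
    by (rule bij_betwI[where g = "\<lambda>i. k - 1 - i"]) (use assms(1) in auto)
  then have "(\<Sum>i\<in>{k - l..<k}. f i) = (\<Sum>i<l. f (k - 1 - i))"
    by (rule sum.reindex_bij_betw[symmetric])
  moreover have "(\<Sum>i<l. max 0 (r - int i)) \<le> (\<Sum>i<l. f i)"
    by (rule sum_mono) (use assms in auto)
  moreover have "(\<Sum>i<l. max 0 (r - int i)) \<le> (\<Sum>i<l. f (k - 1 - i))"
    by (rule sum_mono) (use assms in auto)
  ultimately show ?thesis by linarith
qed

text \<open>
  For odd \<open>k\<close> the bounds from \<open>abacus_profile k \<beta> (\<beta> i - 1)\<close> are too weak.  They improve if the
  middle runner \<open>c\<close> is left out: shifting by a multiple of \<open>k\<close> to a place where runner \<open>c\<close> does not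
  count does not increase the sum over the others, as equally many lie on either side of \<open>c\<close>.
\<close>

lemma abacus_odd_bound:
  assumes ab: "abacus k \<beta>" and k: "k = 2 * c + 1" and r: "\<And>x. r \<le> abacus_profile k \<beta> x"
  shows "r \<le> (\<Sum>j\<in>{..<k} - {c}. \<bar>runner_count k \<beta> j x\<bar>)"
proof -
  define t where "t = runner_count k \<beta> c x"
  have k0: "0 < int k" using k by simp
  have shift: "runner_count k \<beta> j (x - t * int k) = runner_count k \<beta> j x - t" for j
  proof -
    have "x - t * int k - \<beta> j = x - \<beta> j + int k * (- t)" by simp
    then have "(x - t * int k - \<beta> j) div int k = (x - \<beta> j) div int k - t"
      using k0 by (simp only: div_mult_self2[of "int k"])
    then show ?thesis by (simp add: runner_count_def)
  qed
  have anti: "runner_count k \<beta> j x \<le> runner_count k \<beta> i x" if "i \<le> j" "j < k" for i j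
  proof -
    have "\<beta> i \<le> \<beta> j" using ab that by (cases "i = j") (auto simp: abacus_def dest: strict_mono_onD[of _ _ i j])
    then show ?thesis using k0 by (auto simp: runner_count_def intro!: zdiv_mono1)
  qed
  have split: "{..<k} - {c} = {..<c} \<union> {c<..<k}" using k by auto
  have "(\<Sum>j\<in>{..<k} - {c}. \<bar>runner_count k \<beta> j x - t\<bar>) \<le> (\<Sum>j\<in>{..<k} - {c}. \<bar>runner_count k \<beta> j x\<bar>)"
  proof (cases "0 \<le> t")
    case True
    have "(\<Sum>j<c. \<bar>runner_count k \<beta> j x - t\<bar>) = (\<Sum>j<c. \<bar>runner_count k \<beta> j x\<bar>) - int c * t"
    proof -
      have "(\<Sum>j<c. \<bar>runner_count k \<beta> j x - t\<bar>) = (\<Sum>j<c. \<bar>runner_count k \<beta> j x\<bar> - t)"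
      proof (rule sum.cong)
        fix j assume "j \<in> {..<c}"
        then have "t \<le> runner_count k \<beta> j x" using anti[of j c] k by (simp add: t_def)
        then show "\<bar>runner_count k \<beta> j x - t\<bar> = \<bar>runner_count k \<beta> j x\<bar> - t" using True by simp
      qed simp
      then show ?thesis by (simp add: sum_subtractf)
    qed
    moreover have "(\<Sum>j\<in>{c<..<k}. \<bar>runner_count k \<beta> j x - t\<bar>) \<le> (\<Sum>j\<in>{c<..<k}. \<bar>runner_count k \<beta> j x\<bar>) + int c * t"
    proof -
      have "(\<Sum>j\<in>{c<..<k}. \<bar>runner_count k \<beta> j x - t\<bar>) \<le> (\<Sum>j\<in>{c<..<k}. \<bar>runner_count k \<beta> j x\<bar> + t)"
        by (rule sum_mono) (use True in linarith)
      then show ?thesis using k by (simp add: sum.distrib)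
    qed
    ultimately show ?thesis unfolding split by (subst (1 2) sum.union_disjoint) auto
  next
    case False
    have "(\<Sum>j\<in>{c<..<k}. \<bar>runner_count k \<beta> j x - t\<bar>) = (\<Sum>j\<in>{c<..<k}. \<bar>runner_count k \<beta> j x\<bar>) + int c * t"
    proof -
      have "(\<Sum>j\<in>{c<..<k}. \<bar>runner_count k \<beta> j x - t\<bar>) = (\<Sum>j\<in>{c<..<k}. \<bar>runner_count k \<beta> j x\<bar> + t)"
      proof (rule sum.cong)
        fix j assume "j \<in> {c<..<k}"
        then have "runner_count k \<beta> j x \<le> t" using anti[of c j] by (simp add: t_def)
        then show "\<bar>runner_count k \<beta> j x - t\<bar> = \<bar>runner_count k \<beta> j x\<bar> + t" using False by simp
      qed simp
      then show ?thesis using k by (simp add: sum.distrib)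
    qed
    moreover have "(\<Sum>j<c. \<bar>runner_count k \<beta> j x - t\<bar>) \<le> (\<Sum>j<c. \<bar>runner_count k \<beta> j x\<bar>) - int c * t"
    proof -
      have "(\<Sum>j<c. \<bar>runner_count k \<beta> j x - t\<bar>) \<le> (\<Sum>j<c. \<bar>runner_count k \<beta> j x\<bar> - t)"
        by (rule sum_mono) (use False in linarith)
      then show ?thesis by (simp add: sum_subtractf)
    qed
    ultimately show ?thesis unfolding split by (subst (1 2) sum.union_disjoint) auto
  qed
  moreover have "abacus_profile k \<beta> (x - t * int k) = (\<Sum>j\<in>{..<k} - {c}. \<bar>runner_count k \<beta> j x - t\<bar>)"
  proof -
    have "c \<in> {..<k}" using k by simp
    then show ?thesis
      unfolding abacus_profile_def shift by (subst sum.remove[of _ c]) (auto simp: t_def)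
  qed
  ultimately show ?thesis using r[of "x - t * int k"] by simp
qed

text \<open>The row sums \<open>H\<close> of the weight satisfy H i >= r - i and H i >= r - (k - 1 -
  i). For even \<open>k\<close> it suffices to add these bounds over opposite rows. For odd
  \<open>k\<close> the middle row \<open>c\<close> would give r - c only once, where it is needed
  twice. So the bounds for the other rows are proved without column \<open>c\<close>; by symmetry
  that column has the sum H c and supplies the second copy.\<close>

lemma abacus_weight_ge:
  assumes ab: "abacus k \<beta>" and k: "0 < k" and r: "\<And>x. r \<le> abacus_profile k \<beta> x"
  shows "2 * staircase_cost r k \<le> abacus_weight k \<beta>"
proof -
  define H where "H i = (\<Sum>j<k. \<bar>\<beta> j - \<beta> i\<bar> div int k)" for i
  have pos: "0 \<le> \<bar>\<beta> j - \<beta> i\<bar> div int k" for i j using k by (simp add: pos_imp_zdiv_nonneg_iff)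
  have H0: "0 \<le> H i" for i unfolding H_def by (intro sum_nonneg pos)
  have H1: "r - int i \<le> H i" and H2: "r - int (k - 1 - i) \<le> H i" if "i < k" for i
  proof -
    show "r - int i \<le> H i"
      using r[of "\<beta> i - 1"] that sum_count_less(1)[OF that]
      by (simp add: abacus_profile_def H_def runner_count_before[OF ab that] sum.distrib)
    show "r - int (k - 1 - i) \<le> H i"
      using r[of "\<beta> i - int k"] that sum_count_less(2)[OF that]
      by (simp add: abacus_profile_def H_def runner_count_before[OF ab that] sum.distrib)
  qed
  have W: "abacus_weight k \<beta> = (\<Sum>i<k. H i)" by (simp add: abacus_weight_def H_def)
  show ?thesis
  proof (cases "even k")
    case True
    then obtain l where l: "k = 2 * l" by blast
    have "2 * (\<Sum>i<l. max 0 (r - int i)) \<le> (\<Sum>i<l. H i) + (\<Sum>i\<in>{k - l..<k}. H i)"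
    proof (rule sum_outer_ge)
      fix i assume "i < l"
      then show "max 0 (r - int i) \<le> H i" using H1[of i] H0[of i] l by simp
      have "k - 1 - (k - 1 - i) = i" using \<open>i < l\<close> l by simp
      then show "max 0 (r - int i) \<le> H (k - 1 - i)" using H2[of "k - 1 - i"] H0[of "k - 1 - i"] l \<open>i < l\<close> by simp
    qed (use l in simp)
    also have "\<dots> = (\<Sum>i<k. H i)"
      using l by (subst sum.union_disjoint[symmetric]) (auto intro!: sum.cong)
    finally show ?thesis unfolding W staircase_cost_def by (simp add: l)
  next
    case False
    then obtain c where c: "k = 2 * c + 1" by (metis oddE)
    define H' where "H' i = (\<Sum>j\<in>{..<k} - {c}. \<bar>\<beta> j - \<beta> i\<bar> div int k)" for i
    have ck: "c < k" using c by simp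
    have HH': "H i = H' i + \<bar>\<beta> c - \<beta> i\<bar> div int k" for i
      unfolding H_def H'_def using ck by (subst sum.remove[of _ c]) auto
    have H'0: "0 \<le> H' i" for i unfolding H'_def by (intro sum_nonneg pos)
    have H'1: "r - int i \<le> H' i" if "i < c" for i
    proof -
      have ik: "i < k" using that ck by simp
      have "r \<le> (\<Sum>j\<in>{..<k} - {c}. \<bar>runner_count k \<beta> j (\<beta> i - 1)\<bar>)"
        by (rule abacus_odd_bound[OF ab c r])
      also have "\<dots> = H' i + (\<Sum>j\<in>{..<k} - {c}. if j < i then 1 else 0)"
        by (simp add: H'_def runner_count_before[OF ab ik] sum.distrib)
      also have "(\<Sum>j\<in>{..<k} - {c}. if j < i then 1 else (0::int)) = int i"
        using sum_count_less(1)[OF ik] ck that by (subst (asm) sum.remove[of _ c]) auto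
      finally show ?thesis by simp
    qed
    have H'2: "r - int (k - 1 - i) \<le> H' i" if "c < i" "i < k" for i
    proof -
      have "r \<le> (\<Sum>j\<in>{..<k} - {c}. \<bar>runner_count k \<beta> j (\<beta> i - int k)\<bar>)"
        by (rule abacus_odd_bound[OF ab c r])
      also have "\<dots> = H' i + (\<Sum>j\<in>{..<k} - {c}. if i < j then 1 else 0)"
        by (simp add: H'_def runner_count_before[OF ab that(2)] sum.distrib)
      also have "(\<Sum>j\<in>{..<k} - {c}. if i < j then 1 else (0::int)) = int (k - 1 - i)"
        using sum_count_less(2)[OF that(2)] ck that by (subst (asm) sum.remove[of _ c]) auto
      finally show ?thesis by simp
    qed
    have "2 * (\<Sum>i<c. max 0 (r - int i)) \<le> (\<Sum>i<c. H' i) + (\<Sum>i\<in>{k - c..<k}. H' i)"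
    proof (rule sum_outer_ge)
      fix i assume "i < c"
      then show "max 0 (r - int i) \<le> H' i" using H'1[of i] H'0[of i] by simp
      have "k - 1 - (k - 1 - i) = i" using \<open>i < c\<close> c by simp
      then show "max 0 (r - int i) \<le> H' (k - 1 - i)"
        using H'2[of "k - 1 - i"] H'0[of "k - 1 - i"] c \<open>i < c\<close> by simp
    qed (use c in simp)
    also have "\<dots> = (\<Sum>i\<in>{..<k} - {c}. H' i)"
      using c by (subst sum.union_disjoint[symmetric]) (auto intro!: sum.cong)
    finally have A: "2 * (\<Sum>i<c. max 0 (r - int i)) \<le> (\<Sum>i\<in>{..<k} - {c}. H' i)" .
    have "(\<Sum>i<k. H i) = H c + (\<Sum>i\<in>{..<k} - {c}. H i)"
      using ck by (subst sum.remove[of _ c]) auto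
    also have "(\<Sum>i\<in>{..<k} - {c}. H i) = (\<Sum>i\<in>{..<k} - {c}. H' i) + H' c"
      by (simp add: HH' sum.distrib H'_def abs_minus_commute)
    also have "H' c = H c" by (simp add: HH')
    finally have S: "(\<Sum>i<k. H i) = H c + ((\<Sum>i\<in>{..<k} - {c}. H' i) + H c)" .
    have "2 * (\<Sum>i<c. max 0 (r - int i)) + 2 * max 0 (r - int c) \<le> (\<Sum>i<k. H i)"
    proof -
      have "a \<le> s \<Longrightarrow> t = H c + (s + H c) \<Longrightarrow> m \<le> H c \<Longrightarrow> a + 2 * m \<le> t" for a s t m by simp
      from this[OF A S] H1[OF ck] H0[of c] show ?thesis by simp
    qed
    moreover have "(k + 1) div 2 = Suc c" using c by simp
    ultimately show ?thesis by (simp add: W staircase_cost_def)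
  qed
qed

lemma staircase_cost_le:
  assumes "2 \<le> k" "letters k c n" "\<And>x. r \<le> profile c n x"
  shows "staircase_cost r k \<le> int (card {a \<in> {1..n}. c a \<noteq> (\<lambda>_. False)})"
proof -
  obtain \<beta> where "abacus k \<beta>" "abacus_profile k \<beta> = profile c n"
    "abacus_weight k \<beta> \<le> 2 * int (card {a \<in> {1..n}. c a \<noteq> (\<lambda>_. False)})"
    using profile_abacus[OF assms(1,2)] by blast
  moreover from this have "2 * staircase_cost r k \<le> abacus_weight k \<beta>"
    using assms by (intro abacus_weight_ge) auto
  ultimately show ?thesis by linarith
qed

section \<open>A cheapest word\<close>

text \<open>
  The \<open>j\<close>-th box of the \<open>i\<close>-th antidiagonal has content \<open>2 * j - (i - 1)\<close>, and \<open>h\<close> contains it iff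
  \<open>i + 1 \<le> h (2 * j - (i - 1))\<close>.  Stage \<open>\<sigma>\<close> uses the letters \<open>2 * m - (\<sigma> - 1)\<close> for
  \<open>m = min \<sigma> l - 1, \<dots>, 0\<close>.  They also add boxes \<open>j \<ge> l\<close>, whose content is equivalent to that of
  index \<open>j mod l\<close>, of the same antidiagonal if \<open>k\<close> is even and of later ones if \<open>k\<close> is odd.
\<close>

definition staircase_filled :: "nat \<Rightarrow> int \<Rightarrow> int \<Rightarrow> (int \<Rightarrow> int) \<Rightarrow> bool"
  where "staircase_filled k \<sigma> m h \<longleftrightarrow>
    (let l = (int k + 1) div 2 in
      \<forall>i j. 0 \<le> j \<and> j \<le> i - 1 \<and>
        (let t = i - (int k mod 2) * (j div l) in t < \<sigma> \<or> t = \<sigma> \<and> m \<le> j mod l) \<longrightarrow>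
        i + 1 \<le> h (2 * j - (i - 1)))"

lemma staircase_filledD:
  assumes "staircase_filled k \<sigma> m h" "0 \<le> j" "j \<le> i - 1"
    and "i - (int k mod 2) * (j div ((int k + 1) div 2)) < \<sigma> \<or>
      i - (int k mod 2) * (j div ((int k + 1) div 2)) = \<sigma> \<and> m \<le> j mod ((int k + 1) div 2)"
  shows "i + 1 \<le> h (2 * j - (i - 1))"
  using assms by (auto simp: staircase_filled_def Let_def)

lemma raise_minima_ge: "h x \<le> raise_minima P h x"
  by (simp add: raise_minima_def)

text \<open>Box \<open>j\<close> of antidiagonal \<open>i\<close> can be added once the boxes
  \<open>j\<close> and j - 1 of antidiagonal i - 1 are present, where they exist. Box
  \<open>j\<close> belongs to an earlier stage. So does box j - 1, unless \<open>k\<close> is odd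
  and it lies in the preceding block of \<open>l\<close> indices; then it belongs to the same stage
  with index l - 1 modulo \<open>l\<close>. This is why a stage runs through \<open>m\<close> in
  descending order.\<close>

lemma staircase_filled_step:
  assumes h: "is_profile h" and k: "2 \<le> k" and m: "0 \<le> m" "m < (int k + 1) div 2"
    and filled: "staircase_filled k \<sigma> (m + 1) h"
  shows "staircase_filled k \<sigma> m (raise_minima (\<lambda>x. x mod int k = (2 * m - (\<sigma> - 1)) mod int k) h)"
    (is "staircase_filled k \<sigma> m ?h'")
proof -
  define l \<delta> where "l = (int k + 1) div 2" and "\<delta> = int k mod 2"
  have l: "int k = 2 * l - \<delta>" "0 \<le> \<delta>" "\<delta> \<le> 1" unfolding l_def \<delta>_def by presburger+
  have l1: "1 \<le> l" and l2: "\<delta> = 1 \<Longrightarrow> 2 \<le> l" using l k by linarith+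
  have D: "i + 1 \<le> h (2 * j - (i - 1))"
    if "0 \<le> j" "j \<le> i - 1" "i - \<delta> * (j div l) < \<sigma> \<or> i - \<delta> * (j div l) = \<sigma> \<and> m + 1 \<le> j mod l" for i j
    using staircase_filledD[OF filled that(1,2)] that(3) by (simp add: l_def \<delta>_def)
  have "i + 1 \<le> ?h' (2 * j - (i - 1))"
    if j: "0 \<le> j" "j \<le> i - 1" and t: "i - \<delta> * (j div l) < \<sigma> \<or> i - \<delta> * (j div l) = \<sigma> \<and> m \<le> j mod l" for i j
  proof (cases "i - \<delta> * (j div l) < \<sigma> \<or> i - \<delta> * (j div l) = \<sigma> \<and> m + 1 \<le> j mod l")
    case True
    then show ?thesis using D[OF j True] raise_minima_ge[of h] order_trans by blast
  next
    case False
    then have s: "i - \<delta> * (j div l) = \<sigma>" and jm: "j mod l = m" using t by auto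
    define q where "q = j div l"
    have jq: "j = l * q + m" using jm by (simp add: q_def flip: jm)
    define x where "x = 2 * j - (i - 1)"
    \<comment> \<open>The stage is defined as i - \<delta> * q for this purpose: moving on by
      \<open>q\<close> blocks changes the content by 2 * l * q - \<delta> * q, which is k *
      q.\<close>
    have "x = 2 * m - (\<sigma> - 1) + int k * q"
    proof -
      have "i = \<sigma> + \<delta> * q" using s by (simp add: q_def)
      then show ?thesis unfolding x_def l(1) by (subst jq) (simp add: algebra_simps)
    qed
    then have P: "x mod int k = (2 * m - (\<sigma> - 1)) mod int k" by simp
    have up: "i \<le> h (x + 1)"
    proof (cases "j \<le> i - 2")
      case True
      have "(i - 1) + 1 \<le> h (2 * j - (i - 1 - 1))" by (rule D) (use True j s in auto)
      then show ?thesis by (simp add: x_def algebra_simps)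
    next
      case False
      then have "x + 1 = i" using j by (simp add: x_def)
      then show ?thesis using is_profileD(3)[OF h, of "x + 1"] by simp
    qed
    have down: "i \<le> h (x - 1)"
    proof (cases "j = 0")
      case True
      then have "x - 1 = - i" by (simp add: x_def)
      then show ?thesis using is_profileD(3)[OF h, of "x - 1"] by simp
    next
      case False
      have "(i - 1) - \<delta> * ((j - 1) div l) < \<sigma> \<or> (i - 1) - \<delta> * ((j - 1) div l) = \<sigma> \<and> m + 1 \<le> (j - 1) mod l"
      proof (cases "m = 0")
        case True
        have e: "j - 1 = l * (q - 1) + (l - 1)" using jq True by (simp add: algebra_simps)
        have "(j - 1) div l = q - 1" by (rule int_div_pos_eq[OF e]) (use l1 in auto)
        moreover have "(j - 1) mod l = l - 1" by (rule int_mod_pos_eq[OF e]) (use l1 in auto)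
        \<comment> \<open>For odd \<open>k\<close> the box is in stage \<open>\<sigma>\<close> with
          index l - 1, and this is at least m + 1 = 1 because l >= 2.\<close>
        ultimately show ?thesis using s l(2,3) l2 True
          by (cases "\<delta> = 0") (auto simp: q_def[symmetric] algebra_simps)
      next
        case False
        have e: "j - 1 = l * q + (m - 1)" using jq by simp
        have "(j - 1) div l = q" by (rule int_div_pos_eq[OF e]) (use m False l_def in auto)
        then show ?thesis using s by (simp add: q_def[symmetric])
      qed
      then have "(i - 1) + 1 \<le> h (2 * (j - 1) - (i - 1 - 1))" using j False by (intro D) auto
      then show ?thesis by (simp add: x_def algebra_simps)
    qed
    have "even (h x + x)" "even (x + (i - 1))" using is_profileD(4)[OF h, of x] by (auto simp: x_def)
    then have "even (h x + (i - 1))" by presburger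
    moreover have "i - 1 \<le> h x" using up is_profileD(1)[OF h, of x] by linarith
    ultimately have "i + 1 \<le> h x \<or> h x = i - 1" by presburger
    then have "i + 1 \<le> ?h' x"
    proof
      assume "i + 1 \<le> h x"
      then show ?thesis using raise_minima_ge[of h x] order_trans by blast
    next
      assume 2: "h x = i - 1"
      then have "h (x - 1) = h x + 1" "h (x + 1) = h x + 1"
        using up down is_profileD(1,2)[OF h, of x] by linarith+
      then show ?thesis using P 2 by (simp add: raise_minima_def)
    qed
    then show ?thesis by (simp add: x_def)
  qed
  then show ?thesis by (auto simp: staircase_filled_def Let_def l_def \<delta>_def)
qed

text \<open>No letter is spent between stages: in a box of stage \<sigma> + 1 the index modulo
  \<open>l\<close> is at most \<open>\<sigma>\<close>, so only min (\<sigma> + 1) l values of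
  \<open>m\<close> occur.\<close>

lemma staircase_filled_next:
  assumes "2 \<le> k" "0 \<le> \<sigma>" "staircase_filled k \<sigma> 0 h \<or> \<sigma> = 0"
  shows "staircase_filled k (\<sigma> + 1) (min (\<sigma> + 1) ((int k + 1) div 2)) h"
proof -
  define l \<delta> where "l = (int k + 1) div 2" and "\<delta> = int k mod 2"
  have l: "1 \<le> l" "0 \<le> \<delta>" "\<delta> \<le> 1" using assms(1) unfolding l_def \<delta>_def by presburger+
  have "i + 1 \<le> h (2 * j - (i - 1))"
    if j: "0 \<le> j" "j \<le> i - 1"
      and t: "i - \<delta> * (j div l) < \<sigma> + 1 \<or> i - \<delta> * (j div l) = \<sigma> + 1 \<and> min (\<sigma> + 1) l \<le> j mod l" for i j
  proof -
    define q where "q = j div l"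
    have q: "j = l * q + j mod l" "0 \<le> q" "0 \<le> j mod l" "j mod l < l"
      using l j by (auto simp: q_def pos_imp_zdiv_nonneg_iff)
    have "\<delta> * q \<le> 1 * q" "1 * q \<le> l * q" using l q by (intro mult_right_mono; simp)+
    then have "i - \<delta> * q \<ge> 1 + j mod l" using q(1) j by linarith
    then have "i - \<delta> * q < \<sigma> + 1" "1 \<le> i - \<delta> * q" using t q unfolding q_def[symmetric] by auto
    then have "\<sigma> \<noteq> 0" and c: "i - \<delta> * (j div l) < \<sigma> \<or> i - \<delta> * (j div l) = \<sigma> \<and> 0 \<le> j mod l"
      using q(3) unfolding q_def by linarith+
    then show ?thesis
      using assms(3) staircase_filledD[OF _ j c[unfolded l_def \<delta>_def]] by blast
  qed
  then show ?thesis by (auto simp: staircase_filled_def Let_def l_def \<delta>_def)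
qed

definition word_profile :: "nat \<Rightarrow> (nat \<Rightarrow> int) \<Rightarrow> nat \<Rightarrow> int \<Rightarrow> int"
  where "word_profile k w = profile (\<lambda>a x. x mod int k = w a mod int k)"

lemma word_profile_Suc:
  "\<exists>w'. word_profile k w' (Suc n) = raise_minima (\<lambda>x. x mod int k = s mod int k) (word_profile k w n)"
proof
  have "profile (\<lambda>a x. x mod int k = (w(Suc n := s)) a mod int k) n = profile (\<lambda>a x. x mod int k = w a mod int k) n"
    by (rule profile_cong) simp
  then show "word_profile k (w(Suc n := s)) (Suc n) =
      raise_minima (\<lambda>x. x mod int k = s mod int k) (word_profile k w n)"
    by (simp add: word_profile_def)
qed

lemma word_stage:
  assumes k: "2 \<le> k" and "staircase_filled k \<sigma> (int m) (word_profile k w n)" "int m \<le> (int k + 1) div 2"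
  shows "\<exists>w'. staircase_filled k \<sigma> 0 (word_profile k w' (n + m))"
  using assms(2,3)
proof (induction m arbitrary: w n)
  case 0
  then show ?case by auto
next
  case (Suc m)
  obtain w' where w': "word_profile k w' (Suc n) =
      raise_minima (\<lambda>x. x mod int k = (2 * int m - (\<sigma> - 1)) mod int k) (word_profile k w n)"
    using word_profile_Suc by blast
  have "staircase_filled k \<sigma> (int m) (word_profile k w' (Suc n))"
    unfolding w' by (rule staircase_filled_step) (use Suc.prems k in \<open>auto simp: word_profile_def is_profile_profile add.commute\<close>)
  then show ?case using Suc.IH[of w' "Suc n"] Suc.prems by auto
qed

lemma staircase_word_filled:
  assumes "2 \<le> k"
  shows "\<exists>w. staircase_filled k (int \<sigma>) 0 (word_profile k w (\<Sum>\<tau>=1..\<sigma>. min \<tau> ((k + 1) div 2))) \<or> \<sigma> = 0"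
proof (induction \<sigma>)
  case (Suc \<sigma>)
  then obtain w where "staircase_filled k (int \<sigma>) 0 (word_profile k w (\<Sum>\<tau>=1..\<sigma>. min \<tau> ((k + 1) div 2))) \<or> int \<sigma> = 0"
    by auto
  from staircase_filled_next[OF assms _ this]
  have "staircase_filled k (int (Suc \<sigma>)) (int (min (Suc \<sigma>) ((k + 1) div 2)))
      (word_profile k w (\<Sum>\<tau>=1..\<sigma>. min \<tau> ((k + 1) div 2)))"
    by (simp add: of_nat_min zdiv_int add.commute)
  from word_stage[OF assms this] show ?case by (simp add: zdiv_int)
qed simp

section \<open>Length of the word and closed form of the cost\<close>

lemma staircase_cost_eq:
  "staircase_cost (int r) k = int (\<Sum>\<tau>=1..r. min \<tau> ((k + 1) div 2))"
proof (induction r)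
  case (Suc r)
  define l where "l = (k + 1) div 2"
  have "{..<l} \<inter> {i. i \<le> r} = {..<min (Suc r) l}" by auto
  then have "(\<Sum>i<l. if i \<le> r then 1 else (0::int)) = int (min (Suc r) l)"
    by (simp add: sum.If_cases)
  moreover have "max 0 (int (Suc r) - int i) = max 0 (int r - int i) + (if i \<le> r then 1 else 0)" for i
    by auto
  ultimately have "staircase_cost (int (Suc r)) k = staircase_cost (int r) k + int (min (Suc r) l)"
    unfolding staircase_cost_def l_def by (simp only: sum.distrib)
  then show ?case using Suc by (simp add: l_def)
qed (simp add: staircase_cost_def)

lemma staircase_cost_nonpos: "r \<le> 0 \<Longrightarrow> staircase_cost r k = 0"
  by (simp add: staircase_cost_def)

lemma staircase_word:
  assumes "2 \<le> k"
  shows "\<exists>w. \<forall>x. r \<le> word_profile k w (nat (staircase_cost r k)) x"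
proof (cases "r \<le> 0")
  case True
  have "r \<le> word_profile k w n x" for w n x
    using is_profileD(3)[OF is_profile_profile, of x _ n] True by (simp add: word_profile_def) (meson abs_ge_zero order_trans)
  then show ?thesis by blast
next
  case False
  define n where "n = nat r"
  have n: "int n = r" "n \<noteq> 0" using False by (auto simp: n_def)
  obtain w where w: "staircase_filled k r 0 (word_profile k w (nat (staircase_cost r k)))"
  proof -
    have "nat (staircase_cost r k) = (\<Sum>\<tau>=1..n. min \<tau> ((k + 1) div 2))"
      using staircase_cost_eq[of n k] n by (metis nat_int)
    then show ?thesis using staircase_word_filled[OF assms, of n] n that by metis
  qed
  let ?h = "word_profile k w (nat (staircase_cost r k))"
  have h: "is_profile ?h" by (simp add: word_profile_def is_profile_profile)
  define l \<delta> where "l = (int k + 1) div 2" and "\<delta> = int k mod 2"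
  have l: "1 \<le> l" "0 \<le> \<delta>" using assms unfolding l_def \<delta>_def by presburger+
  have D: "i + 1 \<le> ?h (2 * j - (i - 1))" if "0 \<le> j" "j \<le> i - 1" "i \<le> r" for i j
  proof (rule staircase_filledD[OF w that(1,2)])
    have "0 \<le> \<delta> * (j div l)" using l that by (simp add: pos_imp_zdiv_nonneg_iff)
    moreover have "0 \<le> j mod l" using l by simp
    ultimately show "i - (int k mod 2) * (j div ((int k + 1) div 2)) < r \<or>
      i - (int k mod 2) * (j div ((int k + 1) div 2)) = r \<and> 0 \<le> j mod ((int k + 1) div 2)"
      using that(3) unfolding l_def \<delta>_def by linarith
  qed
  have "r \<le> ?h x" for x
  proof (cases "r \<le> \<bar>x\<bar>")
    case True
    then show ?thesis using is_profileD(3)[OF h, of x] by linarith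
  next
    case F: False
    show ?thesis
    \<comment> \<open>A box of antidiagonal \<open>r\<close> forces the value r + 1 and one of
      antidiagonal r - 1 the value r. The parity of x decides which of the two has content
      x.\<close>
    proof (cases "even (x + r)")
      case True
      have "even (x + (r - 1 - 1))" using True by simp
      then obtain j where j: "x + (r - 1 - 1) = 2 * j" by (elim dvdE)
      have "\<bar>x\<bar> \<le> r - 2" using True F by presburger
      then have "(r - 1) + 1 \<le> ?h (2 * j - (r - 1 - 1))" using j by (intro D) linarith+
      moreover have "2 * j - (r - 1 - 1) = x" using j by linarith
      ultimately show ?thesis by simp
    next
      case False
      have "even (x + (r - 1))" using False by simp
      then obtain j where j: "x + (r - 1) = 2 * j" by (elim dvdE)
      have "r + 1 \<le> ?h (2 * j - (r - 1))" using j F by (intro D) linarith+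
      moreover have "2 * j - (r - 1) = x" using j by linarith
      ultimately show ?thesis by simp
    qed
  qed
  then show ?thesis by blast
qed

lemma sum_diff_arith: "2 * (\<Sum>i<l. r - int i) = int l * (2 * r - int l + 1)"
  by (induction l) (auto simp: algebra_simps)

lemma choose_two_Suc: "2 * int (Suc n choose 2) = int n * (int n + 1)"
proof -
  have "even (Suc n * n)" by simp
  then have "2 * (Suc n choose 2) = Suc n * n" by (simp add: choose_two)
  moreover have "2 * int c = int n * (int n + 1)" if "2 * c = Suc n * n" for c
    using arg_cong[OF that, of int] by (simp add: algebra_simps)
  ultimately show ?thesis by blast
qed

lemma pbn_codim_eq:
  assumes "2 \<le> k" "- 1 \<le> r"
  shows "pbn_codim r k = staircase_cost r k"
proof -
  define l where "l = (k + 1) div 2"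
  have "\<lceil>real k / 2\<rceil> = int l"
  proof (rule ceiling_unique)
    have "k \<le> 2 * l" "2 * l \<le> k + 1" unfolding l_def by presburger+
    then have "real k \<le> 2 * real l" "2 * real l \<le> real k + 1" by linarith+
    then show "real_of_int (int l) - 1 < real k / 2" "real k / 2 \<le> real_of_int (int l)" by simp_all
  qed
  then have c: "pbn_codim r k = (if int l \<le> r - 1 then int (Suc l choose 2) + int l * (r - int l)
      else int (nat (r + 1) choose 2))"
    by (simp add: pbn_codim_def Let_def)
  show ?thesis
  proof (cases "int l \<le> r - 1")
    case True
    have "staircase_cost r k = (\<Sum>i<l. r - int i)"
      unfolding staircase_cost_def l_def[symmetric] by (rule sum.cong) (use True in auto)
    then have "2 * staircase_cost r k = int l * (2 * r - int l + 1)" using sum_diff_arith by simp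
    moreover have "2 * pbn_codim r k = int l * (int l + 1) + 2 * (int l * (r - int l))"
      using c True choose_two_Suc[of l] by simp
    ultimately have "2 * pbn_codim r k = 2 * staircase_cost r k" by (simp add: algebra_simps)
    then show ?thesis by simp
  next
    case False
    show ?thesis
    proof (cases "r = - 1")
      case True
      then show ?thesis using c False by (simp add: staircase_cost_nonpos)
    next
      case r: False
      define n where "n = nat r"
      have n: "int n = r" "n \<le> l" using r assms False by (auto simp: n_def)
      have "staircase_cost r k = (\<Sum>i<n. max 0 (r - int i))"
        unfolding staircase_cost_def l_def[symmetric]
        by (rule sum.mono_neutral_right) (use n in auto)
      also have "\<dots> = (\<Sum>i<n. r - int i)" by (rule sum.cong) (use n in auto)
      finally have "2 * staircase_cost r k = int n * (int n + 1)"
        using sum_diff_arith[of r n] n by simp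
      moreover have "nat (r + 1) = Suc n" using n by auto
      ultimately have "2 * pbn_codim r k = 2 * staircase_cost r k"
        using c False choose_two_Suc[of n] by simp
      then show ?thesis by simp
    qed
  qed
qed

section \<open>The rank as a game\<close>

text \<open>
  \<open>u\<close> counts the chips of an effective divisor to the right of the current loop.  A loop from which
  \<open>f\<close> chips are removed needs more than \<open>f\<close> chips, unless \<open>f = 0\<close> and it can do without any.
\<close>

definition loop_step :: "(int \<Rightarrow> bool) \<Rightarrow> nat \<Rightarrow> int \<Rightarrow> int \<Rightarrow> bool"
  where "loop_step P f u' u \<longleftrightarrow> u + int f < u' \<or> f = 0 \<and> u' = u \<and> P u"

text \<open>\<open>S a\<close> is the set of numbers for which loop \<open>a\<close> is special, and
  \<open>e a\<close> is the number of chips removed there. Index 0 stands for chips removed at the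
  left end of the chain.\<close>

primrec reachable :: "(nat \<Rightarrow> int \<Rightarrow> bool) \<Rightarrow> int \<Rightarrow> (nat \<Rightarrow> nat) \<Rightarrow> nat \<Rightarrow> int \<Rightarrow> bool" where
  "reachable S d e 0 u \<longleftrightarrow> u \<le> d - int (e 0)"
| "reachable S d e (Suc a) u \<longleftrightarrow> (\<exists>u'. reachable S d e a u' \<and> loop_step (S (Suc a)) (e (Suc a)) u' u)"

lemma reachable_antimono: "reachable S d e a u \<Longrightarrow> v \<le> u \<Longrightarrow> reachable S d e a v"
proof (cases a)
  case (Suc b)
  assume "reachable S d e a u" "v \<le> u"
  then show ?thesis unfolding Suc by (cases "v = u") (fastforce simp: loop_step_def)+
qed simp

lemma reachable_cong:
  "(\<And>i. i \<le> a \<Longrightarrow> e i = e' i) \<Longrightarrow> reachable S d e a u \<longleftrightarrow> reachable S d e' a u"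
  by (induction a arbitrary: u) auto

lemma reachable_path:
  "reachable S d e a v \<longleftrightarrow>
    (\<exists>u. u 0 \<le> d - int (e 0) \<and> u a = v \<and> (\<forall>i\<in>{1..a}. loop_step (S i) (e i) (u (i - 1)) (u i)))"
proof (induction a arbitrary: v)
  case 0
  show ?case by (auto intro: exI[of _ "\<lambda>_. v"])
next
  case (Suc a)
  show ?case
  proof
    assume "reachable S d e (Suc a) v"
    then obtain u where u: "u 0 \<le> d - int (e 0)" "\<forall>i\<in>{1..a}. loop_step (S i) (e i) (u (i - 1)) (u i)"
      and s: "loop_step (S (Suc a)) (e (Suc a)) (u a) v" using Suc by auto
    have "\<forall>i\<in>{1..Suc a}. loop_step (S i) (e i) ((u(Suc a := v)) (i - 1)) ((u(Suc a := v)) i)"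
      using u(2) s by (auto simp: le_Suc_eq)
    then show "\<exists>u. u 0 \<le> d - int (e 0) \<and> u (Suc a) = v \<and>
        (\<forall>i\<in>{1..Suc a}. loop_step (S i) (e i) (u (i - 1)) (u i))"
      using u(1) by (intro exI[of _ "u(Suc a := v)"]) auto
  next
    assume "\<exists>u. u 0 \<le> d - int (e 0) \<and> u (Suc a) = v \<and>
        (\<forall>i\<in>{1..Suc a}. loop_step (S i) (e i) (u (i - 1)) (u i))"
    then obtain u where u: "u 0 \<le> d - int (e 0)" "u (Suc a) = v"
      "\<forall>i\<in>{1..Suc a}. loop_step (S i) (e i) (u (i - 1)) (u i)" by blast
    then have "reachable S d e a (u a)" using Suc by auto
    moreover have "loop_step (S (Suc a)) (e (Suc a)) (u a) v" using u by force
    ultimately show "reachable S d e (Suc a) v" by auto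
  qed
qed

text \<open>With x = d + 1 - a - u, an ordinary loop, which uses up one chip, leaves x unchanged,
  while a special loop passed without loss lowers x by one.\<close>

definition left_profile :: "(nat \<Rightarrow> int \<Rightarrow> bool) \<Rightarrow> int \<Rightarrow> nat \<Rightarrow> int \<Rightarrow> int"
  where "left_profile S d = profile (\<lambda>a x. S a (d + 1 - int a - x))"

lemma left_profile_Suc:
  "left_profile S d (Suc a) = raise_minima (\<lambda>x. S (Suc a) (d + 1 - int (Suc a) - x)) (left_profile S d a)"
  by (simp add: left_profile_def)

lemma is_profile_left_profile: "is_profile (left_profile S d a)"
  by (simp add: left_profile_def is_profile_profile)

text \<open>One half of the statement that (h x + x) / 2 is the least number of removed chips that
  can block the value d + 1 - a - x. If the last loop raises x, the extra chip gained is paid for by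
  the special step, which starts at x + 1.\<close>

lemma reachable_if:
  assumes "2 * int (\<Sum>i\<le>a. e i) + 2 \<le> left_profile S d a x + x"
  shows "reachable S d e a (d + 1 - int a - x)"
  using assms
proof (induction a arbitrary: x)
  case 0
  then show ?case by (auto simp: left_profile_def abs_if split: if_splits)
next
  case (Suc a)
  let ?h = "left_profile S d a" and ?f = "e (Suc a)"
  let ?u = "d + 1 - int (Suc a) - x"
  have h: "is_profile ?h" by (rule is_profile_left_profile)
  have sum: "2 * int (\<Sum>i\<le>a. e i) + 2 * int ?f + 2 \<le> left_profile S d (Suc a) x + x"
    using Suc.prems by simp
  consider (keep) "left_profile S d (Suc a) x = ?h x"
    | (raise) "left_profile S d (Suc a) x = ?h x + 2" "S (Suc a) ?u" "?h (x - 1) = ?h x + 1" "?h (x + 1) = ?h x + 1"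
  proof -
    have "left_profile S d (Suc a) x = ?h x \<or> (left_profile S d (Suc a) x = ?h x + 2 \<and> S (Suc a) ?u \<and>
        ?h (x - 1) = ?h x + 1 \<and> ?h (x + 1) = ?h x + 1)"
      unfolding left_profile_Suc by (simp add: raise_minima_def)
    then show ?thesis using that by blast
  qed
  then show ?case
  proof cases
    case keep
    have "reachable S d e a (d + 1 - int a - (x - int ?f))"
      using Suc.IH[of "x - int ?f"] sum keep profile_add_mono(3)[OF h, of "x - int ?f" x] by simp
    then show ?thesis by (auto simp: loop_step_def)
  next
    case raise
    show ?thesis
    proof (cases "?f = 0")
      case True
      have "reachable S d e a (d + 1 - int a - (x + 1))"
        using Suc.IH[of "x + 1"] sum raise True by simp
      moreover have "d + 1 - int a - (x + 1) = ?u" by simp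
      ultimately show ?thesis using True raise(2) by (auto simp: loop_step_def)
    next
      case False
      \<comment> \<open>If chips are removed from a special loop, an ordinary step is still
        possible: the old profile descends from x - 1 to x, which makes up for the 2 by which the
        new one is larger.\<close>
      have "reachable S d e a (d + 1 - int a - (x - int ?f))"
        using Suc.IH[of "x - int ?f"] sum raise False profile_add_mono(3)[OF h, of "x - int ?f" "x - 1"] by simp
      then show ?thesis by (auto simp: loop_step_def)
    qed
  qed
qed

text \<open>The optimal removal is read off from the old profile near x. If it descends to the right
  of x, or if x is raised, the loop is spared and x + 1 is blocked before it. If x - 1 is lower, one
  chip is removed on the loop and x - 1 is blocked with one chip fewer. If the loop is not special
  at x, it is spared and x itself is blocked.\<close>

lemma not_reachable_if:
  assumes "left_profile S d a x + x < 2 * int n + 2"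
  shows "\<exists>e. (\<Sum>i\<le>a. e i) = n \<and> \<not> reachable S d e a (d + 1 - int a - x)"
  using assms
proof (induction a arbitrary: x n)
  case 0
  then have "\<not> reachable S d (\<lambda>_. n) 0 (d + 1 - int 0 - x)" by (auto simp: left_profile_def)
  then show ?case by (intro exI[of _ "\<lambda>_. n"]) simp
next
  case (Suc a)
  let ?h = "left_profile S d a" and ?u = "d + 1 - int (Suc a) - x"
  have h: "is_profile ?h" by (rule is_profile_left_profile)
  have extend: ?case
    if n': "n = n' + f" and e: "(\<Sum>i\<le>a. e i) = n'" and t: "\<not> reachable S d e a t"
      and nr: "\<And>v. loop_step (S (Suc a)) f v ?u \<Longrightarrow> t \<le> v"
    for n' f t and e :: "nat \<Rightarrow> nat"
  proof (intro exI conjI)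
    show "(\<Sum>i\<le>Suc a. (e(Suc a := f)) i) = n" using n' e by simp
    have "reachable S d (e(Suc a := f)) a v \<longleftrightarrow> reachable S d e a v" for v
      by (rule reachable_cong) simp
    then show "\<not> reachable S d (e(Suc a := f)) (Suc a) ?u" using nr t reachable_antimono[of S d e a _ t] by auto
  qed
  have stay: ?case if "?h (x + 1) + (x + 1) < 2 * int n + 2"
  proof -
    obtain e where e: "(\<Sum>i\<le>a. e i) = n" "\<not> reachable S d e a (d + 1 - int a - (x + 1))"
      using Suc.IH[OF \<open>?h (x + 1) + (x + 1) < 2 * int n + 2\<close>] by blast
    show ?case
      by (rule extend[of n 0 e, OF _ e]) (auto simp: loop_step_def)
  qed
  consider (raise) "S (Suc a) ?u" "?h (x - 1) = ?h x + 1" "?h (x + 1) = ?h x + 1"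
    | (right) "?h (x + 1) = ?h x - 1" "left_profile S d (Suc a) x = ?h x"
    | (left) "?h (x - 1) = ?h x - 1" "left_profile S d (Suc a) x = ?h x"
    | (none) "\<not> S (Suc a) ?u" "left_profile S d (Suc a) x = ?h x"
    using is_profileD(1,2)[OF h, of x] unfolding left_profile_Suc by (force simp: raise_minima_def)
  then show ?case
  proof cases
    case raise
    then have "left_profile S d (Suc a) x = ?h x + 2"
      unfolding left_profile_Suc by (simp add: raise_minima_def)
    then show ?thesis using Suc.prems raise by (intro stay) simp
  next
    case right
    then show ?thesis using Suc.prems by (intro stay) simp
  next
    case left
    have "\<bar>x - 1\<bar> \<le> ?h (x - 1)" by (rule is_profileD(3)[OF h])
    then have n: "1 \<le> n" using left Suc.prems by simp
    have "?h (x - 1) + (x - 1) < 2 * int (n - 1) + 2" using left Suc.prems n by simp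
    from Suc.IH[OF this] obtain e where e: "(\<Sum>i\<le>a. e i) = n - 1" "\<not> reachable S d e a (d + 1 - int a - (x - 1))"
      by blast
    show ?thesis
      by (rule extend[of "n - 1" 1 e, OF _ e]) (use n in \<open>auto simp: loop_step_def\<close>)
  next
    case none
    have "?h x + x < 2 * int n + 2" using none Suc.prems by simp
    from Suc.IH[OF this] obtain e where e: "(\<Sum>i\<le>a. e i) = n" "\<not> reachable S d e a (d + 1 - int a - x)"
      by blast
    show ?thesis
      by (rule extend[of n 0 e, OF _ e]) (use none in \<open>auto simp: loop_step_def\<close>)
  qed
qed

section \<open>The two halves of the chain and the middle loop\<close>

definition winning_path :: "(nat \<Rightarrow> int \<Rightarrow> bool) \<Rightarrow> int \<Rightarrow> nat \<Rightarrow> (nat \<Rightarrow> nat) \<Rightarrow> (nat \<Rightarrow> int) \<Rightarrow> bool"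
  where "winning_path S d n e u \<longleftrightarrow> u 0 \<le> d - int (e 0) \<and> int (e (Suc n)) \<le> u n \<and>
    (\<forall>i\<in>{1..n}. loop_step (S i) (e i) (u (i - 1)) (u i))"

lemma loop_step_reverse: "loop_step (\<lambda>v. P (- v)) f (- u) (- u') \<longleftrightarrow> loop_step P f u' u"
  by (auto simp: loop_step_def)

text \<open>Read from the right end with the signs reversed, the second half of a path obeys the
  same rules. The budget there is 0, because at the right end only the removed chips have to be
  present.\<close>

lemma winning_path_split:
  assumes "1 \<le> g"
  shows "(\<exists>u. winning_path S d (2 * g - 1) e u) \<longleftrightarrow>
    (\<exists>u w. reachable S d e (g - 1) u \<and> loop_step (S g) (e g) u w \<and>
      reachable (\<lambda>j v. S (2 * g - j) (- v)) 0 (\<lambda>j. e (2 * g - j)) (g - 1) (- w))"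
    (is "?L \<longleftrightarrow> ?R")
proof
  assume ?L
  then obtain u where u: "u 0 \<le> d - int (e 0)" "int (e (2 * g)) \<le> u (2 * g - 1)"
    "\<And>i. 1 \<le> i \<Longrightarrow> i \<le> 2 * g - 1 \<Longrightarrow> loop_step (S i) (e i) (u (i - 1)) (u i)"
    using assms by (auto simp: winning_path_def)
  have "reachable S d e (g - 1) (u (g - 1))"
    unfolding reachable_path using u by (intro exI[of _ u]) auto
  moreover have "loop_step (S g) (e g) (u (g - 1)) (u g)" using u assms by auto
  moreover have "reachable (\<lambda>j v. S (2 * g - j) (- v)) 0 (\<lambda>j. e (2 * g - j)) (g - 1) (- u g)"
    unfolding reachable_path
  proof (intro exI[of _ "\<lambda>j. - u (2 * g - 1 - j)"] conjI ballI)
    show "- u (2 * g - 1 - 0) \<le> 0 - int (e (2 * g - 0))" using u by simp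
    show "- u (2 * g - 1 - (g - 1)) = - u g" using assms by (simp add: algebra_simps)
    fix i assume "i \<in> {1..g - 1}"
    then have "2 * g - 1 - (i - 1) = 2 * g - i" "2 * g - 1 - i = 2 * g - i - 1" "1 \<le> 2 * g - i" "2 * g - i \<le> 2 * g - 1"
      by auto
    then show "loop_step (\<lambda>v. S (2 * g - i) (- v)) (e (2 * g - i)) (- u (2 * g - 1 - (i - 1))) (- u (2 * g - 1 - i))"
      using u(3)[of "2 * g - i"] loop_step_reverse[of "S (2 * g - i)"] by simp
  qed
  ultimately show ?R by blast
next
  assume ?R
  then obtain v v' where v: "reachable S d e (g - 1) v" "loop_step (S g) (e g) v v'"
    "reachable (\<lambda>j v. S (2 * g - j) (- v)) 0 (\<lambda>j. e (2 * g - j)) (g - 1) (- v')" by blast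
  obtain u where u: "u 0 \<le> d - int (e 0)" "\<forall>i\<in>{1..g - 1}. loop_step (S i) (e i) (u (i - 1)) (u i)" "u (g - 1) = v"
    using v(1) unfolding reachable_path by blast
  obtain w where w: "w 0 \<le> 0 - int (e (2 * g - 0))"
      "\<forall>i\<in>{1..g - 1}. loop_step (\<lambda>v. S (2 * g - i) (- v)) (e (2 * g - i)) (w (i - 1)) (w i)" "w (g - 1) = - v'"
    using v(3) unfolding reachable_path by blast
  have mid: "loop_step (S g) (e g) (u (g - 1)) (- w (g - 1))" using v(2) u(3) w(3) by simp
  define p where "p i = (if i < g then u i else - w (2 * g - 1 - i))" for i
  have "loop_step (S i) (e i) (p (i - 1)) (p i)" if i: "1 \<le> i" "i \<le> 2 * g - 1" for i
  proof -
    consider "i < g" | "i = g" | "g < i" by linarith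
    then show ?thesis
    proof cases
      case 1
      moreover have "i - 1 < g" using 1 by simp
      ultimately show ?thesis using u(2) i by (simp add: p_def)
    next
      case 2
      moreover have "2 * g - 1 - g = g - 1" by simp
      ultimately show ?thesis using mid assms by (simp add: p_def)
    next
      case 3
      define j where "j = 2 * g - i"
      have j: "i = 2 * g - j" "j \<in> {1..g - 1}" using 3 i by (auto simp: j_def)
      then have "loop_step (\<lambda>v. S i (- v)) (e i) (w (j - 1)) (w j)" using w(2) by simp
      moreover have "p (i - 1) = - w j" "p i = - w (j - 1)" using j 3 by (auto simp: p_def)
      ultimately show ?thesis using loop_step_reverse[of "S i" "e i" "- w (j - 1)" "- w j"] by simp
    qed
  qed
  moreover have "Suc (2 * g - 1) = 2 * g" using assms by simp
  ultimately have "winning_path S d (2 * g - 1) e p"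
    using u(1) w(1) assms by (auto simp: winning_path_def p_def)
  then show ?L by blast
qed

text \<open>
  The symmetry hypothesis says that the right half of the chain mirrors the left half, so that one
  profile describes both.
\<close>

lemma winning_path_iff:
  assumes g: "1 \<le> g"
    and sym: "\<And>a v. 1 \<le> a \<Longrightarrow> a < g \<Longrightarrow> S (2 * g - a) v \<longleftrightarrow> S a (v + 2 * int g - 2 * int a)"
    and mid: "\<And>v w. even (v - w) \<Longrightarrow> S g v \<longleftrightarrow> S g w"
  defines "h \<equiv> left_profile S (2 * int g - 2) (g - 1)"
  shows "(\<forall>e. (\<Sum>i\<le>2 * g. e i) = n \<longrightarrow> (\<exists>u. winning_path S (2 * int g - 2) (2 * g - 1) e u)) \<longleftrightarrow>
    (\<forall>x. int n + 1 \<le> h x) \<or> (\<forall>x. int n \<le> h x) \<and> S g (int g - 1 - int n)"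
    (is "?L \<longleftrightarrow> ?R")
proof -
  let ?S' = "\<lambda>j v. S (2 * g - j) (- v)"
  have h: "is_profile h" by (simp add: h_def is_profile_left_profile)
  have h': "left_profile ?S' 0 (g - 1) x = h (- x)" for x
  proof -
    have "left_profile ?S' 0 (g - 1) = profile (\<lambda>a x. S a (2 * int g - 2 + 1 - int a - - x)) (g - 1)"
      unfolding left_profile_def
    proof (rule profile_cong)
      fix i assume i: "1 \<le> i" "i \<le> g - 1"
      show "(\<lambda>x. S (2 * g - i) (- (0 + 1 - int i - x))) = (\<lambda>x. S i (2 * int g - 2 + 1 - int i - - x))"
        using sym[of i] i g by (auto simp: fun_eq_iff algebra_simps)
    qed
    then show ?thesis
      using profile_reflect[of "\<lambda>a x. S a (2 * int g - 2 + 1 - int a - x)"]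
      by (simp add: h_def left_profile_def)
  qed
  have split_sum: "(\<Sum>i\<le>2 * g. e i) = (\<Sum>i\<le>g - 1. e i) + e g + (\<Sum>j\<le>g - 1. e (2 * g - j))" for e :: "nat \<Rightarrow> nat"
  proof -
    have "{..2 * g} = {..g - 1} \<union> {g} \<union> {g + 1..2 * g}" using g by auto
    then have "(\<Sum>i\<le>2 * g. e i) = (\<Sum>i\<le>g - 1. e i) + e g + (\<Sum>i\<in>{g + 1..2 * g}. e i)"
      using g by (simp add: sum.union_disjoint)
    also have "(\<Sum>i\<in>{g + 1..2 * g}. e i) = (\<Sum>j\<le>g - 1. e (2 * g - j))"
      by (rule sum.reindex_bij_witness[where i = "\<lambda>j. 2 * g - j" and j = "\<lambda>i. 2 * g - i"]) (use g in auto)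
    finally show ?thesis .
  qed
  have eqL: "2 * int g - 2 + 1 - int (g - 1) - x = int g - x" for x using g by simp
  have eqR: "0 + 1 - int (g - 1) - - y = - (int g - 2 - y)" for y using g by simp
  have left: "reachable S (2 * int g - 2) e (g - 1) (int g - x)"
    if "2 * int (\<Sum>i\<le>g - 1. e i) + 2 \<le> h x + x" for e x
    using reachable_if[of e "g - 1" S "2 * int g - 2" x] that unfolding eqL h_def by blast
  have right: "reachable ?S' 0 e (g - 1) (- (int g - 2 - y))"
    if "2 * int (\<Sum>i\<le>g - 1. e i) + 2 \<le> h y - y" for e y
    using reachable_if[of e "g - 1" ?S' 0 "- y", unfolded h' eqR] that by simp
  have notleft: "\<exists>e. (\<Sum>i\<le>g - 1. e i) = n \<and> \<not> reachable S (2 * int g - 2) e (g - 1) (int g - x)"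
    if "h x + x < 2 * int n + 2" for n x
    using not_reachable_if[of S "2 * int g - 2" "g - 1" x n] that unfolding eqL h_def by blast
  have notright: "\<exists>e. (\<Sum>i\<le>g - 1. e i) = n \<and> \<not> reachable ?S' 0 e (g - 1) (- (int g - 2 - y))"
    if "h y - y < 2 * int n + 2" for n y
    using not_reachable_if[of ?S' 0 "g - 1" "- y" n, unfolded h' eqR] that by simp
  show ?thesis
  proof
    assume R: ?R
    show ?L
    proof (intro allI impI)
      fix e :: "nat \<Rightarrow> nat" assume "(\<Sum>i\<le>2 * g. e i) = n"
      define e1 f e2 where "e1 = (\<Sum>i\<le>g - 1. e i)" and "f = e g" and "e2 = (\<Sum>j\<le>g - 1. e (2 * g - j))"
      have n: "n = e1 + f + e2" using \<open>_ = n\<close> split_sum[of e] by (simp add: e1_def f_def e2_def)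
      \<comment> \<open>The aim is the position x at which the left half begins to survive the
        removal of \<open>e1\<close> chips; g - x is then the best number with which to arrive at
        the middle loop.\<close>
      define Q where "Q m \<longleftrightarrow> 2 * int e1 + 2 \<le> h (int m - int g) + (int m - int g)" for m
      have Q: "Q (2 * g + e1 + 1)" using is_profileD(3)[OF h, of "int (2 * g + e1 + 1) - int g"] by (simp add: Q_def)
      have Q0: "\<not> Q 0" using profile_eq_abs[of "g - 1" "- int g"] by (simp add: Q_def h_def left_profile_def)
      obtain m where m: "\<not> Q m" "Q (Suc m)"
      proof (rule ccontr)
        assume "\<not> thesis"
        then have "\<not> Q m" for m by (induction m) (use Q0 that in auto)
        then show False using Q by blast
      qed
      define x where "x = int (Suc m) - int g"
      have x: "2 * int e1 + 2 \<le> h x + x" "h (x - 1) + (x - 1) < 2 * int e1 + 2"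
        using m by (auto simp: Q_def x_def algebra_simps)
      have "even (h (x - 1) + (x - 1))" by (rule is_profileD(4)[OF h])
      then have x': "h (x - 1) + (x - 1) = 2 * int e1" "h x = h (x - 1) + 1"
        using x is_profileD(1)[OF h, of "x - 1"] by (auto; presburger)+
      have L: "reachable S (2 * int g - 2) e (g - 1) (int g - x)"
        by (rule left) (use x e1_def in simp)
      have Rr: "reachable ?S' 0 (\<lambda>j. e (2 * g - j)) (g - 1) (- (int g - 2 - y))" if "2 * int e2 + 2 \<le> h y - y" for y
        by (rule right) (use that e2_def in simp)
      have up: "\<exists>u. winning_path S (2 * int g - 2) (2 * g - 1) e u" if "2 * int e2 + 2 \<le> h y - y" "loop_step (S g) (e g) (int g - x) (int g - 2 - y)" for y
        unfolding winning_path_split[OF g] using L Rr that by blast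
      show "\<exists>u. winning_path S (2 * int g - 2) (2 * g - 1) e u"
      \<comment> \<open>At x - 1 the left cost is exactly \<open>e1\<close>, so the right cost is h
        (x - 1) - e1. If this exceeds f + e2, an ordinary step through the middle loop suffices. In
        the case of equality the special position is needed when \<open>f\<close> is 0.\<close>
      proof (cases "h (x - 1) = int n")
        case False
        then have "int n + 1 \<le> h (x - 1)" using R by (metis le_less zless_imp_add1_zle add.commute)
        then have "2 * int e2 + 2 \<le> h (x - 1 + int f) - (x - 1 + int f)"
          using profile_add_mono(4)[OF h, of "x - 1" "x - 1 + int f"] x' n by simp
        moreover have "loop_step (S g) (e g) (int g - x) (int g - 2 - (x - 1 + int f))"
          by (simp add: loop_step_def f_def)
        ultimately show ?thesis using up by blast
      next
        case True
        have "\<not> int n + 1 \<le> h (x - 1)" using True by simp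
        then have spec: "S g (int g - 1 - int n)" and low: "\<And>x. int n \<le> h x" using R by blast+
        show ?thesis
        proof (cases "f = 0")
          case False
          have "2 * int e2 + 2 \<le> h (x - 1 + int f) - (x - 1 + int f)"
            using profile_add_mono(4)[OF h, of x "x - 1 + int f"] x' n True False by simp
          moreover have "loop_step (S g) (e g) (int g - x) (int g - 2 - (x - 1 + int f))"
            by (simp add: loop_step_def f_def)
          ultimately show ?thesis using up by blast
        next
          case f: True
          have "h (x - 1 - 1) = int n + 1"
            using is_profileD(2)[OF h, of "x - 1"] low[of "x - 1 - 1"] True by linarith
          then have "2 * int e2 + 2 \<le> h (x - 2) - (x - 2)" using x' n f True by simp
          \<comment> \<open>Since h (x - 1) = n has the parity of x - 1, the numbers g - x and g - 1
            - n have the same parity, and the middle loop does not distinguish them.\<close>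
          moreover have "S g (int g - x)"
            using spec mid[of "int g - 1 - int n" "int g - x"] is_profileD(4)[OF h, of "x - 1"] True by simp
          then have "loop_step (S g) (e g) (int g - x) (int g - 2 - (x - 2))"
            using f by (simp add: loop_step_def f_def)
          ultimately show ?thesis using up by blast
        qed
      qed
    qed
  next
    assume L: ?L
    \<comment> \<open>Optimal removals in both halves, chosen independently, leave only a narrow
      window for the numbers \<open>u\<close> and \<open>w\<close> before and after the middle
      loop.\<close>
    have key: "\<exists>u w. u < int g - x \<and> int g - 2 - y < w \<and> loop_step (S g) f u w"
      if "e1 + f + e2 = n" "h x + x < 2 * int e1 + 2" "h y - y < 2 * int e2 + 2" for e1 f e2 x y
    proof -
      obtain eL where eL: "(\<Sum>i\<le>g - 1. eL i) = e1" "\<not> reachable S (2 * int g - 2) eL (g - 1) (int g - x)"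
        using notleft[OF \<open>h x + x < _\<close>] by blast
      obtain eR where eR: "(\<Sum>i\<le>g - 1. eR i) = e2" "\<not> reachable ?S' 0 eR (g - 1) (- (int g - 2 - y))"
        using notright[OF \<open>h y - y < _\<close>] by blast
      define e where "e i = (if i < g then eL i else if i = g then f else eR (2 * g - i))" for i
      have eL_eq: "e i = eL i" if "i \<le> g - 1" for i using that g by (auto simp: e_def)
      have eR_eq: "e (2 * g - j) = eR j" if "j \<le> g - 1" for j using that g by (auto simp: e_def)
      have "(\<Sum>i\<le>g - 1. e i) = e1" unfolding eL(1)[symmetric] by (rule sum.cong) (use g in \<open>auto simp: e_def\<close>)
      moreover have "(\<Sum>j\<le>g - 1. e (2 * g - j)) = e2"
        unfolding eR(1)[symmetric] by (rule sum.cong) (use g in \<open>auto simp: e_def\<close>)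
      ultimately have "(\<Sum>i\<le>2 * g. e i) = n" using that(1) split_sum[of e] by (simp add: e_def)
      then obtain u w where uw: "reachable S (2 * int g - 2) e (g - 1) u" "loop_step (S g) (e g) u w"
        "reachable ?S' 0 (\<lambda>j. e (2 * g - j)) (g - 1) (- w)"
        using L winning_path_split[OF g, of S "2 * int g - 2" e] by blast
      have "reachable S (2 * int g - 2) eL (g - 1) u"
        using uw(1) reachable_cong[of "g - 1" e eL, OF eL_eq] by blast
      then have "u < int g - x" using eL(2) reachable_antimono not_le by blast
      moreover have "reachable ?S' 0 eR (g - 1) (- w)"
        using uw(3) reachable_cong[of "g - 1" "\<lambda>j. e (2 * g - j)" eR, OF eR_eq] by blast
      then have "- w < - (int g - 2 - y)" using eR(2) reachable_antimono not_le by blast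
      then have "int g - 2 - y < w" by linarith
      moreover have "loop_step (S g) f u w" using uw(2) by (simp add: e_def)
      ultimately show ?thesis by blast
    qed
    have low: "int n \<le> h x" for x
    proof (rule ccontr)
      assume less: "\<not> int n \<le> h x"
      have hx: "\<bar>x\<bar> \<le> h x" "even (h x + x)" using is_profileD(3,4)[OF h] by auto
      \<comment> \<open>\<open>e1\<close> chips block the left half at x, one chip is taken from the
        middle loop, and the remaining ones, at least h x - e1 in number, block the right half at
        the same x. Then u <= w, although the middle loop must use up more than one chip.\<close>
      define e1 where "e1 = nat ((h x + x) div 2)"
      have e1: "2 * int e1 = h x + x" using hx by (auto simp: e1_def)
      have "e1 + 1 + (n - 1 - e1) = n" using e1 hx less by linarith
      moreover have "h x - x < 2 * int (n - 1 - e1) + 2" using e1 hx less by linarith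
      ultimately obtain u w where "u < int g - x" "int g - 2 - x < w" "loop_step (S g) 1 u w"
        using key[of e1 1 "n - 1 - e1" x x] e1 by auto
      then show False by (simp add: loop_step_def)
    qed
    show ?R
    proof (cases "\<forall>x. int n + 1 \<le> h x")
      case False
      then obtain x where x: "h x = int n" using low by (metis le_less zless_imp_add1_zle add.commute)
      have hx: "\<bar>x\<bar> \<le> h x" "even (h x + x)" using is_profileD(3,4)[OF h] by auto
      \<comment> \<open>Here both costs are paid exactly and nothing remains for the middle loop.
        The window shrinks to u = w = g - 1 - x, so the middle loop has to be special there.\<close>
      define e1 where "e1 = nat ((h x + x) div 2)"
      have e1: "2 * int e1 = h x + x" using hx by (auto simp: e1_def)
      have "e1 + 0 + (n - e1) = n" using e1 hx x by linarith
      moreover have "h x - x < 2 * int (n - e1) + 2" using e1 hx x by linarith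
      ultimately obtain u w where uw: "u < int g - x" "int g - 2 - x < w" "loop_step (S g) 0 u w"
        using key[of e1 0 "n - e1" x x] e1 by auto
      then have "u = int g - 1 - x" "S g u" by (auto simp: loop_step_def)
      moreover have "even ((int g - 1 - x) - (int g - 1 - int n))" using hx x by simp
      ultimately have "S g (int g - 1 - int n)" using mid by blast
      then show ?thesis using low by blast
    qed simp
  qed
qed

section \<open>Slopes of piecewise linear functions\<close>

lemma right_slope_eqI:
  assumes "\<forall>\<^sub>F u in at_right t. h u = h t + of_int n * (u - t)"
  shows "right_slope h t = n"
  unfolding right_slope_def
proof (rule the_equality)
  fix m assume "\<forall>\<^sub>F u in at_right t. h u = h t + of_int m * (u - t)"
  then have "\<forall>\<^sub>F u in at_right t. m = n"
    using assms eventually_at_right_less[of t] by eventually_elim auto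
  then show "m = n" by simp
qed (fact assms)

lemma left_slope_eqI:
  assumes "\<forall>\<^sub>F u in at_left t. h u = h t + of_int n * (t - u)"
  shows "left_slope h t = n"
  unfolding left_slope_def
proof (rule the_equality)
  fix m assume "\<forall>\<^sub>F u in at_left t. h u = h t + of_int m * (t - u)"
  moreover have "\<forall>\<^sub>F u in at_left t. u < t" by (simp add: eventually_at_filter)
  ultimately have "\<forall>\<^sub>F u in at_left t. m = n"
    using assms by eventually_elim auto
  then show "m = n" by simp
qed (fact assms)

lemma slopes_linear:
  fixes h :: "real \<Rightarrow> real" and n :: int
  assumes lin: "\<forall>t\<in>{a..b}. h t = h a + of_int n * (t - a)"
  shows "a \<le> t \<Longrightarrow> t < b \<Longrightarrow> right_slope h t = n"
    and "a < t \<Longrightarrow> t \<le> b \<Longrightarrow> left_slope h t = - n"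
proof -
  have diff: "h u = h v + of_int n * (u - v)" if "u \<in> {a..b}" "v \<in> {a..b}" for u v
    using bspec[OF lin that(1)] bspec[OF lin that(2)] by (simp only:) (simp add: algebra_simps)
  show "right_slope h t = n" if t: "a \<le> t" "t < b"
  proof (rule right_slope_eqI)
    have "\<forall>\<^sub>F u in at_right t. t < u \<and> u < b"
      using t by (auto simp: eventually_at_right)
    then show "\<forall>\<^sub>F u in at_right t. h u = h t + of_int n * (u - t)"
      by (rule eventually_mono) (use t in \<open>intro diff; simp\<close>)
  qed
  show "left_slope h t = - n" if t: "a < t" "t \<le> b"
  proof (rule left_slope_eqI)
    have "\<forall>\<^sub>F u in at_left t. a < u \<and> u < t"
      using t by (auto simp: eventually_at_left)
    then show "\<forall>\<^sub>F u in at_left t. h u = h t + of_int (- n) * (t - u)"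
    proof (rule eventually_mono)
      fix u assume "a < u \<and> u < t"
      then have "h u = h t + of_int n * (u - t)" using t by (intro diff) auto
      then show "h u = h t + of_int (- n) * (t - u)" by (simp add: algebra_simps)
    qed
  qed
qed

lemma finite_gap:
  fixes B :: "real set"
  assumes "finite B" "0 < d"
  shows "\<exists>\<delta>>0. \<delta> \<le> d \<and> {t<..<t + \<delta>} \<inter> B = {} \<and> {t - \<delta><..<t} \<inter> B = {}"
proof -
  obtain e where e: "0 < e" "\<forall>u\<in>B. u \<noteq> t \<longrightarrow> e \<le> dist t u"
    using finite_set_avoid[OF assms(1), of t] by blast
  have "{t<..<t + min e d} \<inter> B = {}" "{t - min e d<..<t} \<inter> B = {}"
    using e by (force simp: dist_real_def)+
  then show ?thesis using e assms by (intro exI[of _ "min e d"]) auto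
qed

text \<open>Integration by parts on one edge against an affine weight, by induction on the
  breakpoints: at a chosen breakpoint the left slope goes to one piece and the right slope to the
  other. The end slopes are listed separately since they contribute to the divisor at
  vertices.\<close>

lemma int_pl_sum_slopes:
  assumes "int_pl c h" "0 < c"
  obtains B where "finite B" "B \<subseteq> {0<..<c}"
    and "\<And>t. t \<in> {0<..<c} - B \<Longrightarrow> right_slope h t + left_slope h t = 0"
    and "\<And>\<alpha> \<beta>. (\<Sum>t\<in>B. of_int (right_slope h t + left_slope h t) * (\<alpha> + \<beta> * t)) +
        of_int (right_slope h 0) * \<alpha> + of_int (left_slope h c) * (\<alpha> + \<beta> * c) = - \<beta> * (h c - h 0)"
proof -
  obtain B where B: "finite B"
    and lin: "\<And>a b. 0 \<le> a \<Longrightarrow> a < b \<Longrightarrow> b \<le> c \<Longrightarrow> {a<..<b} \<inter> B = {} \<Longrightarrow>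
      \<exists>n::int. \<forall>t\<in>{a..b}. h t = h a + of_int n * (t - a)"
    using assms(1) by (auto simp: int_pl_def)
  have 1: "right_slope h t + left_slope h t = 0" if tc: "t \<in> {0<..<c}" "t \<notin> B" for t
  proof -
    obtain \<delta> where \<delta>: "0 < \<delta>" "\<delta> \<le> min t (c - t)" "{t<..<t + \<delta>} \<inter> B = {}" "{t - \<delta><..<t} \<inter> B = {}"
    proof -
      have "0 < min t (c - t)" using tc by auto
      from finite_gap[OF B this, of t] show ?thesis using that by blast
    qed
    have "{t - \<delta><..<t + \<delta>} \<inter> B = {}" using \<delta>(3,4) tc(2) by (force simp: not_less_iff_gr_or_eq)
    then obtain n :: int where n: "\<forall>u\<in>{t - \<delta>..t + \<delta>}. h u = h (t - \<delta>) + of_int n * (u - (t - \<delta>))"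
      using lin[of "t - \<delta>" "t + \<delta>"] \<delta> by auto
    show ?thesis using slopes_linear[OF n, of t] \<delta>(1) by simp
  qed
  have 2: "(\<Sum>t\<in>B \<inter> {a<..<b}. of_int (right_slope h t + left_slope h t) * (\<alpha> + \<beta> * t)) +
      of_int (right_slope h a) * (\<alpha> + \<beta> * a) + of_int (left_slope h b) * (\<alpha> + \<beta> * b) = - \<beta> * (h b - h a)"
    if "0 \<le> a" "a < b" "b \<le> c" for a b \<alpha> \<beta>
    using that
  proof (induction "card (B \<inter> {a<..<b})" arbitrary: a b rule: less_induct)
    case less
    show ?case
    proof (cases "B \<inter> {a<..<b} = {}")
      case True
      then obtain n :: int where n: "\<forall>t\<in>{a..b}. h t = h a + of_int n * (t - a)"
        using lin[of a b] less.prems by auto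
      have sl: "right_slope h a = n" "left_slope h b = - n" "h b = h a + of_int n * (b - a)"
        using slopes_linear(1)[OF n, of a] slopes_linear(2)[OF n, of b] bspec[OF n, of b] less.prems by simp_all
      show ?thesis unfolding True sl by (simp add: algebra_simps)
    next
      case False
      then obtain s where s: "s \<in> B" "a < s" "s < b" by auto
      let ?F = "\<lambda>t. of_int (right_slope h t + left_slope h t) * (\<alpha> + \<beta> * t)"
      have un: "B \<inter> {a<..<b} = (B \<inter> {a<..<s}) \<union> insert s (B \<inter> {s<..<b})" using s by auto
      have "card (B \<inter> {a<..<s}) < card (B \<inter> {a<..<b})" "card (B \<inter> {s<..<b}) < card (B \<inter> {a<..<b})"
        using B s by (auto intro!: psubset_card_mono)
      then have IH: "(\<Sum>t\<in>B \<inter> {a<..<s}. ?F t) + of_int (right_slope h a) * (\<alpha> + \<beta> * a) +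
          of_int (left_slope h s) * (\<alpha> + \<beta> * s) = - \<beta> * (h s - h a)"
        "(\<Sum>t\<in>B \<inter> {s<..<b}. ?F t) + of_int (right_slope h s) * (\<alpha> + \<beta> * s) +
          of_int (left_slope h b) * (\<alpha> + \<beta> * b) = - \<beta> * (h b - h s)"
        using less.hyps[of a s] less.hyps[of s b] less.prems s by auto
      have "(\<Sum>t\<in>B \<inter> {a<..<b}. ?F t) = (\<Sum>t\<in>B \<inter> {a<..<s}. ?F t) + (?F s + (\<Sum>t\<in>B \<inter> {s<..<b}. ?F t))"
        unfolding un using B by (subst sum.union_disjoint) auto
      then show ?thesis using IH by (simp add: algebra_simps)
    qed
  qed
  show thesis
  proof (rule that[of "B \<inter> {0<..<c}"])
    show "right_slope h t + left_slope h t = 0" if "t \<in> {0<..<c} - B \<inter> {0<..<c}" for t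
      using that 1 by auto
    show "(\<Sum>t\<in>B \<inter> {0<..<c}. of_int (right_slope h t + left_slope h t) * (\<alpha> + \<beta> * t)) +
        of_int (right_slope h 0) * \<alpha> + of_int (left_slope h c) * (\<alpha> + \<beta> * c) = - \<beta> * (h c - h 0)" for \<alpha> \<beta>
      using 2[of 0 c \<alpha> \<beta>] assms(2) by simp
  qed (use B in auto)
qed

text \<open>Integrates a prescribed divisor along an edge: \<open>c\<close> and
  \<open>\<sigma>\<close> are the initial value and slope, and \<open>\<kappa> q\<close> is the
  multiplicity of the interior point \<open>q\<close>, at which the slope jumps.\<close>

definition hinge_sum :: "real \<Rightarrow> int \<Rightarrow> real set \<Rightarrow> (real \<Rightarrow> int) \<Rightarrow> real \<Rightarrow> real"
  where "hinge_sum c \<sigma> T \<kappa> t = c + of_int \<sigma> * t + (\<Sum>q\<in>T. of_int (\<kappa> q) * max 0 (t - q))"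

lemma hinge_sum_linear:
  assumes "finite T" "{a<..<b} \<inter> T = {}" "t \<in> {a..b}"
  shows "hinge_sum c \<sigma> T \<kappa> t =
    hinge_sum c \<sigma> T \<kappa> a + of_int (\<sigma> + (\<Sum>q\<in>{q \<in> T. q \<le> a}. \<kappa> q)) * (t - a)"
proof -
  have "max 0 (t - q) = max 0 (a - q) + (if q \<le> a then t - a else 0)" if "q \<in> T" for q
  proof -
    have "q \<le> a \<or> b \<le> q" using assms(2) that by force
    then show ?thesis using assms(3) by auto
  qed
  then have "(\<Sum>q\<in>T. of_int (\<kappa> q) * max 0 (t - q)) =
      (\<Sum>q\<in>T. of_int (\<kappa> q) * max 0 (a - q) + (if q \<le> a then of_int (\<kappa> q) * (t - a) else 0))"
    by (intro sum.cong) (auto simp: algebra_simps)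
  also have "\<dots> = (\<Sum>q\<in>T. of_int (\<kappa> q) * max 0 (a - q)) + (\<Sum>q\<in>{q \<in> T. q \<le> a}. of_int (\<kappa> q) * (t - a))"
    using assms(1) by (simp add: sum.distrib sum.inter_filter)
  finally show ?thesis
    by (simp add: hinge_sum_def algebra_simps sum_distrib_left sum_distrib_right sum_subtractf)
qed

lemma int_pl_hinge_sum: "finite T \<Longrightarrow> int_pl l (hinge_sum c \<sigma> T \<kappa>)"
  unfolding int_pl_def using hinge_sum_linear by (intro exI[of _ T]) blast

lemma slopes_hinge_sum:
  assumes "finite T"
  shows "right_slope (hinge_sum c \<sigma> T \<kappa>) t = \<sigma> + (\<Sum>q\<in>{q \<in> T. q \<le> t}. \<kappa> q)"
    and "left_slope (hinge_sum c \<sigma> T \<kappa>) t = - (\<sigma> + (\<Sum>q\<in>{q \<in> T. q < t}. \<kappa> q))"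
proof -
  obtain \<delta> where \<delta>: "0 < \<delta>" "{t<..<t + \<delta>} \<inter> T = {}" "{t - \<delta><..<t} \<inter> T = {}"
    using finite_gap[OF assms, of 1 t] by (meson zero_less_one)
  show "right_slope (hinge_sum c \<sigma> T \<kappa>) t = \<sigma> + (\<Sum>q\<in>{q \<in> T. q \<le> t}. \<kappa> q)"
  proof (rule slopes_linear(1))
    show "\<forall>u\<in>{t..t + \<delta>}. hinge_sum c \<sigma> T \<kappa> u = hinge_sum c \<sigma> T \<kappa> t +
        of_int (\<sigma> + (\<Sum>q\<in>{q \<in> T. q \<le> t}. \<kappa> q)) * (u - t)"
      using hinge_sum_linear[OF assms \<delta>(2)] by blast
  qed (use \<delta> in auto)
  have eq: "{q \<in> T. q < t} = {q \<in> T. q \<le> t - \<delta>}" using \<delta> by force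
  show "left_slope (hinge_sum c \<sigma> T \<kappa>) t = - (\<sigma> + (\<Sum>q\<in>{q \<in> T. q < t}. \<kappa> q))"
  proof (rule slopes_linear(2))
    show "\<forall>u\<in>{t - \<delta>..t}. hinge_sum c \<sigma> T \<kappa> u = hinge_sum c \<sigma> T \<kappa> (t - \<delta>) +
        of_int (\<sigma> + (\<Sum>q\<in>{q \<in> T. q < t}. \<kappa> q)) * (u - (t - \<delta>))"
      using hinge_sum_linear[OF assms \<delta>(3)] unfolding eq by blast
  qed (use \<delta> in auto)
qed

lemma hinge_sum_bounds:
  assumes "T \<subseteq> {0<..<l}"
  shows "hinge_sum c \<sigma> T \<kappa> 0 = c"
    and "hinge_sum c \<sigma> T \<kappa> l = c + of_int \<sigma> * l + (\<Sum>q\<in>T. of_int (\<kappa> q) * (l - q))"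
proof -
  have "(\<Sum>q\<in>T. of_int (\<kappa> q) * max 0 (0 - q)) = (\<Sum>q\<in>T. 0)"
    by (rule sum.cong) (use assms in auto)
  then show "hinge_sum c \<sigma> T \<kappa> 0 = c" by (simp add: hinge_sum_def)
  have "(\<Sum>q\<in>T. of_int (\<kappa> q) * max 0 (l - q)) = (\<Sum>q\<in>T. of_int (\<kappa> q) * (l - q))"
    by (rule sum.cong) (use assms in auto)
  then show "hinge_sum c \<sigma> T \<kappa> l = c + of_int \<sigma> * l + (\<Sum>q\<in>T. of_int (\<kappa> q) * (l - q))"
    by (simp add: hinge_sum_def)
qed

section \<open>Weighted degrees\<close>

text \<open>Degree and loop coordinates are both of this form, so additivity, pushforward and the
  effect of a rational function are each treated only once.\<close>

definition weighted_deg :: "('v, 'e) divisor \<Rightarrow> (('v, 'e) point \<Rightarrow> real) \<Rightarrow> real"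
  where "weighted_deg D W = (\<Sum>p | D p \<noteq> 0. of_int (D p) * W p)"

lemma weighted_deg_superset:
  assumes "finite P" "{p. D p \<noteq> 0} \<subseteq> P"
  shows "weighted_deg D W = (\<Sum>p\<in>P. of_int (D p) * W p)"
  unfolding weighted_deg_def by (rule sum.mono_neutral_left) (use assms in auto)

lemma deg_eq_weighted_deg: "of_int (deg D) = weighted_deg D (\<lambda>_. 1)"
  by (simp add: deg_def weighted_deg_def)

lemma divisorsD: "D \<in> divisors \<Gamma> \<Longrightarrow> finite {p. D p \<noteq> 0}" "D \<in> divisors \<Gamma> \<Longrightarrow> {p. D p \<noteq> 0} \<subseteq> points \<Gamma>"
  by (auto simp: divisors_def)

lemma weighted_deg_add:
  assumes "finite {p. D p \<noteq> 0}" "finite {p. D' p \<noteq> 0}"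
  shows "weighted_deg (D + D') W = weighted_deg D W + weighted_deg D' W"
proof -
  let ?P = "{p. D p \<noteq> 0} \<union> {p. D' p \<noteq> 0}"
  have "weighted_deg (D + D') W = (\<Sum>p\<in>?P. of_int ((D + D') p) * W p)"
    by (rule weighted_deg_superset) (use assms in auto)
  moreover have "weighted_deg D W = (\<Sum>p\<in>?P. of_int (D p) * W p)"
    by (rule weighted_deg_superset) (use assms in auto)
  moreover have "weighted_deg D' W = (\<Sum>p\<in>?P. of_int (D' p) * W p)"
    by (rule weighted_deg_superset) (use assms in auto)
  ultimately show ?thesis by (simp add: sum.distrib[symmetric] algebra_simps)
qed

lemma weighted_deg_uminus: "weighted_deg (- D) W = - weighted_deg D W"
  by (simp add: weighted_deg_def sum_negf)

lemma divisors_add: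
  assumes "D \<in> divisors \<Gamma>" "D' \<in> divisors \<Gamma>"
  shows "D + D' \<in> divisors \<Gamma>"
proof -
  have sub: "{p. (D + D') p \<noteq> 0} \<subseteq> {p. D p \<noteq> 0} \<union> {p. D' p \<noteq> 0}" by auto
  have "finite {p. (D + D') p \<noteq> 0}"
    by (rule finite_subset[OF sub]) (use assms in \<open>simp add: divisors_def\<close>)
  moreover have "{p. (D + D') p \<noteq> 0} \<subseteq> points \<Gamma>"
    by (rule order_trans[OF sub]) (use assms in \<open>simp add: divisors_def\<close>)
  ultimately show ?thesis by (simp add: divisors_def)
qed

lemma divisors_uminus: "D \<in> divisors \<Gamma> \<Longrightarrow> - D \<in> divisors \<Gamma>"
  by (simp add: divisors_def)

lemma divisors_diff: "D \<in> divisors \<Gamma> \<Longrightarrow> D' \<in> divisors \<Gamma> \<Longrightarrow> D - D' \<in> divisors \<Gamma>"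
  using divisors_add[OF _ divisors_uminus, of D \<Gamma> D'] by simp

lemma weighted_deg_diff:
  assumes "finite {p. D p \<noteq> 0}" "finite {p. D' p \<noteq> 0}"
  shows "weighted_deg (D - D') W = weighted_deg D W - weighted_deg D' W"
  using weighted_deg_add[of D "- D'" W] assms weighted_deg_uminus[of D' W] by simp

lemma weighted_deg_graph:
  assumes fin: "finite (verts \<Gamma>)" "finite (edges \<Gamma>)" and D: "{p. D p \<noteq> 0} \<subseteq> points \<Gamma>"
    and T: "\<And>e. e \<in> edges \<Gamma> \<Longrightarrow> finite (T e)" "\<And>e. e \<in> edges \<Gamma> \<Longrightarrow> {t. D (Inner e t) \<noteq> 0} \<subseteq> T e"
  shows "finite {p. D p \<noteq> 0}"
    and "weighted_deg D W = (\<Sum>v\<in>verts \<Gamma>. of_int (D (Vertex v)) * W (Vertex v)) +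
      (\<Sum>e\<in>edges \<Gamma>. \<Sum>t\<in>T e. of_int (D (Inner e t)) * W (Inner e t))"
proof -
  let ?I = "(\<lambda>(e, t). Inner e t) ` (SIGMA e:edges \<Gamma>. T e)"
  have P: "finite (Vertex ` verts \<Gamma> \<union> ?I)" "{p. D p \<noteq> 0} \<subseteq> Vertex ` verts \<Gamma> \<union> ?I"
  proof -
    show "finite (Vertex ` verts \<Gamma> \<union> ?I)" using fin T(1) by auto
    show "{p. D p \<noteq> 0} \<subseteq> Vertex ` verts \<Gamma> \<union> ?I"
    proof
      fix p assume p: "p \<in> {p. D p \<noteq> 0}"
      then have P: "p \<in> points \<Gamma>" using D by blast
      show "p \<in> Vertex ` verts \<Gamma> \<union> ?I"
      proof (cases p)
        case (Vertex v)
        then show ?thesis using P by (auto simp: points_def)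
      next
        case (Inner e t)
        then have e: "e \<in> edges \<Gamma>" using P by (auto simp: points_def)
        then have "(e, t) \<in> (SIGMA e:edges \<Gamma>. T e)" using T(2)[OF e] p Inner by auto
        then show ?thesis using Inner by (force intro: image_eqI[where x = "(e, t)"])
      qed
    qed
  qed
  show "finite {p. D p \<noteq> 0}" by (rule finite_subset[OF P(2,1)])
  have "weighted_deg D W = (\<Sum>p\<in>Vertex ` verts \<Gamma> \<union> ?I. of_int (D p) * W p)"
    by (rule weighted_deg_superset[OF P])
  also have "\<dots> = (\<Sum>p\<in>Vertex ` verts \<Gamma>. of_int (D p) * W p) + (\<Sum>p\<in>?I. of_int (D p) * W p)"
    by (rule sum.union_disjoint) (use P(1) in auto)
  also have "(\<Sum>p\<in>Vertex ` verts \<Gamma>. of_int (D p) * W p) = (\<Sum>v\<in>verts \<Gamma>. of_int (D (Vertex v)) * W (Vertex v))"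
    by (subst sum.reindex) (auto simp: inj_on_def)
  also have "(\<Sum>p\<in>?I. of_int (D p) * W p) =
      (\<Sum>(e, t)\<in>(SIGMA e:edges \<Gamma>. T e). of_int (D (Inner e t)) * W (Inner e t))"
    by (subst sum.reindex) (auto simp: inj_on_def split_beta)
  also have "\<dots> = (\<Sum>e\<in>edges \<Gamma>. \<Sum>t\<in>T e. of_int (D (Inner e t)) * W (Inner e t))"
    by (rule sum.Sigma[symmetric]) (use fin T(1) in auto)
  finally show "weighted_deg D W = (\<Sum>v\<in>verts \<Gamma>. of_int (D (Vertex v)) * W (Vertex v)) +
      (\<Sum>e\<in>edges \<Gamma>. \<Sum>t\<in>T e. of_int (D (Inner e t)) * W (Inner e t))" .
qed

text \<open>The jump \<open>\<delta>\<close> allows for coordinates that are defined only modulo the length of a loop.\<close>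

lemma weighted_deg_div_of:
  fixes \<Gamma> :: "('v, 'e) mgraph"
  assumes fin: "finite (verts \<Gamma>)" "finite (edges \<Gamma>)"
    and ends: "tail \<Gamma> ` edges \<Gamma> \<subseteq> verts \<Gamma>" "head \<Gamma> ` edges \<Gamma> \<subseteq> verts \<Gamma>"
    and len: "\<And>e. e \<in> edges \<Gamma> \<Longrightarrow> 0 < len \<Gamma> e"
    and pl: "\<And>e. e \<in> edges \<Gamma> \<Longrightarrow> int_pl (len \<Gamma> e) (f e)"
  shows "div_of \<Gamma> f \<in> divisors \<Gamma>"
    and "(\<And>e. e \<in> edges \<Gamma> \<Longrightarrow> W (Vertex (tail \<Gamma> e)) = \<alpha> e) \<Longrightarrow>
      (\<And>e. e \<in> edges \<Gamma> \<Longrightarrow> W (Vertex (head \<Gamma> e)) = \<alpha> e + \<beta> e * len \<Gamma> e + \<delta> e) \<Longrightarrow>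
      (\<And>e t. e \<in> edges \<Gamma> \<Longrightarrow> 0 < t \<Longrightarrow> t < len \<Gamma> e \<Longrightarrow> W (Inner e t) = \<alpha> e + \<beta> e * t) \<Longrightarrow>
      weighted_deg (div_of \<Gamma> f) W =
        (\<Sum>e\<in>edges \<Gamma>. of_int (left_slope (f e) (len \<Gamma> e)) * \<delta> e - \<beta> e * (f e (len \<Gamma> e) - f e 0))"
proof -
  define good where "good e B \<longleftrightarrow> finite B \<and> B \<subseteq> {0<..<len \<Gamma> e} \<and>
    (\<forall>t\<in>{0<..<len \<Gamma> e} - B. right_slope (f e) t + left_slope (f e) t = 0) \<and>
    (\<forall>\<alpha> \<beta>. (\<Sum>t\<in>B. of_int (right_slope (f e) t + left_slope (f e) t) * (\<alpha> + \<beta> * t)) +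
        of_int (right_slope (f e) 0) * \<alpha> + of_int (left_slope (f e) (len \<Gamma> e)) * (\<alpha> + \<beta> * len \<Gamma> e) =
        - \<beta> * (f e (len \<Gamma> e) - f e 0))" for e B
  have "\<exists>B. good e B" if "e \<in> edges \<Gamma>" for e
  proof (rule int_pl_sum_slopes[OF pl[OF that] len[OF that]])
    fix B assume B: "finite B" "B \<subseteq> {0<..<len \<Gamma> e}"
      "\<And>t. t \<in> {0<..<len \<Gamma> e} - B \<Longrightarrow> right_slope (f e) t + left_slope (f e) t = 0"
      "\<And>\<alpha> \<beta>. (\<Sum>t\<in>B. of_int (right_slope (f e) t + left_slope (f e) t) * (\<alpha> + \<beta> * t)) +
        of_int (right_slope (f e) 0) * \<alpha> + of_int (left_slope (f e) (len \<Gamma> e)) * (\<alpha> + \<beta> * len \<Gamma> e) =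
        - \<beta> * (f e (len \<Gamma> e) - f e 0)"
    have "good e B" unfolding good_def by (intro conjI ballI allI B)
    then show "\<exists>B. good e B" by blast
  qed
  then have "\<forall>e\<in>edges \<Gamma>. \<exists>B. good e B" by blast
  from bchoice[OF this] obtain T where T: "\<And>e. e \<in> edges \<Gamma> \<Longrightarrow> good e (T e)" by blast
  have supp: "{p. div_of \<Gamma> f p \<noteq> 0} \<subseteq> points \<Gamma>" by (auto simp: div_of_def)
  have inner: "div_of \<Gamma> f (Inner e t) = (if 0 < t \<and> t < len \<Gamma> e then right_slope (f e) t + left_slope (f e) t else 0)"
    if "e \<in> edges \<Gamma>" for e t
    using that by (auto simp: div_of_def points_def)
  have T1: "finite (T e)" and T2: "{t. div_of \<Gamma> f (Inner e t) \<noteq> 0} \<subseteq> T e" if "e \<in> edges \<Gamma>" for e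
    using T[OF that] inner[OF that] by (auto simp: good_def split: if_splits)
  show "div_of \<Gamma> f \<in> divisors \<Gamma>"
    using weighted_deg_graph(1)[OF fin supp T1 T2] supp by (simp add: divisors_def)
  assume W: "\<And>e. e \<in> edges \<Gamma> \<Longrightarrow> W (Vertex (tail \<Gamma> e)) = \<alpha> e"
    "\<And>e. e \<in> edges \<Gamma> \<Longrightarrow> W (Vertex (head \<Gamma> e)) = \<alpha> e + \<beta> e * len \<Gamma> e + \<delta> e"
    "\<And>e t. e \<in> edges \<Gamma> \<Longrightarrow> 0 < t \<Longrightarrow> t < len \<Gamma> e \<Longrightarrow> W (Inner e t) = \<alpha> e + \<beta> e * t"
  have regroup: "(\<Sum>v\<in>verts \<Gamma>. of_int (\<Sum>e | e \<in> edges \<Gamma> \<and> k e = v. s e) * W (Vertex v)) =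
      (\<Sum>e\<in>edges \<Gamma>. of_int (s e) * W (Vertex (k e)))" if "k ` edges \<Gamma> \<subseteq> verts \<Gamma>" for k :: "'e \<Rightarrow> 'v" and s :: "'e \<Rightarrow> int"
  proof -
    have "(\<Sum>v\<in>verts \<Gamma>. of_int (\<Sum>e | e \<in> edges \<Gamma> \<and> k e = v. s e) * W (Vertex v)) =
        (\<Sum>v\<in>verts \<Gamma>. \<Sum>e | e \<in> edges \<Gamma> \<and> k e = v. of_int (s e) * W (Vertex (k e)))"
      by (auto simp: sum_distrib_right intro!: sum.cong)
    also have "\<dots> = (\<Sum>e\<in>edges \<Gamma>. of_int (s e) * W (Vertex (k e)))"
      by (rule sum.group) (use fin that in auto)
    finally show ?thesis .
  qed
  have "(\<Sum>v\<in>verts \<Gamma>. of_int (div_of \<Gamma> f (Vertex v)) * W (Vertex v)) =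
      (\<Sum>v\<in>verts \<Gamma>. of_int (\<Sum>e | e \<in> edges \<Gamma> \<and> tail \<Gamma> e = v. right_slope (f e) 0) * W (Vertex v)) +
      (\<Sum>v\<in>verts \<Gamma>. of_int (\<Sum>e | e \<in> edges \<Gamma> \<and> head \<Gamma> e = v. left_slope (f e) (len \<Gamma> e)) * W (Vertex v))"
    by (auto simp: div_of_def points_def sum.distrib[symmetric] algebra_simps intro!: sum.cong)
  also have "\<dots> = (\<Sum>e\<in>edges \<Gamma>. of_int (right_slope (f e) 0) * \<alpha> e +
      of_int (left_slope (f e) (len \<Gamma> e)) * (\<alpha> e + \<beta> e * len \<Gamma> e + \<delta> e))"
    unfolding regroup[OF ends(1)] regroup[OF ends(2)] sum.distrib[symmetric]
    by (rule sum.cong) (use W in auto)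
  finally have V: "(\<Sum>v\<in>verts \<Gamma>. of_int (div_of \<Gamma> f (Vertex v)) * W (Vertex v)) =
      (\<Sum>e\<in>edges \<Gamma>. of_int (right_slope (f e) 0) * \<alpha> e +
        of_int (left_slope (f e) (len \<Gamma> e)) * (\<alpha> e + \<beta> e * len \<Gamma> e + \<delta> e))" .
  have E: "(\<Sum>t\<in>T e. of_int (div_of \<Gamma> f (Inner e t)) * W (Inner e t)) +
      (of_int (right_slope (f e) 0) * \<alpha> e + of_int (left_slope (f e) (len \<Gamma> e)) * (\<alpha> e + \<beta> e * len \<Gamma> e + \<delta> e)) =
      of_int (left_slope (f e) (len \<Gamma> e)) * \<delta> e - \<beta> e * (f e (len \<Gamma> e) - f e 0)" if e: "e \<in> edges \<Gamma>" for e
  proof -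
    have sub: "0 < t \<and> t < len \<Gamma> e" if "t \<in> T e" for t using T[OF e] that by (auto simp: good_def)
    have "(\<Sum>t\<in>T e. of_int (div_of \<Gamma> f (Inner e t)) * W (Inner e t)) =
        (\<Sum>t\<in>T e. of_int (right_slope (f e) t + left_slope (f e) t) * (\<alpha> e + \<beta> e * t))"
      by (rule sum.cong) (use sub inner[OF e] W(3)[OF e] in auto)
    moreover have "(\<Sum>t\<in>T e. of_int (right_slope (f e) t + left_slope (f e) t) * (\<alpha> e + \<beta> e * t)) +
        of_int (right_slope (f e) 0) * \<alpha> e + of_int (left_slope (f e) (len \<Gamma> e)) * (\<alpha> e + \<beta> e * len \<Gamma> e) =
        - \<beta> e * (f e (len \<Gamma> e) - f e 0)"
      using T[OF e] unfolding good_def by blast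
    ultimately show ?thesis by (simp add: algebra_simps)
  qed
  have "weighted_deg (div_of \<Gamma> f) W = (\<Sum>v\<in>verts \<Gamma>. of_int (div_of \<Gamma> f (Vertex v)) * W (Vertex v)) +
      (\<Sum>e\<in>edges \<Gamma>. \<Sum>t\<in>T e. of_int (div_of \<Gamma> f (Inner e t)) * W (Inner e t))"
    by (rule weighted_deg_graph(2)[OF fin supp T1 T2])
  also have "\<dots> = (\<Sum>e\<in>edges \<Gamma>. (\<Sum>t\<in>T e. of_int (div_of \<Gamma> f (Inner e t)) * W (Inner e t)) +
      (of_int (right_slope (f e) 0) * \<alpha> e + of_int (left_slope (f e) (len \<Gamma> e)) * (\<alpha> e + \<beta> e * len \<Gamma> e + \<delta> e)))"
    unfolding V by (simp only: sum.distrib add.commute)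
  also have "\<dots> = (\<Sum>e\<in>edges \<Gamma>. of_int (left_slope (f e) (len \<Gamma> e)) * \<delta> e - \<beta> e * (f e (len \<Gamma> e) - f e 0))"
    by (rule sum.cong[OF refl E])
  finally show "weighted_deg (div_of \<Gamma> f) W =
      (\<Sum>e\<in>edges \<Gamma>. of_int (left_slope (f e) (len \<Gamma> e)) * \<delta> e - \<beta> e * (f e (len \<Gamma> e) - f e 0))" .
qed

lemma deg_add:
  assumes "finite {p. D p \<noteq> 0}" "finite {p. D' p \<noteq> 0}"
  shows "deg (D + D') = deg D + deg D'"
proof -
  have "of_int (deg (D + D')) = (of_int (deg D + deg D') :: real)"
    by (simp add: deg_eq_weighted_deg weighted_deg_add[OF assms])
  then show ?thesis by (simp only: of_int_eq_iff)
qed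

lemma deg_diff:
  assumes "finite {p. D p \<noteq> 0}" "finite {p. D' p \<noteq> 0}"
  shows "deg (D - D') = deg D - deg D'"
proof -
  have "of_int (deg (D - D')) = (of_int (deg D - deg D') :: real)"
    by (simp add: deg_eq_weighted_deg weighted_deg_diff[OF assms])
  then show ?thesis by (simp only: of_int_eq_iff)
qed

section \<open>The Abel--Jacobi theorem for chains of loops\<close>

definition eq_mod :: "real \<Rightarrow> real \<Rightarrow> real \<Rightarrow> bool"
  where "eq_mod L s t \<longleftrightarrow> (\<exists>z::int. s = t + of_int z * L)"

lemma eq_mod_refl [simp]: "eq_mod L s s"
  by (auto simp: eq_mod_def intro: exI[of _ 0])

lemma eq_mod_sym: "eq_mod L s t \<Longrightarrow> eq_mod L t s"
proof -
  assume "eq_mod L s t"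
  then obtain z :: int where "s = t + of_int z * L" by (auto simp: eq_mod_def)
  then have "t = s + of_int (- z) * L" by simp
  then show ?thesis unfolding eq_mod_def by blast
qed

lemma eq_mod_trans: "eq_mod L s t \<Longrightarrow> eq_mod L t u \<Longrightarrow> eq_mod L s u"
proof -
  assume "eq_mod L s t" "eq_mod L t u"
  then obtain z z' :: int where "s = t + of_int z * L" "t = u + of_int z' * L" by (auto simp: eq_mod_def)
  then have "s = u + of_int (z + z') * L" by (simp add: algebra_simps)
  then show ?thesis unfolding eq_mod_def by blast
qed

lemma eq_mod_add: "eq_mod L s t \<Longrightarrow> eq_mod L s' t' \<Longrightarrow> eq_mod L (s + s') (t + t')"
proof -
  assume "eq_mod L s t" "eq_mod L s' t'"
  then obtain z z' :: int where "s = t + of_int z * L" "s' = t' + of_int z' * L" by (auto simp: eq_mod_def)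
  then have "s + s' = t + t' + of_int (z + z') * L" by (simp add: algebra_simps)
  then show ?thesis unfolding eq_mod_def by blast
qed

lemma eq_mod_minus: "eq_mod L s t \<Longrightarrow> eq_mod L (- s) (- t)"
proof -
  assume "eq_mod L s t"
  then obtain z :: int where "s = t + of_int z * L" by (auto simp: eq_mod_def)
  then have "- s = - t + of_int (- z) * L" by simp
  then show ?thesis unfolding eq_mod_def by blast
qed

lemma eq_mod_diff: "eq_mod L s t \<Longrightarrow> eq_mod L s' t' \<Longrightarrow> eq_mod L (s - s') (t - t')"
  using eq_mod_add[OF _ eq_mod_minus, of L s t s' t'] by simp

lemma eq_mod_cong: "eq_mod L s s' \<Longrightarrow> eq_mod L t t' \<Longrightarrow> eq_mod L s t \<longleftrightarrow> eq_mod L s' t'"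
  by (meson eq_mod_sym eq_mod_trans)

section \<open>Retraction coordinates on the loops\<close>

fun loop_index :: "(chain_vertex, chain_edge) point \<Rightarrow> nat" where
  "loop_index (Vertex (LeftV a)) = a"
| "loop_index (Vertex (RightV a)) = a"
| "loop_index (Inner (Upper a) t) = a"
| "loop_index (Inner (Lower a) t) = a"
| "loop_index (Inner (Bridge a) t) = a"

fun loop_pos :: "(nat \<Rightarrow> real) \<Rightarrow> (chain_vertex, chain_edge) point \<Rightarrow> real" where
  "loop_pos x (Vertex (LeftV a)) = 0"
| "loop_pos x (Vertex (RightV a)) = x a"
| "loop_pos x (Inner (Upper a) t) = t"
| "loop_pos x (Inner (Lower a) t) = - t"
| "loop_pos x (Inner (Bridge a) t) = x a"

text \<open>
  The position on loop \<open>a\<close>, modulo its length, of the retraction of a point to loop \<open>a\<close>.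
\<close>

definition loop_coord :: "(nat \<Rightarrow> real) \<Rightarrow> nat \<Rightarrow> (chain_vertex, chain_edge) point \<Rightarrow> real"
  where "loop_coord x a p =
    (if loop_index p < a then 0 else if a < loop_index p then x a else loop_pos x p)"

abbreviation coord :: "(nat \<Rightarrow> real) \<Rightarrow> nat \<Rightarrow> (chain_vertex, chain_edge) divisor \<Rightarrow> real"
  where "coord x a D \<equiv> weighted_deg D (loop_coord x a)"

definition jump_fun :: "('v, 'e) mgraph \<Rightarrow> ('e \<Rightarrow> real) \<Rightarrow> ('e \<Rightarrow> real \<Rightarrow> real) \<Rightarrow> bool"
  where "jump_fun \<Gamma> \<omega> f \<longleftrightarrow> (\<exists>h. \<forall>e\<in>edges \<Gamma>. int_pl (len \<Gamma> e) (f e) \<and>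
      f e 0 = h (tail \<Gamma> e) \<and> f e (len \<Gamma> e) = h (head \<Gamma> e) + len \<Gamma> e * \<omega> e)"

lemma pic_cover_alt: "pic_cover \<Gamma> D \<omega> = {D + div_of \<Gamma> f | f. jump_fun \<Gamma> \<omega> f}"
  by (simp add: pic_cover_def jump_fun_def)

lemma lin_equiv_iff_pic_cover: "lin_equiv \<Gamma> D D' \<longleftrightarrow> D' \<in> pic_cover \<Gamma> D (\<lambda>_. 0)"
  by (auto simp: pic_cover_alt lin_equiv_def rational_fun_def jump_fun_def)

text \<open>The cycle that runs around loop \<open>a\<close> with multiplicity \<open>c a\<close>,
  forward on the upper and backward on the lower arc.\<close>

definition cycle_chain :: "nat \<Rightarrow> (nat \<Rightarrow> real) \<Rightarrow> chain_edge \<Rightarrow> real"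
  where "cycle_chain n c e = (case e of Upper a \<Rightarrow> if a \<in> {1..n} then c a else 0
    | Lower a \<Rightarrow> if a \<in> {1..n} then - c a else 0 | Bridge a \<Rightarrow> 0)"

lemma points_simps:
  "Inner e t \<in> points \<Gamma> \<longleftrightarrow> e \<in> edges \<Gamma> \<and> 0 < t \<and> t < len \<Gamma> e"
  "Vertex v \<in> points \<Gamma> \<longleftrightarrow> v \<in> verts \<Gamma>"
  by (auto simp: points_def)

locale loop_chain =
  fixes n :: nat and x y b :: "nat \<Rightarrow> real"
  assumes n_pos: "1 \<le> n"
    and x_pos: "\<And>a. a \<in> {1..n} \<Longrightarrow> 0 < x a"
    and y_pos: "\<And>a. a \<in> {1..n} \<Longrightarrow> 0 < y a"
    and b_pos: "\<And>a. a \<in> {1..<n} \<Longrightarrow> 0 < b a"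
begin

abbreviation "G \<equiv> chain_of_loops n x y b"

lemma chain_simps [simp]:
  "verts G = LeftV ` {1..n} \<union> RightV ` {1..n}"
  "edges G = Upper ` {1..n} \<union> Lower ` {1..n} \<union> Bridge ` {1..<n}"
  "tail G (Upper a) = LeftV a" "tail G (Lower a) = LeftV a" "tail G (Bridge a) = RightV a"
  "head G (Upper a) = RightV a" "head G (Lower a) = RightV a" "head G (Bridge a) = LeftV (a + 1)"
  "len G (Upper a) = x a" "len G (Lower a) = y a" "len G (Bridge a) = b a"
  by (simp_all add: chain_of_loops_def)

lemma sum_edges:
  "(\<Sum>e\<in>edges G. F e) = (\<Sum>a=1..n. F (Upper a)) + (\<Sum>a=1..n. F (Lower a)) + (\<Sum>a=1..<n. F (Bridge a))"
  for F :: "chain_edge \<Rightarrow> 'a :: comm_monoid_add"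
proof -
  have "inj_on Upper A" "inj_on Lower A" "inj_on Bridge A" for A by (auto simp: inj_on_def)
  then show ?thesis
    unfolding chain_simps
    by (subst sum.union_disjoint, simp, simp, force)+ (simp add: sum.reindex)
qed

lemma sum_verts: "(\<Sum>v\<in>verts G. F v) = (\<Sum>a=1..n. F (LeftV a)) + (\<Sum>a=1..n. F (RightV a))"
  for F :: "chain_vertex \<Rightarrow> 'a :: comm_monoid_add"
proof -
  have "inj_on LeftV A" "inj_on RightV A" for A by (auto simp: inj_on_def)
  then show ?thesis
    unfolding chain_simps by (subst sum.union_disjoint) (auto simp: sum.reindex)
qed

lemma edges_at:
  assumes "a \<in> {1..n}"
  shows "{e. e \<in> edges G \<and> tail G e = LeftV a} = {Upper a, Lower a}"
    and "{e. e \<in> edges G \<and> head G e = LeftV a} = (if 1 < a then {Bridge (a - 1)} else {})"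
    and "{e. e \<in> edges G \<and> tail G e = RightV a} = (if a < n then {Bridge a} else {})"
    and "{e. e \<in> edges G \<and> head G e = RightV a} = {Upper a, Lower a}"
  using assms by (auto simp: image_iff)

lemma finite_graph: "finite (verts G)" "finite (edges G)"
  by simp_all

lemma graph_ends: "tail G ` edges G \<subseteq> verts G" "head G ` edges G \<subseteq> verts G"
  by auto

lemma len_pos: "e \<in> edges G \<Longrightarrow> 0 < len G e"
  using x_pos y_pos b_pos by auto

lemma cycle_chain_in_homology1: "cycle_chain n c \<in> homology1 G"
  unfolding homology1_def
proof (intro CollectI conjI allI impI ballI)
  fix e assume "e \<notin> edges G"
  then show "cycle_chain n c e = 0" by (cases e) (auto simp: cycle_chain_def)
next
  fix v assume "v \<in> verts G"
  then consider a where "a \<in> {1..n}" "v = LeftV a" | a where "a \<in> {1..n}" "v = RightV a" by auto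
  then show "(\<Sum>e | e \<in> edges G \<and> tail G e = v. cycle_chain n c e) = (\<Sum>e | e \<in> edges G \<and> head G e = v. cycle_chain n c e)"
  proof cases
    case 1
    then show ?thesis unfolding 1(2) edges_at(1,2)[OF 1(1)] by (simp add: cycle_chain_def)
  next
    case 2
    then show ?thesis unfolding 2(2) edges_at(3,4)[OF 2(1)] by (simp add: cycle_chain_def)
  qed
qed

text \<open>The coordinate of loop \<open>a\<close> has derivative 1 on its upper arc, -1 on its
  lower arc and 0 elsewhere, so integration by parts leaves the jump of \<open>f\<close> around the
  loop. The term \<open>\<delta>\<close> corrects the right vertex, whose coordinate is x a and not
  - y a; as slopes are integers, it contributes a multiple of the length of the loop.\<close>

lemma div_of_jump_fun:
  assumes "jump_fun G (cycle_chain n c) f"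
  shows "div_of G f \<in> divisors G" and "deg (div_of G f) = 0"
    and "a \<in> {1..n} \<Longrightarrow> eq_mod (x a + y a) (coord x a (div_of G f)) (- ((x a + y a) * c a))"
proof -
  obtain h where pl: "\<And>e. e \<in> edges G \<Longrightarrow> int_pl (len G e) (f e)"
    and f: "\<And>e. e \<in> edges G \<Longrightarrow> f e (len G e) - f e 0 = h (head G e) - h (tail G e) + len G e * cycle_chain n c e"
    using assms by (fastforce simp: jump_fun_def)
  note main = weighted_deg_div_of[OF finite_graph graph_ends len_pos pl]
  show "div_of G f \<in> divisors G" by (rule main(1))
  have "weighted_deg (div_of G f) (\<lambda>_. 1) =
      (\<Sum>e\<in>edges G. of_int (left_slope (f e) (len G e)) * 0 - 0 * (f e (len G e) - f e 0))"
    by (rule main(2)[where \<alpha> = "\<lambda>_. 1"]) simp_all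
  then show "deg (div_of G f) = 0" unfolding deg_eq_weighted_deg[symmetric] by simp
  assume a: "a \<in> {1..n}"
  define \<beta> \<delta> :: "chain_edge \<Rightarrow> real" where
    "\<beta> e = (if e = Upper a then 1 else if e = Lower a then - 1 else 0)" and
    "\<delta> e = (if e = Lower a then x a + y a else 0)" for e
  have "coord x a (div_of G f) =
      (\<Sum>e\<in>edges G. of_int (left_slope (f e) (len G e)) * \<delta> e - \<beta> e * (f e (len G e) - f e 0))"
  proof (rule main(2)[where \<alpha> = "\<lambda>e. loop_coord x a (Vertex (tail G e))"])
    fix e assume "e \<in> edges G"
    then show "loop_coord x a (Vertex (head G e)) = loop_coord x a (Vertex (tail G e)) + \<beta> e * len G e + \<delta> e"
      by (auto simp: loop_coord_def \<beta>_def \<delta>_def)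
  next
    fix e t assume "e \<in> edges G"
    then show "loop_coord x a (Inner e t) = loop_coord x a (Vertex (tail G e)) + \<beta> e * t"
      by (auto simp: loop_coord_def \<beta>_def)
  qed simp_all
  also have "\<dots> = of_int (left_slope (f (Lower a)) (y a)) * (x a + y a)
      - ((f (Upper a) (x a) - f (Upper a) 0) - (f (Lower a) (y a) - f (Lower a) 0))"
  proof -
    have "(\<Sum>e\<in>edges G. of_int (left_slope (f e) (len G e)) * \<delta> e - \<beta> e * (f e (len G e) - f e 0)) =
       (\<Sum>e\<in>{Upper a, Lower a}. of_int (left_slope (f e) (len G e)) * \<delta> e - \<beta> e * (f e (len G e) - f e 0))"
      by (rule sum.mono_neutral_right) (use a in \<open>auto simp: \<beta>_def \<delta>_def\<close>)
    then show ?thesis by (simp add: \<beta>_def \<delta>_def)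
  qed
  also have "\<dots> = - ((x a + y a) * c a) + of_int (left_slope (f (Lower a)) (y a)) * (x a + y a)"
    using f[of "Upper a"] f[of "Lower a"] a by (simp add: cycle_chain_def algebra_simps)
  finally show "eq_mod (x a + y a) (coord x a (div_of G f)) (- ((x a + y a) * c a))"
    unfolding eq_mod_def by blast
qed

text \<open>On a chain the function can be written down. Its slope at the start of a bridge must be
  the degree to the left of it, and on each loop one integer remains to be chosen, the initial slope
  of the upper arc. That both arcs lead to the same value at the right vertex, up to the prescribed
  jump, is a linear equation for this integer; it is solvable by the assumption on the
  coordinate.\<close>

lemma divisor_is_div_of:
  assumes D: "D \<in> divisors G" and deg0: "deg D = 0"
    and co: "\<And>a. a \<in> {1..n} \<Longrightarrow> eq_mod (x a + y a) (coord x a D) (- ((x a + y a) * c a))"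
  shows "\<exists>f. jump_fun G (cycle_chain n c) f \<and> D = div_of G f"
proof -
  define T where "T e = {t. D (Inner e t) \<noteq> 0}" for e
  have finD: "finite {p. D p \<noteq> 0}" and subD: "{p. D p \<noteq> 0} \<subseteq> points G" using divisorsD[OF D] by auto
  have finT: "finite (T e)" for e
  proof -
    have "Inner e ` T e \<subseteq> {p. D p \<noteq> 0}" by (auto simp: T_def)
    then have "finite (Inner e ` T e :: (chain_vertex, chain_edge) point set)"
      by (rule finite_subset) (rule finD)
    then show ?thesis by (rule finite_imageD) (auto simp: inj_on_def)
  qed
  have T_points: "e \<in> edges G \<and> 0 < t \<and> t < len G e" if "t \<in> T e" for e t
  proof -
    have "Inner e t \<in> points G" using subD that by (auto simp: T_def simp del: chain_simps)
    then show ?thesis by (simp only: points_simps)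
  qed
  have T_sub: "T e \<subseteq> {0<..<len G e}" for e using T_points by (auto simp del: chain_simps)
  have T_empty: "T e = {}" if "e \<notin> edges G" for e using T_points that by blast
  define tot mom where "tot e = (\<Sum>t\<in>T e. D (Inner e t))" and
    "mom e = (\<Sum>t\<in>T e. of_int (D (Inner e t)) * t)" for e
  define dL dR where "dL a = D (Vertex (LeftV a))" and "dR a = D (Vertex (RightV a))" for a
  define m where "m a = dL a + dR a + tot (Upper a) + tot (Lower a) + tot (Bridge a)" for a
  \<comment> \<open>Interior points of a bridge are counted with the loop before it, so this is the
    degree strictly to the left of the left vertex of loop \<open>a\<close>.\<close>
  define A where "A a = (\<Sum>c=1..<a. m c)" for a
  have T_n: "T (Bridge n) = {}" by (rule T_empty) auto
  then have tot_n: "tot (Bridge n) = 0" by (simp add: tot_def)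
  have A_Suc: "A (Suc a) = A a + m a" if "1 \<le> a" for a using that by (simp add: A_def)
  have W: "weighted_deg D W = (\<Sum>a=1..n. of_int (dL a) * W (Vertex (LeftV a)) + of_int (dR a) * W (Vertex (RightV a)) +
      (\<Sum>t\<in>T (Upper a). of_int (D (Inner (Upper a) t)) * W (Inner (Upper a) t)) +
      (\<Sum>t\<in>T (Lower a). of_int (D (Inner (Lower a) t)) * W (Inner (Lower a) t)) +
      (\<Sum>t\<in>T (Bridge a). of_int (D (Inner (Bridge a) t)) * W (Inner (Bridge a) t)))" for W
  proof -
    have "(\<Sum>a=1..<n. \<Sum>t\<in>T (Bridge a). of_int (D (Inner (Bridge a) t)) * W (Inner (Bridge a) t)) =
        (\<Sum>a=1..n. \<Sum>t\<in>T (Bridge a). of_int (D (Inner (Bridge a) t)) * W (Inner (Bridge a) t))"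
      by (rule sum.mono_neutral_left) (use T_n in \<open>auto simp: not_less\<close>)
    moreover have "weighted_deg D W = (\<Sum>v\<in>verts G. of_int (D (Vertex v)) * W (Vertex v)) +
      (\<Sum>e\<in>edges G. \<Sum>t\<in>T e. of_int (D (Inner e t)) * W (Inner e t))"
      by (rule weighted_deg_graph(2)[OF finite_graph subD]) (use finT in \<open>auto simp: T_def\<close>)
    ultimately show ?thesis
      unfolding sum_verts sum_edges by (simp add: sum.distrib dL_def dR_def)
  qed
  have A_end: "A (Suc n) = 0"
  proof -
    have "of_int (deg D) = (of_int (A (Suc n)) :: real)"
      unfolding deg_eq_weighted_deg W by (simp add: A_def m_def tot_def atLeastLessThanSuc_atLeastAtMost)
    then show ?thesis using deg0 by simp
  qed
  have coord_D: "coord x a D = mom (Upper a) - mom (Lower a) + x a * of_int (dR a + tot (Bridge a) - A (Suc a))"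
    if a: "a \<in> {1..n}" for a
  proof -
    let ?F = "\<lambda>d. of_int (dL d) * loop_coord x a (Vertex (LeftV d)) + of_int (dR d) * loop_coord x a (Vertex (RightV d)) +
      (\<Sum>t\<in>T (Upper d). of_int (D (Inner (Upper d) t)) * loop_coord x a (Inner (Upper d) t)) +
      (\<Sum>t\<in>T (Lower d). of_int (D (Inner (Lower d) t)) * loop_coord x a (Inner (Lower d) t)) +
      (\<Sum>t\<in>T (Bridge d). of_int (D (Inner (Bridge d) t)) * loop_coord x a (Inner (Bridge d) t))"
    have 1: "?F d = 0" if "d < a" for d using that by (simp add: loop_coord_def)
    have 2: "?F d = x a * of_int (m d)" if "a < d" for d
      using that by (simp add: loop_coord_def m_def tot_def algebra_simps sum_distrib_left)
    have 3: "?F a = mom (Upper a) - mom (Lower a) + x a * of_int (dR a + tot (Bridge a))"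
      by (simp add: loop_coord_def mom_def tot_def algebra_simps sum_distrib_left sum_negf)
    have split: "(\<Sum>d=1..n. F d) = (\<Sum>d=1..<a. F d) + (F a + (\<Sum>d=Suc a..n. F d))" for F :: "nat \<Rightarrow> real"
    proof -
      have "{1..n} = {1..<a} \<union> insert a {Suc a..n}" using a by auto
      then show ?thesis by (simp only:) (subst sum.union_disjoint, simp, simp, force, simp)
    qed
    have "coord x a D = (\<Sum>d=1..<a. ?F d) + (?F a + (\<Sum>d=Suc a..n. ?F d))"
      unfolding W by (rule split)
    also have "(\<Sum>d=1..<a. ?F d) = 0" by (rule sum.neutral) (use 1 in auto)
    also have "(\<Sum>d=Suc a..n. ?F d) = (\<Sum>d=Suc a..n. x a * of_int (m d))" by (rule sum.cong) (use 2 in auto)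
    also have "\<dots> = x a * of_int (A (Suc n) - A (Suc a))"
    proof -
      have "{1..<Suc n} = {1..<Suc a} \<union> {Suc a..n}" using a by auto
      then have "A (Suc n) = A (Suc a) + (\<Sum>d=Suc a..n. m d)"
        unfolding A_def by (simp only:) (subst sum.union_disjoint, simp, simp, force, simp)
      then show ?thesis by (simp add: sum_distrib_left)
    qed
    finally show ?thesis using 3 A_end by (simp add: algebra_simps)
  qed
  \<comment> \<open>The initial slopes of the two arcs add up to A a + dL a. With \<open>z\<close>
    on the upper arc, the equation says that the increments along both arcs agree up to the
    jump.\<close>
  have "\<exists>z. of_int z * (x a + y a) = of_int (A a + dL a + tot (Lower a)) * y a - mom (Lower a)
      - of_int (tot (Upper a)) * x a + mom (Upper a) + (x a + y a) * c a" if a: "a \<in> {1..n}" for a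
  proof -
    obtain z :: int where z: "coord x a D = - ((x a + y a) * c a) + of_int z * (x a + y a)"
      using co[OF a] by (auto simp: eq_mod_def)
    have "A (Suc a) = A a + m a" using A_Suc a by simp
    then have "of_int (z + (A a + dL a + tot (Lower a))) * (x a + y a) = of_int (A a + dL a + tot (Lower a)) * y a - mom (Lower a)
      - of_int (tot (Upper a)) * x a + mom (Upper a) + (x a + y a) * c a"
      using z coord_D[OF a] by (simp add: m_def algebra_simps)
    then show ?thesis by blast
  qed
  then obtain z :: "nat \<Rightarrow> int" where z: "\<And>a. a \<in> {1..n} \<Longrightarrow>
      of_int (z a) * (x a + y a) = of_int (A a + dL a + tot (Lower a)) * y a - mom (Lower a)
      - of_int (tot (Upper a)) * x a + mom (Upper a) + (x a + y a) * c a"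
    by metis
  define incU incB where
    "incU a = of_int (z a) * x a + (of_int (tot (Upper a)) * x a - mom (Upper a)) - x a * c a" and
    "incB a = of_int (A (Suc a) - tot (Bridge a)) * b a + (of_int (tot (Bridge a)) * b a - mom (Bridge a))" for a
  define H where "H a = (\<Sum>d=1..<a. incU d + incB d)" for a
  define h where "h v = (case v of LeftV a \<Rightarrow> H a | RightV a \<Rightarrow> H a + incU a)" for v
  define \<sigma> where "\<sigma> e = (case e of Upper a \<Rightarrow> z a | Lower a \<Rightarrow> A a + dL a - z a | Bridge a \<Rightarrow> A (Suc a) - tot (Bridge a))" for e
  define f where "f e = hinge_sum (h (tail G e)) (\<sigma> e) (T e) (\<lambda>t. D (Inner e t))" for e
  have f0: "f e 0 = h (tail G e)" for e by (simp add: f_def hinge_sum_bounds(1)[OF T_sub])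
  have f1: "f e (len G e) = h (tail G e) + of_int (\<sigma> e) * len G e + (of_int (tot e) * len G e - mom e)" for e
    by (simp add: f_def hinge_sum_bounds(2)[OF T_sub] tot_def mom_def algebra_simps sum_subtractf sum_distrib_left)
  have rs: "right_slope (f e) t = \<sigma> e + (\<Sum>q\<in>{q \<in> T e. q \<le> t}. D (Inner e q))"
    and ls: "left_slope (f e) t = - (\<sigma> e + (\<Sum>q\<in>{q \<in> T e. q < t}. D (Inner e q)))" for e t
    unfolding f_def by (rule slopes_hinge_sum[OF finT])+
  have rs0: "right_slope (f e) 0 = \<sigma> e" for e
  proof -
    have E: "{q \<in> T e. q \<le> 0} = {}" using T_sub[of e] by auto
    show ?thesis unfolding rs E by simp
  qed
  have ls1: "left_slope (f e) (len G e) = - (\<sigma> e + tot e)" for e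
  proof -
    have E: "{q \<in> T e. q < len G e} = T e" using T_sub[of e] by auto
    show ?thesis unfolding ls E by (simp add: tot_def)
  qed
  have "jump_fun G (cycle_chain n c) f"
    unfolding jump_fun_def
  proof (intro exI[of _ h] ballI conjI)
    fix e assume e: "e \<in> edges G"
    show "int_pl (len G e) (f e)" unfolding f_def by (rule int_pl_hinge_sum[OF finT])
    show "f e 0 = h (tail G e)" by (rule f0)
    from e consider a where "e = Upper a" "a \<in> {1..n}" | a where "e = Lower a" "a \<in> {1..n}"
      | a where "e = Bridge a" "a \<in> {1..<n}" by auto
    then show "f e (len G e) = h (head G e) + len G e * cycle_chain n c e"
    proof cases
      case 1
      then show ?thesis unfolding f1 by (simp add: h_def \<sigma>_def incU_def cycle_chain_def algebra_simps)
    next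
      case 2
      have "of_int (A a + dL a - z a) * y a + (of_int (tot (Lower a)) * y a - mom (Lower a)) = incU a - y a * c a"
        using z[OF 2(2)] by (simp add: incU_def algebra_simps)
      then show ?thesis using 2 unfolding f1 by (simp add: h_def \<sigma>_def cycle_chain_def)
    next
      case 3
      then have "H (Suc a) = H a + incU a + incB a" by (simp add: H_def)
      then show ?thesis using 3 unfolding f1 by (simp add: h_def \<sigma>_def incB_def cycle_chain_def)
    qed
  qed
  moreover have "D = div_of G f"
  proof
    fix p
    show "D p = div_of G f p"
    proof (cases "p \<in> points G")
      case False
      then show ?thesis using subD by (auto simp: div_of_def)
    next
      case True
      show ?thesis
      proof (cases p)
        case (Inner e t)
        have "{q \<in> T e. q \<le> t} = (if t \<in> T e then insert t {q \<in> T e. q < t} else {q \<in> T e. q < t})"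
          by (auto simp: less_le)
        then have "(\<Sum>q\<in>{q \<in> T e. q \<le> t}. D (Inner e q)) = (\<Sum>q\<in>{q \<in> T e. q < t}. D (Inner e q)) + D (Inner e t)"
          using finT[of e] by (auto simp: T_def)
        then show ?thesis using True Inner by (simp add: div_of_def rs ls)
      next
        case (Vertex v)
        then have "v \<in> verts G" using True by (auto simp: points_def)
        then consider a where "v = LeftV a" "a \<in> {1..n}" | a where "v = RightV a" "a \<in> {1..n}" by auto
        then show ?thesis
        proof cases
          case 1
          have "A a = (if 1 < a then \<sigma> (Bridge (a - 1)) + tot (Bridge (a - 1)) else 0)"
            using 1(2) by (auto simp: \<sigma>_def A_def)
          moreover have "div_of G f p = \<sigma> (Upper a) + \<sigma> (Lower a) +
              (if 1 < a then - (\<sigma> (Bridge (a - 1)) + tot (Bridge (a - 1))) else 0)"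
            using True by (simp add: div_of_def Vertex 1(1) edges_at(1,2)[OF 1(2)] rs0 ls1 del: chain_simps One_nat_def)
          moreover have "\<sigma> (Upper a) + \<sigma> (Lower a) = A a + dL a" by (simp add: \<sigma>_def)
          moreover have "D p = dL a" by (simp add: dL_def Vertex 1(1))
          ultimately show ?thesis by (simp split: if_splits)
        next
          case 2
          have "tot (Bridge a) - A (Suc a) = 0" if "\<not> a < n"
            using that 2(2) tot_n A_end by auto
          moreover have "A (Suc a) = A a + m a" using A_Suc 2 by simp
          moreover have "div_of G f p = (if a < n then \<sigma> (Bridge a) else 0) -
              (\<sigma> (Upper a) + tot (Upper a)) - (\<sigma> (Lower a) + tot (Lower a))"
            using True by (simp add: div_of_def Vertex 2(1) edges_at(3,4)[OF 2(2)] rs0 ls1 del: chain_simps)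
          moreover have "\<sigma> (Upper a) + \<sigma> (Lower a) = A a + dL a" "\<sigma> (Bridge a) = A (Suc a) - tot (Bridge a)"
            by (simp_all add: \<sigma>_def)
          moreover have "D p = dR a" by (simp add: dR_def Vertex 2(1))
          ultimately show ?thesis by (simp add: m_def split: if_splits)
        qed
      qed
    qed
  qed
  ultimately show ?thesis by blast
qed

text \<open>The Abel--Jacobi isomorphism in coordinates: \<open>c\<close> measures the displacement
  on each loop in units of its length, and c = 0 gives linear equivalence.\<close>

lemma pic_cover_chain:
  assumes D0: "D\<^sub>0 \<in> divisors G"
  shows "pic_cover G D\<^sub>0 (cycle_chain n c) = {D \<in> divisors G. deg D = deg D\<^sub>0 \<and>
    (\<forall>a\<in>{1..n}. eq_mod (x a + y a) (coord x a D) (coord x a D\<^sub>0 - (x a + y a) * c a))}"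
    (is "?L = ?R")
proof
  show "?L \<subseteq> ?R"
  proof
    fix D assume "D \<in> ?L"
    then obtain f where f: "D = D\<^sub>0 + div_of G f" "jump_fun G (cycle_chain n c) f" by (auto simp: pic_cover_alt)
    note E = div_of_jump_fun[OF f(2)]
    have fin: "finite {p. D\<^sub>0 p \<noteq> 0}" "finite {p. div_of G f p \<noteq> 0}"
      using divisorsD(1)[OF D0] divisorsD(1)[OF E(1)] by auto
    have "deg D = deg D\<^sub>0" using E(2) deg_add[OF fin] f(1) by simp
    moreover have "eq_mod (x a + y a) (coord x a D) (coord x a D\<^sub>0 - (x a + y a) * c a)" if "a \<in> {1..n}" for a
      using eq_mod_add[OF eq_mod_refl E(3)[OF that], of "coord x a D\<^sub>0"] by (simp add: f(1) weighted_deg_add[OF fin])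
    ultimately show "D \<in> ?R" using divisors_add[OF D0 E(1)] f(1) by simp
  qed
  show "?R \<subseteq> ?L"
  proof
    fix D assume D: "D \<in> ?R"
    have fin: "finite {p. D p \<noteq> 0}" "finite {p. D\<^sub>0 p \<noteq> 0}"
      using D divisorsD(1)[OF D0] divisorsD(1)[of D G] by auto
    have "\<exists>f. jump_fun G (cycle_chain n c) f \<and> D - D\<^sub>0 = div_of G f"
    proof (rule divisor_is_div_of)
      show "D - D\<^sub>0 \<in> divisors G" using D D0 divisors_diff by blast
      show "deg (D - D\<^sub>0) = 0" using D by (simp add: deg_diff[OF fin])
      fix a assume "a \<in> {1..n}"
      then have "eq_mod (x a + y a) (coord x a D) (coord x a D\<^sub>0 - (x a + y a) * c a)" using D by simp
      from eq_mod_diff[OF this eq_mod_refl, of "coord x a D\<^sub>0"]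
      show "eq_mod (x a + y a) (coord x a (D - D\<^sub>0)) (- ((x a + y a) * c a))"
        by (simp add: weighted_deg_diff[OF fin])
    qed
    then obtain f where "jump_fun G (cycle_chain n c) f" "D - D\<^sub>0 = div_of G f" by blast
    moreover from this have "D = D\<^sub>0 + div_of G f" by (simp add: algebra_simps)
    ultimately show "D \<in> ?L" by (auto simp: pic_cover_alt)
  qed
qed

lemma lin_equiv_chain:
  assumes "D \<in> divisors G"
  shows "lin_equiv G D D' \<longleftrightarrow> D' \<in> divisors G \<and> deg D' = deg D \<and>
    (\<forall>a\<in>{1..n}. eq_mod (x a + y a) (coord x a D') (coord x a D))"
proof -
  have "(\<lambda>_. 0) = cycle_chain n (\<lambda>_. 0)" by (auto simp: cycle_chain_def fun_eq_iff split: chain_edge.split)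
  then show ?thesis using pic_cover_chain[OF assms, of "\<lambda>_. 0"] by (simp add: lin_equiv_iff_pic_cover)
qed

lemma div_class_chain:
  assumes "D \<in> divisors G"
  shows "div_class G D = {D' \<in> divisors G. deg D' = deg D \<and>
    (\<forall>a\<in>{1..n}. eq_mod (x a + y a) (coord x a D') (coord x a D))}"
  using lin_equiv_chain[OF assms] by (auto simp: div_class_def)

lemma div_class_eq_iff:
  assumes "D \<in> divisors G" "D' \<in> divisors G"
  shows "div_class G D = div_class G D' \<longleftrightarrow> deg D = deg D' \<and>
    (\<forall>a\<in>{1..n}. eq_mod (x a + y a) (coord x a D) (coord x a D'))" (is "_ \<longleftrightarrow> ?R")
proof
  assume "div_class G D = div_class G D'"
  moreover have "D \<in> div_class G D" using assms by (simp add: div_class_chain)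
  ultimately show ?R using assms by (auto simp: div_class_chain)
next
  assume ?R
  then show "div_class G D = div_class G D'"
    unfolding div_class_chain[OF assms(1)] div_class_chain[OF assms(2)]
    using eq_mod_cong[OF eq_mod_refl] by (intro Collect_cong conj_cong ball_cong refl) auto
qed

end

section \<open>Effective classes on chains of loops\<close>

definition of_points :: "('v, 'e) point list \<Rightarrow> ('v, 'e) divisor"
  where "of_points ps p = int (count_list ps p)"

lemma of_points_Cons: "of_points (p # ps) = (\<lambda>q. if q = p then 1 else 0) + of_points ps"
  by (auto simp: of_points_def fun_eq_iff)

lemma supp_of_points: "{p. of_points ps p \<noteq> 0} = set ps"
  by (auto simp: of_points_def count_list_0_iff)

lemma weighted_deg_of_points: "weighted_deg (of_points ps) W = (\<Sum>p\<leftarrow>ps. W p)"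
proof (induction ps)
  case Nil
  then show ?case by (simp add: weighted_deg_def of_points_def)
next
  case (Cons p ps)
  have "weighted_deg (\<lambda>q. if q = p then 1 else 0) W = W p"
    by (simp add: weighted_deg_def)
  moreover have "weighted_deg (of_points (p # ps)) W =
      weighted_deg (\<lambda>q. if q = p then 1 else 0) W + weighted_deg (of_points ps) W"
    unfolding of_points_Cons by (rule weighted_deg_add) (auto simp: supp_of_points)
  ultimately show ?case using Cons by simp
qed

lemma deg_of_points: "deg (of_points ps) = int (length ps)"
proof -
  have "real_of_int (deg (of_points ps)) = real_of_int (int (length ps))"
    unfolding deg_eq_weighted_deg weighted_deg_of_points by (simp add: sum_list_triv)
  then show ?thesis by (simp only: of_int_eq_iff)
qed

lemma effective_of_points: "effective (of_points ps)"
  by (simp add: effective_def of_points_def)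

lemma of_points_in_divisors: "set ps \<subseteq> points \<Gamma> \<Longrightarrow> of_points ps \<in> divisors \<Gamma>"
  by (simp add: divisors_def supp_of_points)

text \<open>For an effective divisor this is the path of the game. The bridge after loop
  \<open>i\<close> is not yet beyond it.\<close>

definition chips_beyond :: "(chain_vertex, chain_edge) divisor \<Rightarrow> nat \<Rightarrow> int"
  where "chips_beyond D i = (\<Sum>p | D p \<noteq> 0 \<and> i < loop_index p. D p)"

context loop_chain
begin

lemma loop_index_points: "p \<in> points G \<Longrightarrow> loop_index p \<in> {1..n}"
  by (auto simp: points_def)

lemma L_pos: "a \<in> {1..n} \<Longrightarrow> 0 < x a + y a"
  using x_pos[of a] y_pos[of a] by simp

lemma point_at:
  assumes a: "a \<in> {1..n}"
  obtains p where "p \<in> points G" "loop_index p = a" "eq_mod (x a + y a) (loop_pos x p) \<theta>"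
proof -
  define L where "L = x a + y a"
  have L: "0 < L" using L_pos[OF a] by (simp add: L_def)
  define s where "s = \<theta> - of_int \<lfloor>\<theta> / L\<rfloor> * L"
  have s0: "0 \<le> s" "s < L"
    using L floor_divide_lower[OF L, of \<theta>] floor_divide_upper[OF L, of \<theta>] by (auto simp: s_def algebra_simps)
  have \<theta>: "eq_mod L s \<theta>"
  proof -
    have "s = \<theta> + of_int (- \<lfloor>\<theta> / L\<rfloor>) * L" by (simp add: s_def)
    then show ?thesis unfolding eq_mod_def by blast
  qed
  consider "s = 0" | "0 < s" "s < x a" | "s = x a" | "x a < s" using s0 by linarith
  then show thesis
  proof cases
    case 1
    then show thesis using that[of "Vertex (LeftV a)"] a \<theta> by (auto simp: points_simps L_def)
  next
    case 2
    then show thesis using that[of "Inner (Upper a) s"] a \<theta> by (auto simp: points_simps L_def)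
  next
    case 3
    then show thesis using that[of "Vertex (RightV a)"] a \<theta> by (auto simp: points_simps L_def)
  next
    case 4
    have "- (L - s) = s + of_int (- 1) * L" by simp
    then have "eq_mod L (- (L - s)) s" unfolding eq_mod_def by blast
    then have "eq_mod L (- (L - s)) \<theta>" using \<theta> eq_mod_trans by blast
    then show thesis
      using that[of "Inner (Lower a) (L - s)"] a 4 s0 by (auto simp: points_simps L_def)
  qed
qed

text \<open>A chip at the left vertex of a loop does not move its coordinate, and every chip further
  right moves it by \<open>x a\<close>. So one chip in a suitable position fixes the coordinate of
  its loop, the other chips of the loop are put at its left vertex, and \<open>dS\<close> and
  \<open>dE\<close> chips sit at the ends of the chain.\<close>

lemma divisor_with_chips:
  fixes \<nu> :: "nat \<Rightarrow> nat" and dS dE :: nat and \<theta> :: "nat \<Rightarrow> real"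
  obtains E where "E \<in> divisors G" "effective E" "deg E = int dS + (\<Sum>a=1..n. int (\<nu> a)) + int dE"
    and "\<And>a. a \<in> {1..n} \<Longrightarrow> eq_mod (x a + y a) (coord x a E)
      (of_int ((\<Sum>c=Suc a..n. int (\<nu> c)) + int dE) * x a + (if \<nu> a = 0 then 0 else \<theta> a))"
proof -
  have "\<forall>a\<in>{1..n}. \<exists>p. p \<in> points G \<and> loop_index p = a \<and> eq_mod (x a + y a) (loop_pos x p) (\<theta> a)"
  proof
    fix a assume "a \<in> {1..n}"
    then show "\<exists>p. p \<in> points G \<and> loop_index p = a \<and> eq_mod (x a + y a) (loop_pos x p) (\<theta> a)"
      by (rule point_at) (intro exI conjI)
  qed
  from bchoice[OF this] obtain P where P: "\<And>a. a \<in> {1..n} \<Longrightarrow> P a \<in> points G"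
    "\<And>a. a \<in> {1..n} \<Longrightarrow> loop_index (P a) = a" "\<And>a. a \<in> {1..n} \<Longrightarrow> eq_mod (x a + y a) (loop_pos x (P a)) (\<theta> a)"
    by blast
  define chips where "chips a = (if \<nu> a = 0 then [] else P a # replicate (\<nu> a - 1) (Vertex (LeftV a)))" for a
  define ps where "ps = replicate dS (Vertex (LeftV 1)) @ concat (map chips [1..<Suc n]) @ replicate dE (Vertex (RightV n))"
  have W: "weighted_deg (of_points ps) W = real dS * W (Vertex (LeftV 1)) + (\<Sum>a=1..n. \<Sum>p\<leftarrow>chips a. W p) + real dE * W (Vertex (RightV n))" for W
  proof -
    have "(\<Sum>p\<leftarrow>concat (map chips [1..<Suc n]). W p) = (\<Sum>a\<leftarrow>[1..<Suc n]. \<Sum>p\<leftarrow>chips a. W p)"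
      by (induction n) auto
    also have "\<dots> = (\<Sum>a=1..n. \<Sum>p\<leftarrow>chips a. W p)"
      by (simp only: interv_sum_list_conv_sum_set_nat set_upt atLeastLessThanSuc_atLeastAtMost)
    finally show ?thesis
      by (simp add: weighted_deg_of_points ps_def sum_list_replicate del: upt_Suc)
  qed
  show thesis
  proof (rule that)
    show "of_points ps \<in> divisors G"
      by (rule of_points_in_divisors) (use n_pos P(1) in \<open>auto simp: ps_def chips_def points_simps split: if_splits\<close>)
    show "effective (of_points ps)" by (rule effective_of_points)
    have "(\<Sum>p\<leftarrow>chips a. 1) = real (\<nu> a)" for a by (simp add: chips_def sum_list_replicate)
    then have "real_of_int (deg (of_points ps)) = real_of_int (int dS + (\<Sum>a=1..n. int (\<nu> a)) + int dE)"
      unfolding deg_eq_weighted_deg W by simp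
    then show "deg (of_points ps) = int dS + (\<Sum>a=1..n. int (\<nu> a)) + int dE" by (simp only: of_int_eq_iff)
    fix a assume a: "a \<in> {1..n}"
    let ?W = "loop_coord x a"
    have 1: "(\<Sum>p\<leftarrow>chips c. ?W p) = 0" if "c < a" "1 \<le> c" for c
      using that a P(2)[of c] by (simp add: chips_def loop_coord_def sum_list_replicate)
    have 2: "(\<Sum>p\<leftarrow>chips c. ?W p) = of_int (int (\<nu> c)) * x a" if "a < c" "c \<le> n" for c
      using that a P(2)[of c] by (cases "\<nu> c") (simp_all add: chips_def loop_coord_def sum_list_replicate algebra_simps)
    have 3: "(\<Sum>p\<leftarrow>chips a. ?W p) = (if \<nu> a = 0 then 0 else loop_pos x (P a))"
      using a P(2)[of a] by (simp add: chips_def loop_coord_def sum_list_replicate)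
    have split: "(\<Sum>d=1..n. F d) = (\<Sum>d=1..<a. F d) + (F a + (\<Sum>d=Suc a..n. F d))" for F :: "nat \<Rightarrow> real"
    proof -
      have "{1..n} = {1..<a} \<union> insert a {Suc a..n}" using a by auto
      then show ?thesis by (simp only:) (subst sum.union_disjoint, simp, simp, force, simp)
    qed
    have "(\<Sum>d=1..<a. \<Sum>p\<leftarrow>chips d. ?W p) = 0" by (rule sum.neutral) (use 1 in auto)
    moreover have "(\<Sum>d=Suc a..n. \<Sum>p\<leftarrow>chips d. ?W p) = of_int (\<Sum>c=Suc a..n. int (\<nu> c)) * x a"
      by (simp add: sum_distrib_right, rule sum.cong) (use 2 in auto)
    moreover have "?W (Vertex (LeftV 1)) = 0" "?W (Vertex (RightV n)) = x a"
      using a by (auto simp: loop_coord_def)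
    ultimately have "coord x a (of_points ps) =
        of_int ((\<Sum>c=Suc a..n. int (\<nu> c)) + int dE) * x a + (if \<nu> a = 0 then 0 else loop_pos x (P a))"
      unfolding W split 3 by (simp add: algebra_simps)
    then show "eq_mod (x a + y a) (coord x a (of_points ps))
      (of_int ((\<Sum>c=Suc a..n. int (\<nu> c)) + int dE) * x a + (if \<nu> a = 0 then 0 else \<theta> a))"
      using P(3)[OF a] by (auto intro: eq_mod_add)
  qed
qed

text \<open>The last claim is the origin of special loops: if an effective divisor has no chip on
  loop \<open>i\<close>, the coordinate of this loop comes only from the chips beyond it.\<close>

lemma chips_beyond:
  assumes E: "E \<in> divisors G"
  shows "chips_beyond E 0 = deg E" and "chips_beyond E n = 0"
    and "effective E \<Longrightarrow> chips_beyond E i \<le> chips_beyond E (i - 1)"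
    and "effective E \<Longrightarrow> i \<in> {1..n} \<Longrightarrow> chips_beyond E i = chips_beyond E (i - 1) \<Longrightarrow>
      coord x i E = of_int (chips_beyond E i) * x i"
proof -
  have idx: "loop_index p \<in> {1..n}" if "E p \<noteq> 0" for p
    using divisorsD[OF E] that loop_index_points by blast
  have fin: "finite {p. E p \<noteq> 0}" using divisorsD[OF E] by blast
  have "{p. E p \<noteq> 0 \<and> 0 < loop_index p} = {p. E p \<noteq> 0}" using idx by force
  then show "chips_beyond E 0 = deg E" by (simp add: chips_beyond_def deg_def)
  have "{p. E p \<noteq> 0 \<and> n < loop_index p} = {}" using idx by force
  then show "chips_beyond E n = 0" unfolding chips_beyond_def by (simp only: sum.empty)
  assume eff: "effective E"
  show le: "chips_beyond E i \<le> chips_beyond E (i - 1)"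
    unfolding chips_beyond_def
    by (rule sum_mono2) (use fin eff in \<open>auto simp: effective_def\<close>)
  assume i: "i \<in> {1..n}" and eq: "chips_beyond E i = chips_beyond E (i - 1)"
  have "chips_beyond E (i - 1) = chips_beyond E i + (\<Sum>p | E p \<noteq> 0 \<and> loop_index p = i. E p)"
  proof -
    have "{p. E p \<noteq> 0 \<and> i - 1 < loop_index p} = {p. E p \<noteq> 0 \<and> i < loop_index p} \<union> {p. E p \<noteq> 0 \<and> loop_index p = i}"
      using i by auto
    then show ?thesis unfolding chips_beyond_def
      by (simp only:) (subst sum.union_disjoint, use fin in auto)
  qed
  then have "(\<Sum>p | E p \<noteq> 0 \<and> loop_index p = i. E p) = 0" using eq by simp
  then have none: "loop_index p \<noteq> i" if "E p \<noteq> 0" for p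
    using that fin eff by (subst (asm) sum_nonneg_eq_0_iff) (auto simp: effective_def)
  have "coord x i E = (\<Sum>p | E p \<noteq> 0. if i < loop_index p then of_int (E p) * x i else 0)"
    unfolding weighted_deg_def by (rule sum.cong) (use none in \<open>auto simp: loop_coord_def\<close>)
  also have "\<dots> = (\<Sum>p | E p \<noteq> 0 \<and> i < loop_index p. of_int (E p) * x i)"
    using fin by (simp add: sum.inter_filter[symmetric])
  finally show "coord x i E = of_int (chips_beyond E i) * x i"
    by (simp add: chips_beyond_def sum_distrib_right)
qed

text \<open>The path is realised by a divisor with u (i - 1) - u i chips on loop \<open>i\<close>
  and the surplus at the two ends. A loop with a chip can be given any coordinate; a loop without
  one has the right coordinate because it is special.\<close>

lemma effective_class_if:
  assumes D: "D \<in> divisors G" and u0: "u 0 \<le> deg D" "0 \<le> u n"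
    and step: "\<And>i. i \<in> {1..n} \<Longrightarrow> u i < u (i - 1) \<or>
      u i = u (i - 1) \<and> eq_mod (x i + y i) (coord x i D) (of_int (u i) * x i)"
  shows "\<exists>D'. lin_equiv G D D' \<and> effective D'"
proof -
  define \<nu> where "\<nu> i = nat (u (i - 1) - u i)" for i
  have \<nu>: "int (\<nu> i) = u (i - 1) - u i" if "i \<in> {1..n}" for i using step[OF that] by (auto simp: \<nu>_def)
  have tel: "(\<Sum>c=Suc a..n. int (\<nu> c)) = u a - u n" if "a \<le> n" for a
  proof -
    have "(\<Sum>c=Suc a..n. int (\<nu> c)) = (\<Sum>c=Suc a..n. u (c - 1) - u c)"
      by (rule sum.cong) (use \<nu> in auto)
    also have "\<dots> = - (u n - u a)"
      using sum_telescope''[OF that, of u] by (simp add: sum_subtractf)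
    finally show ?thesis by simp
  qed
  obtain D' where D': "D' \<in> divisors G" "effective D'"
    "deg D' = int (nat (deg D - u 0)) + (\<Sum>a=1..n. int (\<nu> a)) + int (nat (u n))"
    "\<And>a. a \<in> {1..n} \<Longrightarrow> eq_mod (x a + y a) (coord x a D')
      (of_int ((\<Sum>c=Suc a..n. int (\<nu> c)) + int (nat (u n))) * x a +
        (if \<nu> a = 0 then 0 else coord x a D - of_int (u a) * x a))"
    by (rule divisor_with_chips[of "nat (deg D - u 0)" \<nu> "nat (u n)" "\<lambda>a. coord x a D - of_int (u a) * x a"]) blast
  have "deg D' = deg D" using D'(3) tel[of 0] u0 by simp
  moreover have "eq_mod (x a + y a) (coord x a D') (coord x a D)" if a: "a \<in> {1..n}" for a
  proof -
    have e: "(\<Sum>c=Suc a..n. int (\<nu> c)) + int (nat (u n)) = u a" using tel[of a] a u0 by simp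
    note E = D'(4)[OF a, unfolded e]
    show ?thesis
    proof (cases "\<nu> a = 0")
      case True
      then have "eq_mod (x a + y a) (coord x a D) (of_int (u a) * x a)" using step[OF a] \<nu>[OF a] by auto
      moreover have "eq_mod (x a + y a) (coord x a D') (of_int (u a) * x a)" using E True by simp
      ultimately show ?thesis using eq_mod_trans eq_mod_sym by blast
    next
      case False
      then show ?thesis using E by simp
    qed
  qed
  ultimately show ?thesis using D' lin_equiv_chain[OF D] by blast
qed

lemma effective_class_path:
  assumes D: "D \<in> divisors G" and "lin_equiv G D D'" "effective D'"
  obtains u where "u 0 = deg D" "u n = 0"
    and "\<And>i. i \<in> {1..n} \<Longrightarrow> u i < u (i - 1) \<or>
      u i = u (i - 1) \<and> eq_mod (x i + y i) (coord x i D) (of_int (u i) * x i)"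
proof (rule that[of "chips_beyond D'"])
  have D': "D' \<in> divisors G" "deg D' = deg D"
    "\<And>a. a \<in> {1..n} \<Longrightarrow> eq_mod (x a + y a) (coord x a D') (coord x a D)"
    using assms lin_equiv_chain by auto
  show "chips_beyond D' 0 = deg D" "chips_beyond D' n = 0"
    using chips_beyond(1,2)[OF D'(1)] D'(2) by auto
  fix i assume i: "i \<in> {1..n}"
  show "chips_beyond D' i < chips_beyond D' (i - 1) \<or> chips_beyond D' i = chips_beyond D' (i - 1) \<and>
      eq_mod (x i + y i) (coord x i D) (of_int (chips_beyond D' i) * x i)"
  proof (cases "chips_beyond D' i = chips_beyond D' (i - 1)")
    case True
    then have "coord x i D' = of_int (chips_beyond D' i) * x i"
      using chips_beyond(4)[OF D'(1) assms(3) i] by simp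
    then show ?thesis using True eq_mod_sym[OF D'(3)[OF i]] by simp
  next
    case False
    then show ?thesis using chips_beyond(3)[OF D'(1) assms(3), of i] by simp
  qed
qed

text \<open>Only countably many positions are excluded. After removing a chip from any other
  position the loop is special for no number.\<close>

lemma generic_position: "\<exists>\<theta>. \<forall>v::int. \<not> eq_mod L (s - \<theta>) (of_int v * t)"
proof -
  have "countable (range (\<lambda>(v::int, z::int). s - of_int v * t - of_int z * L))" by simp
  then obtain \<theta> where \<theta>: "\<theta> \<notin> range (\<lambda>(v::int, z::int). s - of_int v * t - of_int z * L)"
    using uncountable_UNIV_real by (metis UNIV_eq_I)
  have "\<not> eq_mod L (s - \<theta>) (of_int v * t)" for v :: int
  proof
    assume "eq_mod L (s - \<theta>) (of_int v * t)"
    then obtain z :: int where "s - \<theta> = of_int v * t + of_int z * L" by (auto simp: eq_mod_def)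
    then have "\<theta> = s - of_int v * t - of_int z * L" by simp
    then show False using \<theta> by (metis (mono_tags, lifting) case_prod_conv rangeI)
  qed
  then show ?thesis by blast
qed

definition loop_spec :: "(chain_vertex, chain_edge) divisor \<Rightarrow> nat \<Rightarrow> int \<Rightarrow> bool"
  where "loop_spec D a v \<longleftrightarrow> eq_mod (x a + y a) (coord x a D) (of_int v * x a)"

definition rank_ge :: "(chain_vertex, chain_edge) divisor \<Rightarrow> int \<Rightarrow> bool"
  where "rank_ge D k \<longleftrightarrow> (\<forall>E\<in>divisors_of_degree G k. effective E \<longrightarrow>
      (\<exists>D'. lin_equiv G (D - E) D' \<and> effective D'))"

text \<open>Only the numbers of chips of \<open>E\<close> on the loops matter. On a loop that
  \<open>E\<close> avoids, the coordinate of \<open>E\<close> is the number of its chips beyond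
  times \<open>x i\<close>, so subtracting \<open>E\<close> shifts the special values in the same
  way as the path.\<close>

lemma rank_ge_if:
  assumes D: "D \<in> divisors G"
    and win: "\<And>\<nu>. (\<Sum>i\<le>Suc n. \<nu> i) = e \<Longrightarrow> \<exists>u. winning_path (loop_spec D) (deg D) n \<nu> u"
  shows "rank_ge D (int e)"
  unfolding rank_ge_def
proof (intro ballI impI)
  fix E assume E: "E \<in> divisors_of_degree G (int e)" and eff: "effective E"
  have Ed: "E \<in> divisors G" "deg E = int e" using E by (auto simp: divisors_of_degree_def)
  let ?R = "chips_beyond E"
  define \<nu> where "\<nu> i = (if i \<in> {1..n} then nat (?R (i - 1) - ?R i) else 0)" for i
  have \<nu>: "int (\<nu> i) = ?R (i - 1) - ?R i" if "i \<in> {1..n}" for i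
    using that chips_beyond(3)[OF Ed(1) eff, of i] by (simp add: \<nu>_def)
  have "(\<Sum>i\<le>Suc n. \<nu> i) = (\<Sum>i=1..n. \<nu> i)"
    by (rule sum.mono_neutral_right) (auto simp: \<nu>_def)
  moreover have "(\<Sum>i=1..n. int (\<nu> i)) = int e"
  proof -
    have "(\<Sum>i=1..n. int (\<nu> i)) = (\<Sum>i=Suc 0..n. ?R (i - 1) - ?R i)"
      by (rule sum.cong) (use \<nu> in auto)
    also have "\<dots> = - (?R n - ?R 0)"
      using sum_telescope''[of 0 n ?R] by (simp add: sum_subtractf)
    finally show ?thesis using chips_beyond(1,2)[OF Ed(1)] Ed(2) by simp
  qed
  ultimately have "(\<Sum>i\<le>Suc n. \<nu> i) = e" by (metis of_nat_eq_iff of_nat_sum)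
  then obtain u where u: "winning_path (loop_spec D) (deg D) n \<nu> u" using win by blast
  have fin: "finite {p. D p \<noteq> 0}" "finite {p. E p \<noteq> 0}" using divisorsD(1)[OF D] divisorsD(1)[OF Ed(1)] by auto
  show "\<exists>D'. lin_equiv G (D - E) D' \<and> effective D'"
  proof (rule effective_class_if[where u = "\<lambda>i. u i - ?R i"])
    show "D - E \<in> divisors G" by (rule divisors_diff[OF D Ed(1)])
    show "u 0 - ?R 0 \<le> deg (D - E)" "0 \<le> u n - ?R n"
      using u chips_beyond(1,2)[OF Ed(1)] by (auto simp: winning_path_def deg_diff[OF fin])
    fix i assume i: "i \<in> {1..n}"
    then have "loop_step (loop_spec D i) (\<nu> i) (u (i - 1)) (u i)" using u unfolding winning_path_def by blast
    then show "u i - ?R i < u (i - 1) - ?R (i - 1) \<or> u i - ?R i = u (i - 1) - ?R (i - 1) \<and>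
        eq_mod (x i + y i) (coord x i (D - E)) (of_int (u i - ?R i) * x i)"
      unfolding loop_step_def loop_spec_def
    proof (elim disjE conjE)
      assume "u i + int (\<nu> i) < u (i - 1)"
      then show ?thesis using \<nu>[OF i] by simp
    next
      assume 2: "\<nu> i = 0" "u (i - 1) = u i" "eq_mod (x i + y i) (coord x i D) (of_int (u i) * x i)"
      then have R: "?R i = ?R (i - 1)" using \<nu>[OF i] by simp
      then have "coord x i E = of_int (?R i) * x i" by (rule chips_beyond(4)[OF Ed(1) eff i])
      then have "eq_mod (x i + y i) (coord x i (D - E)) (of_int (u i) * x i - of_int (?R i) * x i)"
        unfolding weighted_deg_diff[OF fin] using eq_mod_diff[OF 2(3) eq_mod_refl] by simp
      then show ?thesis using 2 R by (simp add: algebra_simps)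
    qed
  qed
qed

text \<open>The worst \<open>E\<close> with given numbers of chips has a chip in generic position on
  every loop it meets. Then D - E is not special on these loops, so an effective representative
  needs a chip there.\<close>

lemma winning_path_if_rank_ge:
  assumes D: "D \<in> divisors G" and rank: "rank_ge D (int e)" and \<nu>: "(\<Sum>i\<le>Suc n. \<nu> i) = e"
  shows "\<exists>u. winning_path (loop_spec D) (deg D) n \<nu> u"
proof -
  have "\<forall>a. \<exists>t. \<forall>v. \<not> eq_mod (x a + y a) (coord x a D - t) (of_int v * x a)"
    using generic_position by (intro allI)
  from choice[OF this] obtain \<theta> where \<theta>: "\<And>a v. \<not> eq_mod (x a + y a) (coord x a D - \<theta> a) (of_int v * x a)" by blast
  obtain E where E: "E \<in> divisors G" "effective E"
    "deg E = int (\<nu> 0) + (\<Sum>a=1..n. int (\<nu> a)) + int (\<nu> (Suc n))"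
    "\<And>a. a \<in> {1..n} \<Longrightarrow> eq_mod (x a + y a) (coord x a E)
      (of_int ((\<Sum>c=Suc a..n. int (\<nu> c)) + int (\<nu> (Suc n))) * x a + (if \<nu> a = 0 then 0 else \<theta> a))"
    by (rule divisor_with_chips[of "\<nu> 0" \<nu> "\<nu> (Suc n)" \<theta>]) blast
  have sum0: "(\<Sum>i\<le>Suc n. int (\<nu> i)) = int (\<nu> 0) + (\<Sum>a=1..n. int (\<nu> a)) + int (\<nu> (Suc n))"
  proof -
    have "{..Suc n} = insert 0 (insert (Suc n) {1..n})" by auto
    then show ?thesis by (simp only:) simp
  qed
  have degE: "deg E = int e"
    using E(3) sum0 of_nat_sum[where ?'a = int, of \<nu> "{..Suc n}"] unfolding \<nu> by linarith
  have fin: "finite {p. D p \<noteq> 0}" "finite {p. E p \<noteq> 0}" using divisorsD(1)[OF D] divisorsD(1)[OF E(1)] by auto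
  have DE: "D - E \<in> divisors G" by (rule divisors_diff[OF D E(1)])
  obtain D' where D': "lin_equiv G (D - E) D'" "effective D'"
    using rank E degE by (auto simp: rank_ge_def divisors_of_degree_def)
  obtain v where v: "v 0 = deg (D - E)" "v n = 0"
    "\<And>i. i \<in> {1..n} \<Longrightarrow> v i < v (i - 1) \<or>
      v i = v (i - 1) \<and> eq_mod (x i + y i) (coord x i (D - E)) (of_int (v i) * x i)"
    by (rule effective_class_path[OF DE D']) blast
  define R where "R i = (\<Sum>c=Suc i..n. int (\<nu> c)) + int (\<nu> (Suc n))" for i
  have R_step: "R (i - 1) = int (\<nu> i) + R i" if "i \<in> {1..n}" for i
  proof -
    have "{Suc (i - 1)..n} = insert i {Suc i..n}" using that by auto
    then show ?thesis by (simp add: R_def)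
  qed
  have "winning_path (loop_spec D) (deg D) n \<nu> (\<lambda>i. v i + R i)"
    unfolding winning_path_def
  proof (intro conjI ballI)
    show "v 0 + R 0 \<le> deg D - int (\<nu> 0)"
      using v(1) E(3) by (simp add: R_def deg_diff[OF fin])
    show "int (\<nu> (Suc n)) \<le> v n + R n" using v(2) by (simp add: R_def)
    fix i assume i: "i \<in> {1..n}"
    have Ei: "eq_mod (x i + y i) (coord x i E) (of_int (R i) * x i + (if \<nu> i = 0 then 0 else \<theta> i))"
      using E(4)[OF i] by (simp add: R_def)
    show "loop_step (loop_spec D i) (\<nu> i) (v (i - 1) + R (i - 1)) (v i + R i)"
    proof (cases "v i < v (i - 1)")
      case True
      then show ?thesis using R_step[OF i] by (simp add: loop_step_def)
    next
      case False
      then have eq: "v i = v (i - 1)" and s: "eq_mod (x i + y i) (coord x i D - coord x i E) (of_int (v i) * x i)"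
        using v(3)[OF i] by (auto simp: weighted_deg_diff[OF fin])
      from eq_mod_add[OF s Ei]
      have s': "eq_mod (x i + y i) (coord x i D) (of_int (v i + R i) * x i + (if \<nu> i = 0 then 0 else \<theta> i))"
        by (simp add: algebra_simps)
      have "\<nu> i = 0"
      proof (rule ccontr)
        assume "\<nu> i \<noteq> 0"
        then have "eq_mod (x i + y i) (coord x i D - \<theta> i) (of_int (v i + R i) * x i)"
          using eq_mod_diff[OF s' eq_mod_refl, of "\<theta> i"] by simp
        then show False using \<theta> by blast
      qed
      then show ?thesis using s' eq R_step[OF i] by (simp add: loop_step_def loop_spec_def)
    qed
  qed
  then show ?thesis by blast
qed

lemma rank_ge_iff:
  assumes "D \<in> divisors G"
  shows "rank_ge D (int e) \<longleftrightarrow>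
    (\<forall>\<nu>. (\<Sum>i\<le>Suc n. \<nu> i) = e \<longrightarrow> (\<exists>u. winning_path (loop_spec D) (deg D) n \<nu> u))"
  using rank_ge_if[OF assms] winning_path_if_rank_ge[OF assms] by blast

lemma rank_ge_minus_one: "rank_ge D (- 1)"
proof -
  have "0 \<le> deg E" if "effective E" for E :: "(chain_vertex, chain_edge) divisor"
    unfolding deg_def by (rule sum_nonneg) (use that in \<open>simp add: effective_def\<close>)
  then show ?thesis by (force simp: rank_ge_def divisors_of_degree_def)
qed

lemma rank_div_eqI:
  assumes "- 1 \<le> k" "rank_ge D k" "\<And>e. rank_ge D (int e) \<Longrightarrow> int e \<le> k"
  shows "rank_div G D = k"
proof -
  have "rank_div G D = (GREATEST k. - 1 \<le> k \<and> rank_ge D k)"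
    by (simp add: rank_div_def rank_ge_def)
  also have "\<dots> = k"
  proof (rule Greatest_equality)
    fix j assume j: "- 1 \<le> j \<and> rank_ge D j"
    show "j \<le> k"
    proof (cases "j = - 1")
      case False
      then have "j = int (nat j)" using j by simp
      then show ?thesis using assms(3)[of "nat j"] j by simp
    qed (use assms in simp)
  qed (use assms in simp)
  finally show ?thesis .
qed

end

section \<open>The Prym condition\<close>

lemma weighted_deg_eq_mod:
  assumes "\<And>p. D p \<noteq> 0 \<Longrightarrow> eq_mod L (W p) (W' p)"
  shows "eq_mod L (weighted_deg D W) (weighted_deg D W')"
proof -
  have "\<forall>p\<in>{p. D p \<noteq> 0}. \<exists>z::int. W p = W' p + of_int z * L"
    using assms by (auto simp: eq_mod_def)
  from bchoice[OF this] obtain z :: "_ \<Rightarrow> int" where z: "\<And>p. D p \<noteq> 0 \<Longrightarrow> W p = W' p + of_int (z p) * L"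
    by auto
  have "weighted_deg D W = (\<Sum>p | D p \<noteq> 0. of_int (D p) * W' p + of_int (D p * z p) * L)"
    unfolding weighted_deg_def by (rule sum.cong) (use z in \<open>auto simp: algebra_simps\<close>)
  also have "\<dots> = weighted_deg D W' + of_int (\<Sum>p | D p \<noteq> 0. D p * z p) * L"
    by (simp add: weighted_deg_def sum.distrib sum_distrib_right)
  finally show ?thesis unfolding eq_mod_def by (rule exI)
qed

lemma weighted_deg_diff_weight:
  "weighted_deg D (\<lambda>p. W p - W' p) = weighted_deg D W - weighted_deg D W'"
  by (simp add: weighted_deg_def right_diff_distrib sum_subtractf)

lemma supp_pushforward: "{q. pushforward \<phi> D q \<noteq> 0} \<subseteq> \<phi> ` {p. D p \<noteq> 0}"
proof
  fix q assume "q \<in> {q. pushforward \<phi> D q \<noteq> 0}"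
  then have "(\<Sum>p | D p \<noteq> 0 \<and> \<phi> p = q. D p) \<noteq> 0" by (simp add: pushforward_def)
  then have "{p. D p \<noteq> 0 \<and> \<phi> p = q} \<noteq> {}" by (metis sum.empty)
  then show "q \<in> \<phi> ` {p. D p \<noteq> 0}" by auto
qed

text \<open>Pushforward of divisors is adjoint to pullback of weights; the Prym condition thus
  reduces to pulling back the loop coordinates.\<close>

lemma weighted_deg_pushforward:
  assumes fin: "finite {p. D p \<noteq> 0}"
  shows "weighted_deg (pushforward \<phi> D) W = weighted_deg D (\<lambda>p. W (\<phi> p))"
proof -
  let ?S = "{p. D p \<noteq> 0}"
  have "weighted_deg (pushforward \<phi> D) W = (\<Sum>q\<in>\<phi> ` ?S. of_int (pushforward \<phi> D q) * W q)"
    by (rule weighted_deg_superset[OF _ supp_pushforward]) (use fin in simp)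
  also have "\<dots> = (\<Sum>q\<in>\<phi> ` ?S. \<Sum>p\<in>{p \<in> ?S. \<phi> p = q}. of_int (D p) * W (\<phi> p))"
    by (rule sum.cong) (auto simp: pushforward_def sum_distrib_right)
  also have "\<dots> = (\<Sum>p\<in>?S. of_int (D p) * W (\<phi> p))"
    by (rule sum.image_gen[symmetric, OF fin])
  finally show ?thesis by (simp add: weighted_deg_def)
qed

lemma deg_pushforward:
  assumes "finite {p. D p \<noteq> 0}"
  shows "deg (pushforward \<phi> D) = deg D"
proof -
  have "real_of_int (deg (pushforward \<phi> D)) = real_of_int (deg D)"
    unfolding deg_eq_weighted_deg weighted_deg_pushforward[OF assms] ..
  then show ?thesis by (simp only: of_int_eq_iff)
qed

lemma pushforward_in_divisors:
  assumes "D \<in> divisors \<Gamma>'" "\<And>p. p \<in> points \<Gamma>' \<Longrightarrow> \<phi> p \<in> points \<Gamma>"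
  shows "pushforward \<phi> D \<in> divisors \<Gamma>"
proof -
  have fin: "finite (\<phi> ` {p. D p \<noteq> 0})" and sub: "\<phi> ` {p. D p \<noteq> 0} \<subseteq> points \<Gamma>"
    using assms divisorsD[OF assms(1)] by auto
  show ?thesis
    unfolding divisors_def
    using finite_subset[OF supp_pushforward fin] order_trans[OF supp_pushforward sub] by simp
qed

context loop_chain
begin

lemma canonical_chain:
  shows "canonical G \<in> divisors G"
    and "weighted_deg (canonical G) W = (\<Sum>c=1..<n. W (Vertex (RightV c)) + W (Vertex (LeftV (Suc c))))"
proof -
  have inner: "{t. canonical G (Inner e t) \<noteq> 0} \<subseteq> {}" for e by (auto simp: canonical_def)
  have supp: "{p. canonical G p \<noteq> 0} \<subseteq> points G"
  proof
    fix p assume "p \<in> {p. canonical G p \<noteq> 0}"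
    then show "p \<in> points G"
      by (cases p) (auto simp: canonical_def points_simps simp del: chain_simps split: if_splits)
  qed
  note graph = weighted_deg_graph[OF finite_graph supp, of "\<lambda>_. {}", OF finite.emptyI inner]
  show "canonical G \<in> divisors G" using graph(1) supp by (simp add: divisors_def)
  have L: "canonical G (Vertex (LeftV a)) = (if 1 < a then 1 else 0)" if "a \<in> {1..n}" for a
    using that edges_at(1,2)[OF that] by (simp add: canonical_def valence_def del: chain_simps(2) One_nat_def)
  have R: "canonical G (Vertex (RightV a)) = (if a < n then 1 else 0)" if "a \<in> {1..n}" for a
    using that edges_at(3,4)[OF that] by (simp add: canonical_def valence_def del: chain_simps(2))
  have "weighted_deg (canonical G) W =
      (\<Sum>a=1..n. if 1 < a then W (Vertex (LeftV a)) else 0) + (\<Sum>a=1..n. if a < n then W (Vertex (RightV a)) else 0)"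
    unfolding graph(2) sum_verts
    by (simp, intro arg_cong2[where f = "(+)"] sum.cong refl) (use L R in auto)
  also have "(\<Sum>a=1..n. if 1 < a then W (Vertex (LeftV a)) else 0) = (\<Sum>a=Suc 1..<Suc n. W (Vertex (LeftV a)))"
    by (rule sum.mono_neutral_cong_right) auto
  also have "\<dots> = (\<Sum>c=1..<n. W (Vertex (LeftV (Suc c))))"
    by (rule sum.shift_bounds_Suc_ivl)
  also have "(\<Sum>a=1..n. if a < n then W (Vertex (RightV a)) else 0) = (\<Sum>c=1..<n. W (Vertex (RightV c)))"
    by (rule sum.mono_neutral_cong_right) auto
  finally show "weighted_deg (canonical G) W = (\<Sum>c=1..<n. W (Vertex (RightV c)) + W (Vertex (LeftV (Suc c))))"
    by (simp add: sum.distrib)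
qed

lemma deg_canonical: "deg (canonical G) = 2 * int n - 2"
proof -
  have "real_of_int (deg (canonical G)) = real_of_int (2 * int n - 2)"
    unfolding deg_eq_weighted_deg canonical_chain(2) using n_pos by (simp add: of_nat_diff)
  then show ?thesis by (simp only: of_int_eq_iff)
qed

lemma coord_canonical:
  assumes "a \<in> {1..n}"
  shows "coord x a (canonical G) = of_int (2 * int n - 2 * int a) * x a"
proof -
  have "coord x a (canonical G) = (\<Sum>c=1..<n. if a \<le> c then 2 * x a else 0)"
    unfolding canonical_chain(2) by (rule sum.cong) (auto simp: loop_coord_def)
  also have "\<dots> = (\<Sum>c=a..<n. 2 * x a)"
    by (rule sum.mono_neutral_cong_right) (use assms in auto)
  also have "\<dots> = of_int (2 * int n - 2 * int a) * x a"
    using assms by (simp add: of_nat_diff algebra_simps)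
  finally show ?thesis .
qed

end

section \<open>The double cover in coordinates\<close>

locale folded_loops =
  fixes g :: nat and \<l> m b :: "nat \<Rightarrow> real"
  assumes g2: "2 \<le> g"
    and l_pos: "\<And>a. a \<in> {1..g} \<Longrightarrow> 0 < \<l> a" and m_pos: "\<And>a. a \<in> {1..g} \<Longrightarrow> 0 < m a"
    and bridge_pos: "\<And>a. a \<in> {1..<g} \<Longrightarrow> 0 < b a"
begin

definition "fx a = (if a < g then \<l> a else if a = g then \<l> g + m g else \<l> (2 * g - a))"
definition "fy a = (if a < g then m a else if a = g then \<l> g + m g else m (2 * g - a))"
definition "fb a = (if a < g then b a else b (2 * g - 1 - a))"

sublocale base: loop_chain g \<l> m b
  by standard (use g2 l_pos m_pos bridge_pos in auto)

sublocale cover: loop_chain "2 * g - 1" fx fy fb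
proof
  show "1 \<le> 2 * g - 1" using g2 by simp
  fix a assume a: "a \<in> {1..2 * g - 1}"
  then have "a < g \<or> a = g \<or> (g < a \<and> 2 * g - a \<in> {1..g})" by auto
  then show "0 < fx a" "0 < fy a"
    using a l_pos[of a] m_pos[of a] l_pos[of g] m_pos[of g] l_pos[of "2 * g - a"] m_pos[of "2 * g - a"] g2
    by (auto simp: fx_def fy_def)
next
  fix a assume "a \<in> {1..<2 * g - 1}"
  then have "a < g \<or> 2 * g - 1 - a \<in> {1..<g}" using g2 by auto
  then show "0 < fb a" using \<open>a \<in> _\<close> bridge_pos[of a] bridge_pos[of "2 * g - 1 - a"] by (auto simp: fb_def)
qed

lemma folded_chain_eq: "folded_chain g \<l> m b = cover.G"
  unfolding folded_chain_def fx_def fy_def fb_def ..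

abbreviation "\<phi> \<equiv> folding_map g \<l> m b"

lemma fx_simps: "a < g \<Longrightarrow> fx a = \<l> a" "a < g \<Longrightarrow> fx (2 * g - a) = \<l> a" "fx g = \<l> g + m g"
    "g < a \<Longrightarrow> fx a = \<l> (2 * g - a)"
  and fy_simps: "a < g \<Longrightarrow> fy a = m a" "a < g \<Longrightarrow> fy (2 * g - a) = m a" "fy g = \<l> g + m g"
    "g < a \<Longrightarrow> fy a = m (2 * g - a)"
  by (auto simp: fx_def fy_def)

lemma cover_points_cases:
  assumes "p \<in> points cover.G"
  obtains (L) c where "p = Vertex (LeftV c)" "1 \<le> c" "c < 2 * g"
  | (R) c where "p = Vertex (RightV c)" "1 \<le> c" "c < 2 * g"
  | (U) c t where "p = Inner (Upper c) t" "1 \<le> c" "c < 2 * g" "0 < t" "t < fx c"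
  | (D) c t where "p = Inner (Lower c) t" "1 \<le> c" "c < 2 * g" "0 < t" "t < fy c"
  | (B) c t where "p = Inner (Bridge c) t" "1 \<le> c" "c < 2 * g - 1" "0 < t" "t < fb c"
  using assms by (auto simp: points_def simp del: One_nat_def)

lemma folding_map_points:
  assumes "p \<in> points cover.G"
  shows "\<phi> p \<in> points base.G"
  using assms
proof (cases rule: cover_points_cases)
  case (L c)
  then show ?thesis by (auto simp: points_simps image_iff)
next
  case (R c)
  then show ?thesis by (auto simp: points_simps image_iff)
next
  case (U c t)
  consider "c < g" | "c = g" | "g < c" by linarith
  then show ?thesis
  proof cases
    case 1
    then show ?thesis using U by (auto simp: points_simps fx_simps)
  next
    case 2
    then show ?thesis using U g2 by (auto simp: points_simps fx_simps)
  next
    case 3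
    then have "2 * g - c \<in> {1..g}" using U by auto
    then show ?thesis using U 3 by (auto simp: points_simps fx_simps)
  qed
next
  case (D c t)
  consider "c < g" | "c = g" | "g < c" by linarith
  then show ?thesis
  proof cases
    case 1
    then show ?thesis using D by (auto simp: points_simps fy_simps)
  next
    case 2
    then show ?thesis using D g2 by (auto simp: points_simps fy_simps)
  next
    case 3
    then have "2 * g - c \<in> {1..g}" using D by auto
    then show ?thesis using D 3 by (auto simp: points_simps fy_simps)
  qed
next
  case (B c t)
  show ?thesis
  proof (cases "c < g")
    case True
    then have "t < b c" using B by (simp add: fb_def)
    show ?thesis
    proof (cases "c = g")
      case False
      have "Bridge c \<in> edges base.G" using True B by auto
      then show ?thesis using B True \<open>t < b c\<close> by (auto simp: points_simps)
    qed (use True in simp)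
  next
    case False
    then have "2 * g - 1 - c \<in> {1..<g}" "t < b (2 * g - 1 - c)" using B by (auto simp: fb_def)
    then show ?thesis using B False by (auto simp: points_simps)
  qed
qed

text \<open>The left preimage of loop \<open>a\<close> keeps its direction and the right one is
  traversed backwards, hence the difference. The two sides differ by a full turn for points on the
  lower arc of loop 2 * g - a.\<close>

lemma loop_coord_folding_map:
  assumes p: "p \<in> points cover.G" and a: "1 \<le> a" "a < g"
  shows "eq_mod (\<l> a + m a) (loop_coord \<l> a (\<phi> p)) (loop_coord fx a p - loop_coord fx (2 * g - a) p)"
proof -
  have "loop_coord \<l> a (\<phi> p) = loop_coord fx a p - loop_coord fx (2 * g - a) p \<or>
      loop_coord \<l> a (\<phi> p) = loop_coord fx a p - loop_coord fx (2 * g - a) p + of_int (- 1) * (\<l> a + m a)"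
    using p
  proof (cases rule: cover_points_cases)
    case (L c)
    then show ?thesis using a by (cases "c \<le> g") (auto simp: loop_coord_def fx_simps)
  next
    case (R c)
    then show ?thesis using a by (cases "c < g") (auto simp: loop_coord_def fx_simps)
  next
    case (U c t)
    consider "c < g" | "c = g" | "g < c" by linarith
    then show ?thesis by cases (use U a in \<open>auto simp: loop_coord_def fx_simps\<close>)
  next
    case (D c t)
    consider "c < g" | "c = g" | "g < c" by linarith
    then show ?thesis by cases (use D a in \<open>auto simp: loop_coord_def fx_simps\<close>)
  next
    case (B c t)
    then show ?thesis using a by (cases "c < g") (auto simp: loop_coord_def fx_simps)
  qed
  then show ?thesis unfolding eq_mod_def by (metis add.right_neutral mult_zero_left of_int_0)
qed

lemma loop_coord_folding_map_middle:
  assumes p: "p \<in> points cover.G"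
  shows "eq_mod (\<l> g + m g) (loop_coord \<l> g (\<phi> p)) (loop_coord fx g p)"
proof -
  have "loop_coord \<l> g (\<phi> p) = loop_coord fx g p + of_int 0 * (\<l> g + m g) \<or>
      loop_coord \<l> g (\<phi> p) = loop_coord fx g p + of_int (- 1) * (\<l> g + m g) \<or>
      loop_coord \<l> g (\<phi> p) = loop_coord fx g p + of_int 1 * (\<l> g + m g)"
    using p
  proof (cases rule: cover_points_cases)
    case (L c)
    then show ?thesis by (cases "c \<le> g") (auto simp: loop_coord_def fx_simps)
  next
    case (R c)
    consider "c < g" | "c = g" | "g < c" by linarith
    then show ?thesis by cases (use R in \<open>auto simp: loop_coord_def fx_simps\<close>)
  next
    case (U c t)
    consider "c < g" | "c = g" | "g < c" by linarith
    then show ?thesis by cases (use U in \<open>auto simp: loop_coord_def fx_simps\<close>)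
  next
    case (D c t)
    consider "c < g" | "c = g" | "g < c" by linarith
    then show ?thesis by cases (use D in \<open>auto simp: loop_coord_def fx_simps\<close>)
  next
    case (B c t)
    consider "c < g" | "c = g" | "g < c" by linarith
    then show ?thesis by cases (use B in \<open>auto simp: loop_coord_def fx_simps\<close>)
  qed
  then show ?thesis unfolding eq_mod_def by metis
qed

text \<open>The last condition holds modulo half the length of the middle loop, so it leaves two
  possible coordinates there. They correspond to the two components of the fibre.\<close>

definition prym :: "(chain_vertex, chain_edge) divisor \<Rightarrow> bool"
  where "prym D \<longleftrightarrow>
    (\<forall>a\<in>{1..<g}. eq_mod (\<l> a + m a) (coord fx a D - coord fx (2 * g - a) D) (of_int (2 * int g - 2 * int a) * \<l> a)) \<and>
    eq_mod (\<l> g + m g) (coord fx g D) 0"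

lemma prym_iff:
  assumes D: "D \<in> divisors_of_degree cover.G (2 * int g - 2)"
  shows "div_class base.G (pushforward \<phi> D) = div_class base.G (canonical base.G) \<longleftrightarrow> prym D"
proof -
  have Dd: "D \<in> divisors cover.G" "deg D = 2 * int g - 2" using D by (auto simp: divisors_of_degree_def)
  have fin: "finite {p. D p \<noteq> 0}" and sub: "\<And>p. D p \<noteq> 0 \<Longrightarrow> p \<in> points cover.G" using divisorsD[OF Dd(1)] by auto
  have push: "pushforward \<phi> D \<in> divisors base.G"
    by (rule pushforward_in_divisors[OF Dd(1) folding_map_points])
  have c1: "eq_mod (\<l> a + m a) (coord \<l> a (pushforward \<phi> D)) (coord fx a D - coord fx (2 * g - a) D)"
    if "1 \<le> a" "a < g" for a
    unfolding weighted_deg_pushforward[OF fin] weighted_deg_diff_weight[symmetric]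
    by (rule weighted_deg_eq_mod) (use sub loop_coord_folding_map that in blast)
  have c2: "eq_mod (\<l> g + m g) (coord \<l> g (pushforward \<phi> D)) (coord fx g D)"
    unfolding weighted_deg_pushforward[OF fin]
    by (rule weighted_deg_eq_mod) (use sub loop_coord_folding_map_middle in blast)
  have "{1..g} = insert g {1..<g}" using g2 by auto
  then have "div_class base.G (pushforward \<phi> D) = div_class base.G (canonical base.G) \<longleftrightarrow>
      (\<forall>a\<in>insert g {1..<g}. eq_mod (\<l> a + m a) (coord \<l> a (pushforward \<phi> D)) (of_int (2 * int g - 2 * int a) * \<l> a))"
    using base.div_class_eq_iff[OF push base.canonical_chain(1)] base.deg_canonical
      deg_pushforward[OF fin, of \<phi>] Dd(2) base.coord_canonical by simp
  also have "\<dots> \<longleftrightarrow> prym D"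
    using eq_mod_cong[OF c1 eq_mod_refl] eq_mod_cong[OF c2 eq_mod_refl] by (auto simp: prym_def)
  finally show ?thesis .
qed

lemma middle_length: "fx g + fy g = 2 * (\<l> g + m g)"
  by (simp add: fx_simps fy_simps)

lemma middle_length_pos: "0 < \<l> g + m g"
  using l_pos[of g] m_pos[of g] g2 by simp

lemma loop_spec_middle: "cover.loop_spec D g v \<longleftrightarrow> eq_mod (2 * (\<l> g + m g)) (coord fx g D) (of_int v * (\<l> g + m g))"
  by (simp only: cover.loop_spec_def fx_simps(3) fy_simps(3) mult_2)

text \<open>The two edges of the middle loop have the same length, so this loop has torsion
  2.\<close>

lemma loop_spec_middle_cong:
  assumes "even (v - w)"
  shows "cover.loop_spec D g v \<longleftrightarrow> cover.loop_spec D g w"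
proof -
  obtain z where "v - w = 2 * z" using assms by blast
  then have v: "v = w + 2 * z" by simp
  have "eq_mod (2 * (\<l> g + m g)) (of_int v * (\<l> g + m g)) (of_int w * (\<l> g + m g))"
    unfolding eq_mod_def v by (intro exI[of _ z]) (simp add: algebra_simps)
  then show ?thesis unfolding loop_spec_middle using eq_mod_cong[OF eq_mod_refl] by blast
qed

lemma loop_spec_middle_exclusive:
  assumes "cover.loop_spec D g v" "cover.loop_spec D g w"
  shows "even (v - w)"
proof -
  have "eq_mod (2 * (\<l> g + m g)) (of_int v * (\<l> g + m g)) (of_int w * (\<l> g + m g))"
    using assms eq_mod_sym eq_mod_trans unfolding loop_spec_middle by blast
  then obtain z :: int where "of_int v * (\<l> g + m g) = of_int w * (\<l> g + m g) + of_int z * (2 * (\<l> g + m g))"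
    by (auto simp: eq_mod_def)
  then have "(of_int v :: real) * (\<l> g + m g) = of_int (w + 2 * z) * (\<l> g + m g)"
    by (simp add: algebra_simps)
  then have "(of_int v :: real) = of_int (w + 2 * z)" using middle_length_pos by simp
  then have "v = w + 2 * z" by (simp only: of_int_eq_iff)
  then show ?thesis by simp
qed

lemma loop_spec_middle_exists: "eq_mod (\<l> g + m g) (coord fx g D) 0 \<longleftrightarrow> (\<exists>v. cover.loop_spec D g v)"
proof
  assume "eq_mod (\<l> g + m g) (coord fx g D) 0"
  then obtain z :: int where "coord fx g D = of_int z * (\<l> g + m g)" by (auto simp: eq_mod_def)
  then show "\<exists>v. cover.loop_spec D g v" unfolding loop_spec_middle by (metis eq_mod_refl)
next
  assume "\<exists>v. cover.loop_spec D g v"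
  then obtain v z :: int where "coord fx g D = of_int v * (\<l> g + m g) + of_int z * (2 * (\<l> g + m g))"
    unfolding loop_spec_middle by (auto simp: eq_mod_def)
  then have "coord fx g D = 0 + of_int (v + 2 * z) * (\<l> g + m g)" by (simp add: algebra_simps)
  then show "eq_mod (\<l> g + m g) (coord fx g D) 0" unfolding eq_mod_def by blast
qed

text \<open>The shift 2 * g - 2 * a is the coordinate of the canonical divisor on loop
  \<open>a\<close>, in units of the upper arc.\<close>

lemma loop_spec_mirror:
  assumes "prym D" "1 \<le> a" "a < g"
  shows "cover.loop_spec D (2 * g - a) v \<longleftrightarrow> cover.loop_spec D a (v + 2 * int g - 2 * int a)"
proof -
  let ?k = "of_int (2 * int g - 2 * int a) * \<l> a"
  have *: "eq_mod (\<l> a + m a) (coord fx a D - coord fx (2 * g - a) D) ?k"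
    using assms by (simp add: prym_def)
  have "eq_mod (\<l> a + m a) (coord fx (2 * g - a) D) (of_int v * \<l> a) \<longleftrightarrow>
      eq_mod (\<l> a + m a) (coord fx a D) (of_int v * \<l> a + ?k)"
  proof
    assume "eq_mod (\<l> a + m a) (coord fx (2 * g - a) D) (of_int v * \<l> a)"
    from eq_mod_add[OF this *] show "eq_mod (\<l> a + m a) (coord fx a D) (of_int v * \<l> a + ?k)" by simp
  next
    assume "eq_mod (\<l> a + m a) (coord fx a D) (of_int v * \<l> a + ?k)"
    from eq_mod_diff[OF this *] show "eq_mod (\<l> a + m a) (coord fx (2 * g - a) D) (of_int v * \<l> a)" by simp
  qed
  also have "of_int v * \<l> a + ?k = of_int (v + 2 * int g - 2 * int a) * \<l> a" by (simp add: algebra_simps)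
  finally show ?thesis using assms by (simp add: cover.loop_spec_def fx_simps fy_simps)
qed

section \<open>Rank and parity\<close>

definition half_profile :: "(chain_vertex, chain_edge) divisor \<Rightarrow> int \<Rightarrow> int"
  where "half_profile D = left_profile (cover.loop_spec D) (2 * int g - 2) (g - 1)"

lemma rank_ge_iff_half_profile:
  assumes D: "D \<in> divisors_of_degree cover.G (2 * int g - 2)" and "prym D"
  shows "cover.rank_ge D (int e) \<longleftrightarrow>
    (\<forall>x. int e + 1 \<le> half_profile D x) \<or>
    (\<forall>x. int e \<le> half_profile D x) \<and> cover.loop_spec D g (int g - 1 - int e)"
proof -
  have Dd: "D \<in> divisors cover.G" "deg D = 2 * int g - 2" using D by (auto simp: divisors_of_degree_def)
  have Suc: "Suc (2 * g - 1) = 2 * g" using g2 by simp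
  have "cover.rank_ge D (int e) \<longleftrightarrow> (\<forall>\<nu>. (\<Sum>i\<le>2 * g. \<nu> i) = e \<longrightarrow>
      (\<exists>u. winning_path (cover.loop_spec D) (2 * int g - 2) (2 * g - 1) \<nu> u))"
    using cover.rank_ge_iff[OF Dd(1), of e] by (simp only: Dd(2) Suc)
  also have "\<dots> \<longleftrightarrow> (\<forall>x. int e + 1 \<le> half_profile D x) \<or>
      (\<forall>x. int e \<le> half_profile D x) \<and> cover.loop_spec D g (int g - 1 - int e)"
    unfolding half_profile_def
  proof (rule winning_path_iff)
    show "1 \<le> g" using g2 by simp
  qed (fact loop_spec_mirror[OF assms(2)] loop_spec_middle_cong)+
  finally show ?thesis .
qed

text \<open>With M the minimum of the half profile, the rank is M if the middle loop is special at g
  - 1 - M, and M - 1 otherwise. In both cases the rank has the parity for which the middle loop is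
  special. The parity condition thus only concerns the middle coordinate, and for \<open>r\<close>
  of this parity r <= M is the same as being at most the rank.\<close>

lemma rank_condition_iff:
  assumes D: "D \<in> divisors_of_degree cover.G (2 * int g - 2)" and prym: "prym D"
  shows "r \<le> rank_div cover.G D \<and> rank_div cover.G D mod 2 = r mod 2 \<longleftrightarrow>
    cover.loop_spec D g (int g - 1 - r) \<and> (\<forall>x. r \<le> half_profile D x)"
proof -
  let ?h = "half_profile D"
  have h: "is_profile ?h" by (simp add: half_profile_def is_profile_left_profile)
  have nonneg: "0 \<le> ?h x" for x using is_profileD(3)[OF h, of x] by linarith
  define M where "M = (LEAST n. \<exists>x. ?h x = int n)"
  have "\<exists>n x. ?h x = int n" using nonneg by (metis nonneg_int_cases)
  then have "\<exists>x. ?h x = int M" unfolding M_def by (rule LeastI_ex)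
  then obtain x0 where x0: "?h x0 = int M" by blast
  have low: "int M \<le> ?h x" for x
  proof -
    obtain k where "?h x = int k" using nonneg by (metis nonneg_int_cases)
    then show ?thesis unfolding M_def using Least_le[of "\<lambda>n. \<exists>x. ?h x = int n" k] by auto
  qed
  have all_iff: "(\<forall>x. s \<le> ?h x) \<longleftrightarrow> s \<le> int M" for s using low x0 by (metis order_trans)
  note iff = rank_ge_iff_half_profile[OF D prym, unfolded all_iff]
  obtain v where v: "cover.loop_spec D g v" using prym loop_spec_middle_exists by (auto simp: prym_def)
  have spec: "cover.loop_spec D g w \<longleftrightarrow> even (w - v)" for w
    using v loop_spec_middle_cong loop_spec_middle_exclusive by blast
  show ?thesis
  proof (cases "cover.loop_spec D g (int g - 1 - int M)")
    case True
    have "rank_div cover.G D = int M"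
    proof (rule cover.rank_div_eqI)
      show "cover.rank_ge D (int M)" using iff True by simp
      show "int e \<le> int M" if "cover.rank_ge D (int e)" for e using iff[of e] that by auto
    qed simp
    then show ?thesis using True unfolding all_iff spec by (auto; presburger)
  next
    case False
    have "rank_div cover.G D = int M - 1"
    proof (rule cover.rank_div_eqI)
      show "cover.rank_ge D (int M - 1)"
      proof (cases M)
        case 0
        then show ?thesis using cover.rank_ge_minus_one by simp
      next
        case (Suc e)
        then show ?thesis using iff[of e] by simp
      qed
      show "int e \<le> int M - 1" if "cover.rank_ge D (int e)" for e
        using iff[of e] that False by (cases "e = M") auto
    qed simp
    then show ?thesis using False unfolding all_iff spec by (auto; presburger)
  qed
qed

lemma prym_brill_noether_eq:
  "prym_brill_noether (folded_chain g \<l> m b) (chain_of_loops g \<l> m b) \<phi> g r =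
    {div_class cover.G D | D. D \<in> divisors_of_degree cover.G (2 * int g - 2) \<and> prym D \<and>
      cover.loop_spec D g (int g - 1 - r) \<and> (\<forall>x. r \<le> half_profile D x)}"
  unfolding prym_brill_noether_def folded_chain_eq using prym_iff rank_condition_iff by blast

end

section \<open>Tori of divisor classes\<close>

lemma sum_scaleR_apply: "(\<Sum>i\<in>I. u i *\<^sub>R q i) e = (\<Sum>i\<in>I. u i * q i e)"
  for q :: "'i \<Rightarrow> 'e \<Rightarrow> real"
  by (induction I rule: infinite_finite_induct) (simp_all add: scaleR_fun_def)

text \<open>Seen through the evaluations \<open>ev\<close>, the points are a vertex \<open>p\<close>
  and its translates by \<open>K\<close> along distinct coordinate axes.\<close>

lemma affine_independent_funs:
  fixes p :: "'e \<Rightarrow> real" and q :: "'i \<Rightarrow> 'e \<Rightarrow> real"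
  assumes I: "finite I" and K: "K \<noteq> 0"
    and ev: "\<And>a c. a \<in> I \<Longrightarrow> c \<in> I \<Longrightarrow> q c (ev a) = p (ev a) + (if a = c then K else 0)"
  shows "\<not> affine_dependent (insert p (q ` I))" and "card (insert p (q ` I)) = card I + 1"
proof -
  have inj: "inj_on q I"
  proof (rule inj_onI)
    fix a c assume "a \<in> I" "c \<in> I" "q a = q c"
    then have "q a (ev a) = q c (ev a)" by simp
    then show "a = c" using ev[of a a] ev[of a c] \<open>a \<in> I\<close> \<open>c \<in> I\<close> K by (simp split: if_splits)
  qed
  have notin: "p \<notin> q ` I"
  proof
    assume "p \<in> q ` I"
    then obtain a where a: "a \<in> I" "p = q a" by blast
    then have "q a (ev a) = p (ev a)" by simp
    then show False using ev[of a a] a(1) K by simp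
  qed
  show "card (insert p (q ` I)) = card I + 1"
    using I notin by (simp add: card_image[OF inj])
  show "\<not> affine_dependent (insert p (q ` I))"
  proof
    assume "affine_dependent (insert p (q ` I))"
    then obtain U where U: "sum U (insert p (q ` I)) = 0" "\<exists>v\<in>insert p (q ` I). U v \<noteq> 0"
      "(\<Sum>v\<in>insert p (q ` I). U v *\<^sub>R v) = 0"
      using I by (subst (asm) affine_dependent_explicit_finite) auto
    have split: "(\<Sum>v\<in>insert p (q ` I). F v) = F p + (\<Sum>c\<in>I. F (q c))" for F :: "('e \<Rightarrow> real) \<Rightarrow> real"
      using I notin by (simp add: sum.reindex[OF inj])
    have zero: "U (q a) = 0" if a: "a \<in> I" for a
    proof -
      have "0 = (\<Sum>v\<in>insert p (q ` I). U v *\<^sub>R v) (ev a)" using U(3) by simp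
      also have "\<dots> = (\<Sum>v\<in>insert p (q ` I). U v * v (ev a))" by (rule sum_scaleR_apply)
      also have "\<dots> = U p * p (ev a) + (\<Sum>c\<in>I. U (q c) * q c (ev a))" by (rule split)
      also have "(\<Sum>c\<in>I. U (q c) * q c (ev a)) = (\<Sum>c\<in>I. U (q c) * p (ev a) + (if a = c then U (q c) * K else 0))"
        by (rule sum.cong) (use ev[OF a] in \<open>auto simp: algebra_simps\<close>)
      also have "\<dots> = (\<Sum>c\<in>I. U (q c)) * p (ev a) + U (q a) * K"
        using I a by (simp add: sum.distrib sum_distrib_right)
      finally have "(U p + (\<Sum>c\<in>I. U (q c))) * p (ev a) + U (q a) * K = 0" by (simp add: algebra_simps)
      then show ?thesis using U(1) K unfolding split by simp
    qed
    then have "U p = 0" using U(1) unfolding split by simp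
    then show False using zero U(2) by auto
  qed
qed

lemma cycle_chain_cong:
  assumes "\<And>c. c \<in> {1..n} \<Longrightarrow> \<gamma> c = \<gamma>' c"
  shows "cycle_chain n \<gamma> = cycle_chain n \<gamma>'"
proof
  fix e
  show "cycle_chain n \<gamma> e = cycle_chain n \<gamma>' e" by (cases e) (simp_all add: cycle_chain_def assms)
qed

text \<open>Torsion refers to the lower arc and special positions to the upper one, but modulo x + y
  these are negatives of each other. The integers \<open>j\<close> for which j * y is a multiple of
  x + y form a subgroup, generated by its least positive element \<open>k\<close>.\<close>

lemma has_torsion_eq_mod_iff:
  assumes tors: "has_torsion x y k" and L: "0 < x + y"
  shows "eq_mod (x + y) (of_int u * x) (of_int v * x) \<longleftrightarrow> u mod int k = v mod int k"
proof -
  define J where "J j \<longleftrightarrow> (\<exists>z::int. of_int j * y = of_int z * (x + y))" for j :: int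
  have k: "0 < k" "J (int k)" and min: "\<And>j. 0 < j \<Longrightarrow> J (int j) \<Longrightarrow> k \<le> j"
    using tors by (auto simp: has_torsion_def J_def)
  have sub: "J (i - j * c)" if ij: "J i" "J j" for i j c
  proof -
    obtain z w :: int where "of_int i * y = of_int z * (x + y)" "of_int j * y = of_int w * (x + y)"
      using ij by (auto simp: J_def)
    moreover have "of_int (i - j * c) * y = of_int i * y - of_int c * (of_int j * y)"
      by (simp add: algebra_simps)
    ultimately have "of_int (i - j * c) * y = of_int (z - c * w) * (x + y)"
      by (simp add: algebra_simps)
    then show ?thesis unfolding J_def by blast
  qed
  have J_iff: "J j \<longleftrightarrow> int k dvd j" for j
  proof
    assume "J j"
    then have "J (j mod int k)" using sub[OF _ k(2), of j "j div int k"] by (simp add: minus_mult_div_eq_mod)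
    then have "J (int (nat (j mod int k)))" using k by simp
    moreover have "nat (j mod int k) < k" using k by (simp add: nat_less_iff)
    ultimately have "nat (j mod int k) = 0" using min[of "nat (j mod int k)"] by linarith
    then have "j mod int k = 0" using pos_mod_sign[of "int k" j] k by linarith
    then show "int k dvd j" by auto
  next
    assume "int k dvd j"
    then obtain c where "j = int k * c" by blast
    moreover have "J 0" by (auto simp: J_def)
    ultimately show "J j" using sub[OF _ k(2), of 0 "- c"] by simp
  qed
  have "eq_mod (x + y) (of_int u * x) (of_int v * x) \<longleftrightarrow> J (u - v)"
  proof
    assume "eq_mod (x + y) (of_int u * x) (of_int v * x)"
    then obtain z :: int where "of_int u * x = of_int v * x + of_int z * (x + y)" by (auto simp: eq_mod_def)
    then have "of_int (u - v) * y = of_int (u - v - z) * (x + y)" by (simp add: algebra_simps)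
    then show "J (u - v)" unfolding J_def by blast
  next
    assume "J (u - v)"
    then obtain z :: int where "of_int (u - v) * y = of_int z * (x + y)" by (auto simp: J_def)
    then have "of_int u * x = of_int v * x + of_int (u - v - z) * (x + y)" by (simp add: algebra_simps)
    then show "eq_mod (x + y) (of_int u * x) (of_int v * x)" unfolding eq_mod_def by blast
  qed
  then show ?thesis by (simp add: J_iff mod_eq_dvd_iff)
qed

text \<open>A negative value of \<open>\<sigma> a\<close> means that the chip on loop \<open>a\<close> is free.\<close>

definition letter_cond :: "nat \<Rightarrow> (nat \<Rightarrow> int) \<Rightarrow> nat \<Rightarrow> int \<Rightarrow> bool"
  where "letter_cond k \<sigma> a = (if \<sigma> a < 0 then (\<lambda>_. False) else (\<lambda>x. x mod int k = \<sigma> a mod int k))"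

lemma letter_cond_neq_False: "letter_cond k \<sigma> a \<noteq> (\<lambda>_. False) \<longleftrightarrow> 0 \<le> \<sigma> a"
  by (auto simp: letter_cond_def fun_eq_iff)

lemma letters_letter_cond: "letters k (letter_cond k \<sigma>) n"
  by (auto simp: letters_def letter_cond_def)

locale gonal_folded_loops = folded_loops +
  fixes k :: nat and r :: int
  assumes k2: "2 \<le> k" and gonal: "uniform_gonal g \<l> m k"
begin

abbreviation "L a \<equiv> \<l> a + m a"

lemma L_pos: "a \<in> {1..g} \<Longrightarrow> 0 < L a"
  using l_pos[of a] m_pos[of a] by simp

lemma torsion_iff:
  assumes "1 \<le> a" "a < g"
  shows "eq_mod (L a) (of_int u * \<l> a) (of_int v * \<l> a) \<longleftrightarrow> u mod int k = v mod int k"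
  using has_torsion_eq_mod_iff[of "\<l> a" "m a" k] gonal L_pos[of a] assms by (simp add: uniform_gonal_def)

section \<open>Classes with prescribed coordinates\<close>

definition D0 :: "(chain_vertex, chain_edge) divisor"
  where "D0 = of_points (replicate (2 * g - 2) (Vertex (LeftV 1)))"

lemma D0: "D0 \<in> divisors cover.G" "deg D0 = 2 * int g - 2" "D0 \<in> divisors_of_degree cover.G (2 * int g - 2)"
  "a \<in> {1..2 * g - 1} \<Longrightarrow> coord fx a D0 = 0"
proof -
  show 1: "D0 \<in> divisors cover.G"
    unfolding D0_def by (rule of_points_in_divisors) (use g2 in \<open>auto simp: points_simps simp del: One_nat_def\<close>)
  show 2: "deg D0 = 2 * int g - 2" using g2 by (simp add: D0_def deg_of_points of_nat_diff)
  show "D0 \<in> divisors_of_degree cover.G (2 * int g - 2)" using 1 2 by (simp add: divisors_of_degree_def)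
  assume "a \<in> {1..2 * g - 1}"
  then have "loop_coord fx a (Vertex (LeftV 1)) = 0" by (simp add: loop_coord_def)
  then show "coord fx a D0 = 0" by (simp add: D0_def weighted_deg_of_points sum_list_replicate)
qed

text \<open>All coordinates of the base divisor vanish, so \<open>\<gamma> c\<close> is minus the
  coordinate on loop \<open>c\<close> in units of its length.\<close>

definition cls :: "(nat \<Rightarrow> real) \<Rightarrow> (chain_vertex, chain_edge) divisor set"
  where "cls \<gamma> = pic_cover cover.G D0 (cycle_chain (2 * g - 1) \<gamma>)"

lemma in_cls_iff:
  "D \<in> cls \<gamma> \<longleftrightarrow> D \<in> divisors_of_degree cover.G (2 * int g - 2) \<and>
    (\<forall>c\<in>{1..2 * g - 1}. eq_mod (fx c + fy c) (coord fx c D) (- ((fx c + fy c) * \<gamma> c)))"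
  unfolding cls_def cover.pic_cover_chain[OF D0(1)] divisors_of_degree_def D0(2) using D0(4) by auto

lemma cls_eq_div_class:
  assumes "D \<in> cls \<gamma>"
  shows "cls \<gamma> = div_class cover.G D"
proof -
  have D: "D \<in> divisors cover.G" "deg D = 2 * int g - 2"
    "\<And>c. c \<in> {1..2 * g - 1} \<Longrightarrow> eq_mod (fx c + fy c) (coord fx c D) (- ((fx c + fy c) * \<gamma> c))"
    using assms unfolding in_cls_iff divisors_of_degree_def by blast+
  have "D' \<in> cls \<gamma> \<longleftrightarrow> D' \<in> div_class cover.G D" for D'
    unfolding in_cls_iff cover.div_class_chain[OF D(1)] divisors_of_degree_def D(2)
    using eq_mod_cong[OF eq_mod_refl D(3)] by blast
  then show ?thesis by blast
qed

text \<open>Divisors with one chip on each of the 2 * g - 1 loops attain all coordinates.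
  Subtracting a chip at the left end, where every coordinate is 0, corrects the degree.\<close>

lemma cls_nonempty: "cls \<gamma> \<noteq> {}"
proof -
  define R where "R a = (\<Sum>c=Suc a..2 * g - 1. int 1) + int 0" for a
  obtain E where E: "E \<in> divisors cover.G" "deg E = int 0 + (\<Sum>a=1..2 * g - 1. int 1) + int 0"
    "\<And>a. a \<in> {1..2 * g - 1} \<Longrightarrow> eq_mod (fx a + fy a) (coord fx a E)
      (of_int (R a) * fx a + (if (1::nat) = 0 then 0 else - ((fx a + fy a) * \<gamma> a) - of_int (R a) * fx a))"
    unfolding R_def
    by (rule cover.divisor_with_chips[of 0 "\<lambda>_. 1" 0
          "\<lambda>a. - ((fx a + fy a) * \<gamma> a) - of_int ((\<Sum>c=Suc a..2 * g - 1. int 1) + int 0) * fx a"]) blast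
  let ?p = "of_points [Vertex (LeftV 1)] :: (chain_vertex, chain_edge) divisor"
  have p: "?p \<in> divisors cover.G"
    by (rule of_points_in_divisors) (use g2 in \<open>auto simp: points_simps simp del: One_nat_def\<close>)
  have fin: "finite {q. E q \<noteq> 0}" "finite {q. ?p q \<noteq> 0}" using divisorsD(1)[OF E(1)] divisorsD(1)[OF p] by auto
  have "deg (E - ?p) = 2 * int g - 2"
    unfolding deg_diff[OF fin] deg_of_points using E(2) g2 by (simp add: of_nat_diff)
  moreover have "eq_mod (fx a + fy a) (coord fx a (E - ?p)) (- ((fx a + fy a) * \<gamma> a))" if a: "a \<in> {1..2 * g - 1}" for a
  proof -
    have "loop_coord fx a (Vertex (LeftV 1)) = 0" using a by (simp add: loop_coord_def)
    then show ?thesis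
      unfolding weighted_deg_diff[OF fin] weighted_deg_of_points using E(3)[OF a] by simp
  qed
  ultimately have "E - ?p \<in> cls \<gamma>"
    using divisors_diff[OF E(1) p] by (simp add: in_cls_iff divisors_of_degree_def)
  then show ?thesis by blast
qed

definition mirror_index :: "nat \<Rightarrow> nat"
  where "mirror_index c = (if c < g then c else 2 * g - c)"

text \<open>The special position for the residue \<open>\<sigma> a\<close>, normalised as in
  \<open>cls\<close>; on the right half the canonical shift of the Prym condition is added. The
  middle loop has length 2 * L g, hence the denominator 2.\<close>

definition fixed_part :: "(nat \<Rightarrow> int) \<Rightarrow> nat \<Rightarrow> real"
  where "fixed_part \<sigma> c = (let a = mirror_index c in
    if c = g then - of_int (int g - 1 - r) / 2
    else (if \<sigma> a < 0 then 0 else - (of_int (2 * int g - 1 - int a - \<sigma> a) * \<l> a) / L a) +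
      (if g < c then of_int (2 * int g - 2 * int a) * \<l> a / L a else 0))"

text \<open>Loops \<open>a\<close> and 2 * g - a move with the same parameter, so the dimension of
  the torus is the number of free loops with a < g.\<close>

definition torus_point :: "(nat \<Rightarrow> int) \<Rightarrow> (nat \<Rightarrow> real) \<Rightarrow> nat \<Rightarrow> real"
  where "torus_point \<sigma> t c =
    fixed_part \<sigma> c + (if c \<noteq> g \<and> \<sigma> (mirror_index c) < 0 then t (mirror_index c) else 0)"

definition target :: "(nat \<Rightarrow> int) \<Rightarrow> (nat \<Rightarrow> real) \<Rightarrow> nat \<Rightarrow> real"
  where "target \<sigma> t a = (if \<sigma> a < 0 then - (L a * t a) else of_int (2 * int g - 1 - int a - \<sigma> a) * \<l> a)"

lemma in_cls_torus_point_iff: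
  "D \<in> cls (torus_point \<sigma> t) \<longleftrightarrow> D \<in> divisors_of_degree cover.G (2 * int g - 2) \<and> prym D \<and>
    cover.loop_spec D g (int g - 1 - r) \<and> (\<forall>a\<in>{1..<g}. eq_mod (L a) (coord fx a D) (target \<sigma> t a))"
proof -
  define Q where "Q c \<longleftrightarrow> eq_mod (fx c + fy c) (coord fx c D) (- ((fx c + fy c) * torus_point \<sigma> t c))" for c
  have left: "Q a \<longleftrightarrow> eq_mod (L a) (coord fx a D) (target \<sigma> t a)" if "a \<in> {1..<g}" for a
  proof -
    have "L a * torus_point \<sigma> t a = - target \<sigma> t a"
      using that L_pos[of a] by (simp add: torus_point_def fixed_part_def target_def mirror_index_def Let_def)
    then show ?thesis using that by (simp add: Q_def fx_simps fy_simps)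
  qed
  have right: "Q (2 * g - a) \<longleftrightarrow>
      eq_mod (L a) (coord fx (2 * g - a) D) (target \<sigma> t a - of_int (2 * int g - 2 * int a) * \<l> a)" if "a \<in> {1..<g}" for a
  proof -
    have "mirror_index (2 * g - a) = a" "2 * g - a \<noteq> g" "g < 2 * g - a" using that by (auto simp: mirror_index_def)
    then have "L a * torus_point \<sigma> t (2 * g - a) = - (target \<sigma> t a - of_int (2 * int g - 2 * int a) * \<l> a)"
      using that L_pos[of a] by (simp add: torus_point_def fixed_part_def target_def Let_def distrib_left)
    then show ?thesis using that by (simp add: Q_def fx_simps fy_simps)
  qed
  have mid: "Q g \<longleftrightarrow> cover.loop_spec D g (int g - 1 - r)"
  proof -
    have "- ((fx g + fy g) * torus_point \<sigma> t g) = of_int (int g - 1 - r) * L g"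
      by (simp add: torus_point_def fixed_part_def fx_simps fy_simps Let_def field_simps)
    then show ?thesis unfolding Q_def loop_spec_middle by (simp only: middle_length)
  qed
  have split: "(\<forall>c\<in>{1..2 * g - 1}. Q c) \<longleftrightarrow> (\<forall>a\<in>{1..<g}. Q a \<and> Q (2 * g - a)) \<and> Q g"
  proof
    assume "\<forall>c\<in>{1..2 * g - 1}. Q c"
    moreover have "a \<in> {1..2 * g - 1}" "2 * g - a \<in> {1..2 * g - 1}" if "a \<in> {1..<g}" for a
      using that by auto
    moreover have "g \<in> {1..2 * g - 1}" using g2 by auto
    ultimately show "(\<forall>a\<in>{1..<g}. Q a \<and> Q (2 * g - a)) \<and> Q g" by blast
  next
    assume R: "(\<forall>a\<in>{1..<g}. Q a \<and> Q (2 * g - a)) \<and> Q g"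
    show "\<forall>c\<in>{1..2 * g - 1}. Q c"
    proof
      fix c assume c: "c \<in> {1..2 * g - 1}"
      consider "c \<in> {1..<g}" | "c = g" | "2 * g - c \<in> {1..<g}" "c = 2 * g - (2 * g - c)" using c by fastforce
      then show "Q c" using R by cases (blast, blast, metis)
    qed
  qed
  have pair: "Q a \<and> Q (2 * g - a) \<longleftrightarrow> eq_mod (L a) (coord fx a D) (target \<sigma> t a) \<and>
      eq_mod (L a) (coord fx a D - coord fx (2 * g - a) D) (of_int (2 * int g - 2 * int a) * \<l> a)" if "a \<in> {1..<g}" for a
    unfolding left[OF that] right[OF that]
  proof (intro conj_cong refl iffI)
    assume 1: "eq_mod (L a) (coord fx a D) (target \<sigma> t a)"
    {
      assume "eq_mod (L a) (coord fx (2 * g - a) D) (target \<sigma> t a - of_int (2 * int g - 2 * int a) * \<l> a)"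
      from eq_mod_diff[OF 1 this]
      show "eq_mod (L a) (coord fx a D - coord fx (2 * g - a) D) (of_int (2 * int g - 2 * int a) * \<l> a)" by simp
    next
      assume "eq_mod (L a) (coord fx a D - coord fx (2 * g - a) D) (of_int (2 * int g - 2 * int a) * \<l> a)"
      from eq_mod_diff[OF 1 this]
      show "eq_mod (L a) (coord fx (2 * g - a) D) (target \<sigma> t a - of_int (2 * int g - 2 * int a) * \<l> a)" by simp
    }
  qed
  have "eq_mod (L g) (coord fx g D) 0" if "cover.loop_spec D g (int g - 1 - r)"
    using that loop_spec_middle_exists by blast
  then show ?thesis
    unfolding in_cls_iff Q_def[symmetric] split mid prym_def using pair by blast
qed

text \<open>The reindexing of \<open>left_profile\<close> for degree 2 * g - 2.\<close>

definition spec_letter :: "(chain_vertex, chain_edge) divisor \<Rightarrow> nat \<Rightarrow> int \<Rightarrow> bool"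
  where "spec_letter D a x \<longleftrightarrow> cover.loop_spec D a (2 * int g - 1 - int a - x)"

lemma half_profile_eq: "half_profile D = profile (spec_letter D) (g - 1)"
proof -
  have "(\<lambda>a x. cover.loop_spec D a (2 * int g - 2 + 1 - int a - x)) = spec_letter D"
    by (auto simp: spec_letter_def fun_eq_iff)
  then show ?thesis by (simp add: half_profile_def left_profile_def)
qed

lemma spec_letter_iff:
  "a \<in> {1..<g} \<Longrightarrow> spec_letter D a x \<longleftrightarrow> eq_mod (L a) (coord fx a D) (of_int (2 * int g - 1 - int a - x) * \<l> a)"
  by (simp add: spec_letter_def cover.loop_spec_def fx_simps fy_simps)

lemma letter_torsion:
  assumes "a \<in> {1..<g}"
  shows "eq_mod (L a) (of_int (2 * int g - 1 - int a - x) * \<l> a) (of_int (2 * int g - 1 - int a - x') * \<l> a) \<longleftrightarrow>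
    x mod int k = x' mod int k"
proof -
  have "(2 * int g - 1 - int a - x) mod int k = (2 * int g - 1 - int a - x') mod int k \<longleftrightarrow> x' mod int k = x mod int k"
    by (simp add: mod_eq_dvd_iff)
  moreover have "1 \<le> a" "a < g" using assms by auto
  ultimately show ?thesis by (simp only: torsion_iff eq_commute)
qed

definition good :: "(nat \<Rightarrow> int) \<Rightarrow> bool"
  where "good \<sigma> \<longleftrightarrow> (\<forall>x. r \<le> profile (letter_cond k \<sigma>) (g - 1) x)"

text \<open>A free coordinate of \<open>D\<close> may happen to be special, so \<open>D\<close> has
  at least the letters of \<open>\<sigma>\<close>; its profile can only be larger.\<close>

lemma good_class:
  assumes "good \<sigma>" and D: "D \<in> cls (torus_point \<sigma> t)"
  shows "r \<le> half_profile D x"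
proof -
  have "profile (letter_cond k \<sigma>) (g - 1) x \<le> profile (spec_letter D) (g - 1) x"
  proof (rule profile_mono)
    fix i x assume i: "1 \<le> i" "i \<le> g - 1" and c: "letter_cond k \<sigma> i x"
    then have i': "i \<in> {1..<g}" by auto
    have \<sigma>: "0 \<le> \<sigma> i" "x mod int k = \<sigma> i mod int k" using c by (auto simp: letter_cond_def split: if_splits)
    have "eq_mod (L i) (coord fx i D) (target \<sigma> t i)"
      using D i' unfolding in_cls_torus_point_iff by blast
    moreover have "target \<sigma> t i = of_int (2 * int g - 1 - int i - \<sigma> i) * \<l> i"
      using \<sigma>(1) by (simp add: target_def)
    ultimately have "eq_mod (L i) (coord fx i D) (of_int (2 * int g - 1 - int i - \<sigma> i) * \<l> i)"
      by (simp only:)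
    moreover have "eq_mod (L i) (of_int (2 * int g - 1 - int i - \<sigma> i) * \<l> i) (of_int (2 * int g - 1 - int i - x) * \<l> i)"
      using letter_torsion[OF i'] \<sigma>(2) by simp
    ultimately show "spec_letter D i x" unfolding spec_letter_iff[OF i'] by (rule eq_mod_trans)
  qed
  moreover have "r \<le> profile (letter_cond k \<sigma>) (g - 1) x" using assms(1) by (simp add: good_def)
  ultimately show ?thesis unfolding half_profile_eq by linarith
qed

text \<open>If \<open>\<sigma>\<close> records the residue of every loop on which \<open>D\<close>
  is special, and no others, then its letters are exactly those of \<open>D\<close> and the profiles
  agree.\<close>

lemma class_assignment:
  assumes D: "D \<in> divisors_of_degree cover.G (2 * int g - 2)" "prym D" "cover.loop_spec D g (int g - 1 - r)"
    and r: "\<And>x. r \<le> half_profile D x"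
  obtains \<sigma> t where "\<sigma> \<in> PiE {1..<g} (\<lambda>_. {- 1..<int k})" "good \<sigma>" "D \<in> cls (torus_point \<sigma> t)"
proof -
  define s where "s a = (if \<exists>x. spec_letter D a x then (SOME x. spec_letter D a x) mod int k else - 1)" for a
  define \<sigma> where "\<sigma> = restrict s {1..<g}"
  have m: "0 \<le> y mod int k" "y mod int k < int k" for y using k2 by simp_all
  have s: "s a < 0 \<longleftrightarrow> (\<forall>x. \<not> spec_letter D a x)" "- 1 \<le> s a" "s a < int k" for a
  proof (atomize(full), cases "\<exists>x. spec_letter D a x")
    case True
    then have "s a = (SOME x. spec_letter D a x) mod int k" by (simp add: s_def)
    then have "0 \<le> s a" "s a < int k" using m by simp_all
    then show "(s a < 0 \<longleftrightarrow> (\<forall>x. \<not> spec_letter D a x)) \<and> - 1 \<le> s a \<and> s a < int k" using True by auto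
  next
    case False
    then have "s a = - 1" by (simp add: s_def)
    then show "(s a < 0 \<longleftrightarrow> (\<forall>x. \<not> spec_letter D a x)) \<and> - 1 \<le> s a \<and> s a < int k" using False by auto
  qed
  have letter: "letter_cond k \<sigma> a = spec_letter D a" if a: "a \<in> {1..<g}" for a
  proof
    fix x
    show "letter_cond k \<sigma> a x = spec_letter D a x"
    proof (cases "\<exists>x. spec_letter D a x")
      case True
      then have y: "spec_letter D a (SOME x. spec_letter D a x)" by (rule someI_ex)
      define y where "y = (SOME x. spec_letter D a x)"
      have sy: "s a = y mod int k" "0 \<le> s a" using True k2 by (auto simp: s_def y_def)
      have "spec_letter D a x \<longleftrightarrow> x mod int k = y mod int k"
        unfolding spec_letter_iff[OF a] letter_torsion[OF a, symmetric]
        using y[folded y_def, unfolded spec_letter_iff[OF a]] eq_mod_sym eq_mod_trans by blast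
      then show ?thesis using a sy by (simp add: letter_cond_def \<sigma>_def)
    next
      case False
      then show ?thesis using a s(1)[of a] by (simp add: letter_cond_def \<sigma>_def)
    qed
  qed
  show thesis
  proof (rule that)
    show "\<sigma> \<in> PiE {1..<g} (\<lambda>_. {- 1..<int k})" using s(2,3) by (auto simp: \<sigma>_def)
    have "profile (letter_cond k \<sigma>) (g - 1) = half_profile D"
      unfolding half_profile_eq by (rule profile_cong) (use letter in auto)
    then show "good \<sigma>" using r by (simp add: good_def)
    have "eq_mod (L a) (coord fx a D) (target \<sigma> (\<lambda>a. - coord fx a D / L a) a)" if a: "a \<in> {1..<g}" for a
    proof (cases "\<sigma> a < 0")
      case True
      then show ?thesis using L_pos[of a] a by (simp add: target_def)
    next
      case False
      then have "letter_cond k \<sigma> a (\<sigma> a)" by (simp add: letter_cond_def)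
      then have "spec_letter D a (\<sigma> a)" using letter[OF a] by simp
      then show ?thesis using False unfolding spec_letter_iff[OF a] by (simp add: target_def)
    qed
    then show "D \<in> cls (torus_point \<sigma> (\<lambda>a. - coord fx a D / L a))"
      unfolding in_cls_torus_point_iff using D by blast
  qed
qed

section \<open>Simplices covering the tori\<close>

definition free_loops :: "(nat \<Rightarrow> int) \<Rightarrow> nat set"
  where "free_loops \<sigma> = {a \<in> {1..<g}. \<sigma> a < 0}"

definition torus_chain :: "(nat \<Rightarrow> int) \<Rightarrow> (nat \<Rightarrow> real) \<Rightarrow> chain_edge \<Rightarrow> real"
  where "torus_chain \<sigma> t = cycle_chain (2 * g - 1) (torus_point \<sigma> t)"

text \<open>A simplex which contains a fundamental domain of the torus.\<close>

definition torus_simplex :: "(nat \<Rightarrow> int) \<Rightarrow> (chain_edge \<Rightarrow> real) set"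
  where "torus_simplex \<sigma> = insert (torus_chain \<sigma> (\<lambda>_. 0))
    ((\<lambda>a. torus_chain \<sigma> (\<lambda>c. if c = a then real (card (free_loops \<sigma>)) + 1 else 0)) ` free_loops \<sigma>)"

lemma torus_chain_affine:
  assumes "finite I" "(\<Sum>i\<in>I. u i) = 1"
  shows "(\<Sum>i\<in>I. u i *\<^sub>R torus_chain \<sigma> (T i)) = torus_chain \<sigma> (\<lambda>a. \<Sum>i\<in>I. u i * T i a)"
proof
  fix e
  have pt: "(\<Sum>i\<in>I. u i * torus_point \<sigma> (T i) c) = torus_point \<sigma> (\<lambda>a. \<Sum>i\<in>I. u i * T i a) c" for c
  proof -
    have "(\<Sum>i\<in>I. u i * fixed_part \<sigma> c) = fixed_part \<sigma> c"
      using assms(2) by (simp flip: sum_distrib_right)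
    then show ?thesis by (simp add: torus_point_def distrib_left sum.distrib)
  qed
  show "(\<Sum>i\<in>I. u i *\<^sub>R torus_chain \<sigma> (T i)) e = torus_chain \<sigma> (\<lambda>a. \<Sum>i\<in>I. u i * T i a) e"
    unfolding sum_scaleR_apply torus_chain_def
  proof (cases e)
    case (Upper c)
    then show "(\<Sum>i\<in>I. u i * cycle_chain (2 * g - 1) (torus_point \<sigma> (T i)) e) =
        cycle_chain (2 * g - 1) (torus_point \<sigma> (\<lambda>a. \<Sum>i\<in>I. u i * T i a)) e"
      by (cases "c \<in> {1..2 * g - 1}") (auto simp: cycle_chain_def pt[symmetric])
  next
    case (Lower c)
    then show "(\<Sum>i\<in>I. u i * cycle_chain (2 * g - 1) (torus_point \<sigma> (T i)) e) =
        cycle_chain (2 * g - 1) (torus_point \<sigma> (\<lambda>a. \<Sum>i\<in>I. u i * T i a)) e"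
      by (cases "c \<in> {1..2 * g - 1}") (auto simp: cycle_chain_def pt[symmetric] sum_negf)
  qed (simp add: cycle_chain_def)
qed

lemma free_loops_finite: "finite (free_loops \<sigma>)"
  by (simp add: free_loops_def)

lemma torus_simplex:
  shows "finite (torus_simplex \<sigma>)" "torus_simplex \<sigma> \<noteq> {}" "torus_simplex \<sigma> \<subseteq> homology1 cover.G"
    and "\<not> affine_dependent (torus_simplex \<sigma>)" "card (torus_simplex \<sigma>) = card (free_loops \<sigma>) + 1"
proof -
  let ?K = "real (card (free_loops \<sigma>)) + 1"
  show "finite (torus_simplex \<sigma>)" "torus_simplex \<sigma> \<noteq> {}"
    by (simp_all add: torus_simplex_def free_loops_finite)
  show "torus_simplex \<sigma> \<subseteq> homology1 cover.G"
    unfolding torus_simplex_def torus_chain_def using cover.cycle_chain_in_homology1 by blast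
  have "torus_chain \<sigma> (\<lambda>d. if d = c then ?K else 0) (Upper a) =
      torus_chain \<sigma> (\<lambda>_. 0) (Upper a) + (if a = c then ?K else 0)"
    if "a \<in> free_loops \<sigma>" "c \<in> free_loops \<sigma>" for a c
    using that by (auto simp: torus_chain_def cycle_chain_def torus_point_def mirror_index_def free_loops_def)
  note indep = affine_independent_funs[where ev = Upper, OF free_loops_finite _ this]
  show "\<not> affine_dependent (torus_simplex \<sigma>)" "card (torus_simplex \<sigma>) = card (free_loops \<sigma>) + 1"
    unfolding torus_simplex_def using indep by (auto simp: add_nonneg_eq_0_iff)
qed

lemma torus_simplex_hull_subset: "convex hull (torus_simplex \<sigma>) \<subseteq> range (torus_chain \<sigma>)"
proof (rule hull_minimal)
  show "torus_simplex \<sigma> \<subseteq> range (torus_chain \<sigma>)" by (auto simp: torus_simplex_def)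
  show "convex (range (torus_chain \<sigma>))"
  proof (rule convexI)
    fix p q :: "chain_edge \<Rightarrow> real" and u v :: real
    assume "p \<in> range (torus_chain \<sigma>)" "q \<in> range (torus_chain \<sigma>)" and uv: "0 \<le> u" "0 \<le> v" "u + v = 1"
    then obtain t t' where t: "p = torus_chain \<sigma> t" "q = torus_chain \<sigma> t'" by auto
    have "(\<Sum>i\<in>{True, False}. (if i then u else v) *\<^sub>R torus_chain \<sigma> (if i then t else t')) \<in> range (torus_chain \<sigma>)"
      by (subst torus_chain_affine) (use uv in auto)
    then show "u *\<^sub>R p + v *\<^sub>R q \<in> range (torus_chain \<sigma>)" by (simp add: t)
  qed
qed

lemma cube_subset_torus_simplex_hull:
  assumes t: "\<And>a. 0 \<le> t a" "\<And>a. t a \<le> 1"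
  shows "torus_chain \<sigma> t \<in> convex hull (torus_simplex \<sigma>)"
proof -
  let ?F = "free_loops \<sigma>"
  \<comment> \<open>Parameters in [0, 1] add up to at most the number of free loops, so the unit
    cube lies in the standard simplex scaled by \<open>K\<close>. The additional 1 keeps
    \<open>K\<close> positive when no loop is free.\<close>
  define K where "K = real (card ?F) + 1"
  have K: "0 < K" by (simp add: K_def add_nonneg_pos)
  \<comment> \<open>Barycentric coordinates; index 0 stands for the base vertex, which is possible
    as loops are numbered from 1.\<close>
  define u where "u a = (if a = 0 then 1 - (\<Sum>c\<in>?F. t c / K) else t a / K)" for a :: nat
  define T where "T a = (\<lambda>c. if a \<noteq> 0 \<and> c = a then K else 0)" for a :: nat
  have F: "finite ?F" "0 \<notin> ?F" by (auto simp: free_loops_def)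
  have neq0: "a \<noteq> 0" if "a \<in> ?F" for a using that F by metis
  have uF: "(\<Sum>a\<in>?F. u a * f a) = (\<Sum>a\<in>?F. t a / K * f a)" for f
    by (rule sum.cong) (use neq0 in \<open>auto simp: u_def\<close>)
  have "(\<Sum>a\<in>insert 0 ?F. u a) = 1"
    using F uF[of "\<lambda>_. 1"] by (simp add: u_def)
  have le: "(\<Sum>c\<in>?F. t c / K) \<le> 1"
  proof -
    have "(\<Sum>c\<in>?F. t c / K) \<le> (\<Sum>c\<in>?F. 1 / K)"
      by (rule sum_mono) (use t K in \<open>simp add: divide_right_mono\<close>)
    also have "\<dots> \<le> 1" using K by (simp add: K_def)
    finally show ?thesis .
  qed
  have "(\<Sum>a\<in>insert 0 ?F. u a *\<^sub>R torus_chain \<sigma> (T a)) \<in> convex hull (torus_simplex \<sigma>)"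
  proof (rule convex_sum)
    show "(\<Sum>a\<in>insert 0 ?F. u a) = 1" by fact
    show "0 \<le> u a" if "a \<in> insert 0 ?F" for a using le t K by (simp add: u_def)
    show "torus_chain \<sigma> (T a) \<in> convex hull (torus_simplex \<sigma>)" if a: "a \<in> insert 0 ?F" for a
    proof (rule hull_inc)
      show "torus_chain \<sigma> (T a) \<in> torus_simplex \<sigma>"
      proof (cases "a = 0")
        case True
        then show ?thesis by (simp add: torus_simplex_def T_def)
      next
        case False
        then have T: "T a = (\<lambda>c. if c = a then real (card ?F) + 1 else 0)" and "a \<in> ?F"
          using a by (auto simp: T_def K_def)
        then show ?thesis
          unfolding torus_simplex_def T by (intro insertI2 image_eqI[where x = a]) simp_all
      qed
    qed
  qed (use F in auto)
  also have "(\<Sum>a\<in>insert 0 ?F. u a *\<^sub>R torus_chain \<sigma> (T a)) = torus_chain \<sigma> (\<lambda>c. \<Sum>a\<in>insert 0 ?F. u a * T a c)"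
    by (rule torus_chain_affine) (use F in simp, fact)
  also have "\<dots> = torus_chain \<sigma> t"
  proof -
    have coef: "(\<Sum>a\<in>insert 0 ?F. u a * T a c) = t c" if "c \<in> ?F" for c
    proof -
      have "(\<Sum>a\<in>insert 0 ?F. u a * T a c) = (\<Sum>a\<in>insert 0 ?F. if a = c then u c * K else 0)"
        by (rule sum.cong) (use neq0[OF that] in \<open>auto simp: T_def\<close>)
      then show ?thesis using that F neq0[OF that] K by (simp add: u_def)
    qed
    have "torus_point \<sigma> f c = torus_point \<sigma> f' c"
      if "c \<in> {1..2 * g - 1}" "\<And>a. a \<in> ?F \<Longrightarrow> f a = f' a" for f f' c
    proof (cases "c \<noteq> g \<and> \<sigma> (mirror_index c) < 0")
      case True
      then have "mirror_index c \<in> ?F" using that(1) by (auto simp: free_loops_def mirror_index_def)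
      then show ?thesis using that(2) by (simp add: torus_point_def)
    next
      case False
      then show ?thesis unfolding torus_point_def by (simp only: if_False)
    qed
    from this[OF _ coef] show ?thesis unfolding torus_chain_def by (intro cycle_chain_cong)
  qed
  finally show ?thesis .
qed

text \<open>Changing a parameter by an integer changes the coordinate by a multiple of the length of
  the loop and hence not the class. So the unit cube, and with it the simplex, already yields the
  whole torus.\<close>

lemma cls_torus_simplex:
  "pic_cover cover.G D0 ` (convex hull (torus_simplex \<sigma>)) = {cls (torus_point \<sigma> t) | t. True}"
proof
  have "pic_cover cover.G D0 ` range (torus_chain \<sigma>) = {cls (torus_point \<sigma> t) | t. True}"
    by (auto simp: cls_def torus_chain_def)
  then show "pic_cover cover.G D0 ` (convex hull (torus_simplex \<sigma>)) \<subseteq> {cls (torus_point \<sigma> t) | t. True}"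
    using image_mono[OF torus_simplex_hull_subset, of "pic_cover cover.G D0" \<sigma>] by simp
next
  show "{cls (torus_point \<sigma> t) | t. True} \<subseteq> pic_cover cover.G D0 ` (convex hull (torus_simplex \<sigma>))"
  proof
    fix S assume "S \<in> {cls (torus_point \<sigma> t) | t. True}"
    then obtain t where S: "S = cls (torus_point \<sigma> t)" by blast
    define t' where "t' = (\<lambda>a. frac (t a))"
    have "eq_mod (L a) (target \<sigma> t a) (target \<sigma> t' a)" for a
    proof -
      have "target \<sigma> t a = target \<sigma> t' a + of_int (if \<sigma> a < 0 then - \<lfloor>t a\<rfloor> else 0) * L a"
        by (simp add: target_def t'_def frac_def algebra_simps)
      then show ?thesis unfolding eq_mod_def by blast
    qed
    from eq_mod_cong[OF eq_mod_refl this] have "D \<in> cls (torus_point \<sigma> t) \<longleftrightarrow> D \<in> cls (torus_point \<sigma> t')" for D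
      unfolding in_cls_torus_point_iff by blast
    then have "S = cls (torus_point \<sigma> t')" using S by blast
    moreover have "torus_chain \<sigma> t' \<in> convex hull (torus_simplex \<sigma>)"
      by (rule cube_subset_torus_simplex_hull) (auto simp: t'_def frac_lt_1 less_imp_le)
    ultimately show "S \<in> pic_cover cover.G D0 ` (convex hull (torus_simplex \<sigma>))"
      unfolding cls_def torus_chain_def by blast
  qed
qed

section \<open>The locus as a finite union of tori and its dimension\<close>

definition assignments :: "(nat \<Rightarrow> int) set"
  where "assignments = {\<sigma> \<in> PiE {1..<g} (\<lambda>_. {- 1..<int k}). good \<sigma>}"

lemma finite_assignments: "finite assignments"
  unfolding assignments_def by (rule finite_subset[OF _ finite_PiE[of "{1..<g}" "\<lambda>_. {- 1..<int k}"]]) auto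

lemma prym_brill_noether_eq_tori:
  "prym_brill_noether (folded_chain g \<l> m b) (chain_of_loops g \<l> m b) \<phi> g r =
    (\<Union>\<sigma>\<in>assignments. pic_cover cover.G D0 ` (convex hull (torus_simplex \<sigma>)))"
  unfolding prym_brill_noether_eq cls_torus_simplex
proof (intro equalityI subsetI)
  fix S assume "S \<in> {div_class cover.G D | D. D \<in> divisors_of_degree cover.G (2 * int g - 2) \<and> prym D \<and>
      cover.loop_spec D g (int g - 1 - r) \<and> (\<forall>x. r \<le> half_profile D x)}"
  then obtain D where S: "S = div_class cover.G D" and D: "D \<in> divisors_of_degree cover.G (2 * int g - 2)" "prym D"
    "cover.loop_spec D g (int g - 1 - r)" "\<And>x. r \<le> half_profile D x" by blast
  obtain \<sigma> t where "\<sigma> \<in> PiE {1..<g} (\<lambda>_. {- 1..<int k})" "good \<sigma>" "D \<in> cls (torus_point \<sigma> t)"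
    by (rule class_assignment[OF D])
  then have "\<sigma> \<in> assignments" "S = cls (torus_point \<sigma> t)" using S cls_eq_div_class by (auto simp: assignments_def)
  then show "S \<in> (\<Union>\<sigma>\<in>assignments. {cls (torus_point \<sigma> t) | t. True})" by blast
next
  fix S assume "S \<in> (\<Union>\<sigma>\<in>assignments. {cls (torus_point \<sigma> t) | t. True})"
  then obtain \<sigma> t where \<sigma>: "good \<sigma>" and S: "S = cls (torus_point \<sigma> t)" by (auto simp: assignments_def)
  obtain D where D: "D \<in> cls (torus_point \<sigma> t)" using cls_nonempty by blast
  then have "S = div_class cover.G D" using S cls_eq_div_class by blast
  then show "S \<in> {div_class cover.G D | D. D \<in> divisors_of_degree cover.G (2 * int g - 2) \<and> prym D \<and>
      cover.loop_spec D g (int g - 1 - r) \<and> (\<forall>x. r \<le> half_profile D x)}"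
    using D[unfolded in_cls_torus_point_iff] good_class[OF \<sigma> D] by blast
qed

lemma free_loops_le:
  assumes "good \<sigma>"
  shows "int (card (free_loops \<sigma>)) \<le> int g - 1 - staircase_cost r k"
proof -
  let ?N = "{a \<in> {1..g - 1}. letter_cond k \<sigma> a \<noteq> (\<lambda>_. False)}"
  have "staircase_cost r k \<le> int (card ?N)"
    by (rule staircase_cost_le[OF k2 letters_letter_cond]) (use assms in \<open>simp add: good_def\<close>)
  moreover have "card (free_loops \<sigma>) + card ?N = g - 1"
  proof -
    have "free_loops \<sigma> \<union> ?N = {1..g - 1}" "free_loops \<sigma> \<inter> ?N = {}"
      unfolding free_loops_def letter_cond_neq_False by auto
    then show ?thesis using card_Un_disjoint[OF free_loops_finite, of ?N \<sigma>] by simp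
  qed
  ultimately show ?thesis using g2 by linarith
qed

text \<open>The cheapest word is placed on the first \<open>N\<close> loops and all later loops are
  left free.\<close>

lemma ex_free_loops_eq:
  assumes "staircase_cost r k \<le> int g - 1"
  obtains \<sigma> where "\<sigma> \<in> assignments" "int (card (free_loops \<sigma>)) = int g - 1 - staircase_cost r k"
proof -
  define N where "N = nat (staircase_cost r k)"
  have cost: "0 \<le> staircase_cost r k" by (simp add: staircase_cost_def sum_nonneg)
  then have N: "int N = staircase_cost r k" "N \<le> g - 1" using assms by (auto simp: N_def)
  obtain w where w: "\<And>x. r \<le> word_profile k w N x" using staircase_word[OF k2, of r] by (auto simp: N_def)
  define \<sigma> where "\<sigma> = restrict (\<lambda>a. if a \<le> N then w a mod int k else - 1) {1..<g}"
  have neg: "\<sigma> a < 0 \<longleftrightarrow> N < a" if "a \<in> {1..<g}" for a using that k2 by (auto simp: \<sigma>_def not_less)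
  obtain d where d: "g - 1 = N + d" using N(2) le_Suc_ex by blast
  have "profile (letter_cond k \<sigma>) (g - 1) = profile (letter_cond k \<sigma>) N"
    unfolding d by (rule profile_False) (use neg d in \<open>auto simp: letter_cond_def\<close>)
  also have "\<dots> = word_profile k w N"
    unfolding word_profile_def
  proof (rule profile_cong)
    fix i assume i: "1 \<le> i" "i \<le> N"
    then have "i \<in> {1..<g}" using N(2) g2 by auto
    then show "letter_cond k \<sigma> i = (\<lambda>x. x mod int k = w i mod int k)"
      using i neg[of i] by (simp add: letter_cond_def \<sigma>_def)
  qed
  finally have "good \<sigma>" using w by (simp add: good_def)
  moreover have "\<sigma> \<in> PiE {1..<g} (\<lambda>_. {- 1..<int k})"
  proof -
    have "- 1 \<le> w a mod int k" "w a mod int k < int k" for a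
      using pos_mod_sign[of "int k" "w a"] pos_mod_bound[of "int k" "w a"] k2 by linarith+
    then show ?thesis using k2 by (auto simp: \<sigma>_def)
  qed
  ultimately have "\<sigma> \<in> assignments" by (simp add: assignments_def)
  moreover have "free_loops \<sigma> = {N<..<g}" using neg by (auto simp: free_loops_def)
  then have "int (card (free_loops \<sigma>)) = int g - 1 - staircase_cost r k" using N g2 by (simp add: of_nat_diff flip: N(1))
  ultimately show thesis by (rule that)
qed

lemma prym_brill_noether_dim:
  shows "int g - 1 < staircase_cost r k \<Longrightarrow>
      prym_brill_noether (folded_chain g \<l> m b) (chain_of_loops g \<l> m b) \<phi> g r = {}"
    and "staircase_cost r k \<le> int g - 1 \<Longrightarrow>
      has_pic_dim (folded_chain g \<l> m b) (2 * int g - 2)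
        (prym_brill_noether (folded_chain g \<l> m b) (chain_of_loops g \<l> m b) \<phi> g r) (int g - 1 - staircase_cost r k)"
proof -
  have le: "int (card (free_loops \<sigma>)) \<le> int g - 1 - staircase_cost r k" if "\<sigma> \<in> assignments" for \<sigma>
    using that free_loops_le by (simp add: assignments_def)
  show "prym_brill_noether (folded_chain g \<l> m b) (chain_of_loops g \<l> m b) \<phi> g r = {}"
    if "int g - 1 < staircase_cost r k"
  proof -
    have "assignments = {}" using le that by fastforce
    then show ?thesis unfolding prym_brill_noether_eq_tori by simp
  qed
  assume cost: "staircase_cost r k \<le> int g - 1"
  obtain \<tau> where \<tau>: "\<tau> \<in> assignments" "int (card (free_loops \<tau>)) = int g - 1 - staircase_cost r k"
    by (rule ex_free_loops_eq[OF cost])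
  have "Max (card ` torus_simplex ` assignments) = card (free_loops \<tau>) + 1"
  proof (rule Max_eqI)
    fix y assume "y \<in> card ` torus_simplex ` assignments"
    then obtain \<sigma> where "\<sigma> \<in> assignments" "y = card (free_loops \<sigma>) + 1" using torus_simplex(5) by auto
    then show "y \<le> card (free_loops \<tau>) + 1" using le[of \<sigma>] \<tau>(2) by simp
  next
    show "card (free_loops \<tau>) + 1 \<in> card ` torus_simplex ` assignments"
      using \<tau>(1) torus_simplex(5)[of \<tau>] by (metis image_eqI)
  qed (use finite_assignments in simp)
  then have dim: "int g - 1 - staircase_cost r k = int (Max (card ` torus_simplex ` assignments)) - 1"
    using \<tau>(2) by simp
  show "has_pic_dim (folded_chain g \<l> m b) (2 * int g - 2)
      (prym_brill_noether (folded_chain g \<l> m b) (chain_of_loops g \<l> m b) \<phi> g r) (int g - 1 - staircase_cost r k)"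
    unfolding prym_brill_noether_eq_tori unfolding has_pic_dim_def folded_chain_eq
  proof (intro bexI[of _ D0] exI[of _ "torus_simplex ` assignments"] conjI)
    show "finite (torus_simplex ` assignments)" using finite_assignments by simp
    show "torus_simplex ` assignments \<noteq> {}" using \<tau>(1) by blast
    show "\<forall>C\<in>torus_simplex ` assignments. finite C \<and> C \<noteq> {} \<and> C \<subseteq> homology1 cover.G \<and> \<not> affine_dependent C"
      using torus_simplex(1-4) by blast
  qed (use dim D0(3) in auto)
qed

end

theorem theorem1:
  fixes g k :: nat and r :: int and \<l> m b :: "nat \<Rightarrow> real"
  assumes "2 \<le> g" and "2 \<le> k" and "- 1 \<le> r"
    and "\<And>a. a \<in> {1..g} \<Longrightarrow> 0 < \<l> a" and "\<And>a. a \<in> {1..g} \<Longrightarrow> 0 < m a"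
    and "\<And>a. a \<in> {1..<g} \<Longrightarrow> 0 < b a"
    and "uniform_gonal g \<l> m k"
  defines "V \<equiv> prym_brill_noether (folded_chain g \<l> m b) (chain_of_loops g \<l> m b)
                 (folding_map g \<l> m b) g r"
  shows "(int g - 1 < pbn_codim r k \<longrightarrow> V = {}) \<and>
    (pbn_codim r k \<le> int g - 1 \<longrightarrow>
      has_pic_dim (folded_chain g \<l> m b) (2 * int g - 2) V (int g - 1 - pbn_codim r k))"
proof -
  interpret gonal_folded_loops g \<l> m b k r
    by unfold_locales (use assms in auto)
  show ?thesis
    unfolding V_def pbn_codim_eq[OF assms(2,3)] using prym_brill_noether_dim by blast
qed

end
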